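(* Let $f(z)$ be an extremal quasimodular form of weight $k$ and depth $2$ on $\mathrm{SL}(2,\mathbb{Z})$ and let $$D_q^3y(z)+Q(z)D_qy(z)+\left(\tfrac12D_qQ(z)+R(z)\right)y(z)=0$$ be the differential equation satisfied by $f(z)/\sqrt[3]{W_f(z)}$, as described in the context. (i) If $k\equiv0\bmod 4$, then $$Q(z)=-\frac{k^2}{48}E_4(z),\qquad R(z)=-\frac{k^3}{864}E_6(z).$$ (ii) If $k\equiv2\bmod4$, then $$Q(z)=-\frac{(k-2)^2}{48}E_4(z)-\frac13\,\frac{E_4(z)\big(E_4(z)^3-E_6(z)^2\big)}{E_6(z)^2}$$ and $$R(z)=-\frac{(k-2)^3}{864}E_6(z)+\frac5{54}\,\frac{\big(E_4(z)^3-E_6(z)^2\big)^2}{E_6(z)^3}+\frac{12-(k-2)^2}{144}\,\frac{E_4(z)^3-E_6(z)^2}{E_6(z)}.$$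
   Context: $q=e^{2\pi \mathrm i z}$, $'=\frac{d}{dz}$, $D_q=q\frac{d}{dq}=\frac1{2\pi \mathrm i}\frac{d}{dz}$; $E_2,E_4,E_6$ are the Eisenstein series $E_2=1-24\sum\frac{nq^n}{1-q^n}$, $E_4=1+240\sum\frac{n^3q^n}{1-q^n}$, $E_6=1-504\sum\frac{n^5q^n}{1-q^n}$. $\widetilde{\mathfrak M}_k^{\le 2}(\mathrm{SL}(2,\mathbb{Z}))$ is the space of quasimodular forms of weight $k$ and depth $\le2$, i.e. functions $f=f_0+f_1E_2+f_2E_2^2$ with $f_j$ a holomorphic modular form of weight $k-2j$ on $\mathrm{SL}(2,\mathbb{Z})$; the depth is $2$ if $f_2\not\equiv0$. Such an $f$ is extremal if its vanishing order at $\infty$ (in $q$) equals $\dim\widetilde{\mathfrak M}_k^{\le 2}(\mathrm{SL}(2,\mathbb{Z}))-1$. With $\alpha=\frac{6}{\pi \mathrm i}$ put $h_1=z^2f+\alpha z(f_1+2f_2E_2)+\alpha^2f_2$, $h_2=2zf+\alpha(f_1+2f_2E_2)$, $h_3=f$, and $W_f=\det(h_i^{(j-1)})_{1\le i,j\le3}$ (Wronskian of $h_1,h_2,h_3$). The functions $g_j=h_j/\sqrt[3]{W_f}$ form a fundamental system of solutions of a unique equation $y'''+Q_2(z)y'+Q_3(z)y=0$, with $Q_2=\frac{g_1'''g_2-g_1g_2'''}{g_1g_2'-g_1'g_2}$, $Q_3=\frac{g_1'g_2'''-g_2'g_1'''}{g_1g_2'-g_1'g_2}$. The differential equation of the statement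 is this equation, rewritten with $Q=\frac{Q_2}{(2\pi \mathrm i)^2}$ and $R=\frac{Q_3-\frac12Q_2'}{(2\pi \mathrm i)^3}$. *)

theory Defs
  imports "HOL-Complex_Analysis.Complex_Analysis" "HOL-Library.Function_Algebras"
begin

definition upper_half_plane :: "complex set" where
  "upper_half_plane = {z. Im z > 0}"

definition nome :: "complex \<Rightarrow> complex" where
  "nome z = exp (2 * of_real pi * \<i> * z)"

definition E2 :: "complex \<Rightarrow> complex" where
  "E2 z = 1 - 24 * (\<Sum>n. of_nat (Suc n) * nome z ^ Suc n / (1 - nome z ^ Suc n))"

definition E4 :: "complex \<Rightarrow> complex" where
  "E4 z = 1 + 240 * (\<Sum>n. of_nat (Suc n) ^ 3 * nome z ^ Suc n / (1 - nome z ^ Suc n))"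

definition E6 :: "complex \<Rightarrow> complex" where
  "E6 z = 1 - 504 * (\<Sum>n. of_nat (Suc n) ^ 5 * nome z ^ Suc n / (1 - nome z ^ Suc n))"

text \<open>Functions on the upper half-plane are represented by functions on \<open>complex\<close> that vanish
  outside of it, so that distinct forms are distinct elements of \<open>complex \<Rightarrow> complex\<close> and
  dimensions are the correct ones. Holomorphy at the cusp is boundedness for large imaginary
  part.\<close>

definition modular_form :: "int \<Rightarrow> (complex \<Rightarrow> complex) \<Rightarrow> bool" where
  "modular_form k f \<longleftrightarrow>
     f holomorphic_on upper_half_plane \<and>
     (\<forall>(a::int) (b::int) (c::int) (d::int). a * d - b * c = 1 \<longrightarrow>
        (\<forall>z\<in>upper_half_plane.
           f ((of_int a * z + of_int b) / (of_int c * z + of_int d)) =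
             (of_int c * z + of_int d) powi k * f z)) \<and>
     (\<exists>B C. \<forall>z. Im z > B \<longrightarrow> norm (f z) \<le> C) \<and>
     (\<forall>z. z \<notin> upper_half_plane \<longrightarrow> f z = 0)"

definition quasimodular_decomposition ::
  "int \<Rightarrow> (complex \<Rightarrow> complex) \<Rightarrow> (complex \<Rightarrow> complex) \<Rightarrow> (complex \<Rightarrow> complex) \<Rightarrow>
     (complex \<Rightarrow> complex) \<Rightarrow> bool" where
  "quasimodular_decomposition k f f0 f1 f2 \<longleftrightarrow>
     modular_form k f0 \<and> modular_form (k - 2) f1 \<and> modular_form (k - 4) f2 \<and>
     f = (\<lambda>z. f0 z + f1 z * E2 z + f2 z * E2 z ^ 2)"

definition quasimodular_space :: "int \<Rightarrow> (complex \<Rightarrow> complex) set" where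
  "quasimodular_space k = {f. \<exists>f0 f1 f2. quasimodular_decomposition k f f0 f1 f2}"

definition fun_scale :: "complex \<Rightarrow> (complex \<Rightarrow> complex) \<Rightarrow> (complex \<Rightarrow> complex)" where
  "fun_scale c f = (\<lambda>z. c * f z)"

lemma vector_space_fun_scale: "vector_space fun_scale"
  by unfold_locales (auto simp: fun_scale_def fun_eq_iff algebra_simps)

definition has_order_at_infinity :: "(complex \<Rightarrow> complex) \<Rightarrow> nat \<Rightarrow> bool" where
  "has_order_at_infinity f n \<longleftrightarrow>
     (\<exists>a :: nat \<Rightarrow> complex.
        (\<forall>z\<in>upper_half_plane. (\<lambda>m. a m * nome z ^ m) sums f z) \<and>
        (\<forall>m<n. a m = 0) \<and> a n \<noteq> 0)"

definition extremal :: "int \<Rightarrow> (complex \<Rightarrow> complex) \<Rightarrow> bool" where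
  "extremal k f \<longleftrightarrow>
     f \<in> quasimodular_space k \<and>
     (\<exists>n. has_order_at_infinity f n \<and>
          int n = int (vector_space.dim fun_scale (quasimodular_space k)) - 1)"

definition Dq :: "(complex \<Rightarrow> complex) \<Rightarrow> complex \<Rightarrow> complex" where
  "Dq f = (\<lambda>z. deriv f z / (2 * of_real pi * \<i>))"

definition alpha :: complex where
  "alpha = 6 / (of_real pi * \<i>)"

definition h1 ::
  "(complex \<Rightarrow> complex) \<Rightarrow> (complex \<Rightarrow> complex) \<Rightarrow> (complex \<Rightarrow> complex) \<Rightarrow> complex \<Rightarrow> complex" where
  "h1 f f1 f2 z = z ^ 2 * f z + alpha * z * (f1 z + 2 * f2 z * E2 z) + alpha ^ 2 * f2 z"

definition h2 ::
  "(complex \<Rightarrow> complex) \<Rightarrow> (complex \<Rightarrow> complex) \<Rightarrow> (complex \<Rightarrow> complex) \<Rightarrow> complex \<Rightarrow> complex" where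
  "h2 f f1 f2 z = 2 * z * f z + alpha * (f1 z + 2 * f2 z * E2 z)"

definition wronskian3 ::
  "(complex \<Rightarrow> complex) \<Rightarrow> (complex \<Rightarrow> complex) \<Rightarrow> (complex \<Rightarrow> complex) \<Rightarrow> complex \<Rightarrow> complex" where
  "wronskian3 u1 u2 u3 z =
     det (vector [vector [u1 z, deriv u1 z, (deriv ^^ 2) u1 z],
                  vector [u2 z, deriv u2 z, (deriv ^^ 2) u2 z],
                  vector [u3 z, deriv u3 z, (deriv ^^ 2) u3 z]] :: complex ^ 3 ^ 3)"

definition W ::
  "(complex \<Rightarrow> complex) \<Rightarrow> (complex \<Rightarrow> complex) \<Rightarrow> (complex \<Rightarrow> complex) \<Rightarrow> complex \<Rightarrow> complex" where
  "W f f1 f2 = wronskian3 (h1 f f1 f2) (h2 f f1 f2) f"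

text \<open>The cube root of the Wronskian is in general multivalued on the upper half-plane: it branches
  at the zeros of the Wronskian. It is therefore represented by an arbitrary holomorphic branch
  \<open>w\<close> on an open set \<open>U\<close> avoiding these zeros; every other point of the upper half-plane has such a
  neighbourhood.\<close>

definition cube_root_branch :: "complex set \<Rightarrow> (complex \<Rightarrow> complex) \<Rightarrow> (complex \<Rightarrow> complex) \<Rightarrow> bool" where
  "cube_root_branch U F w \<longleftrightarrow>
     open U \<and> U \<subseteq> upper_half_plane \<and> (\<forall>z\<in>U. F z \<noteq> 0) \<and>
     w holomorphic_on U \<and> (\<forall>z\<in>U. w z ^ 3 = F z)"

text \<open>The quotients below are read as meromorphic functions; \<open>remove_sings\<close> gives
  them their values at zeros of the common denominator where the singularity is removable.\<close>

definition Q2 :: "(complex \<Rightarrow> complex) \<Rightarrow> (complex \<Rightarrow> complex) \<Rightarrow> complex \<Rightarrow> complex" where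
  "Q2 g1 g2 = remove_sings (\<lambda>z.
     ((deriv ^^ 3) g1 z * g2 z - g1 z * (deriv ^^ 3) g2 z) /
     (g1 z * deriv g2 z - deriv g1 z * g2 z))"

definition Q3 :: "(complex \<Rightarrow> complex) \<Rightarrow> (complex \<Rightarrow> complex) \<Rightarrow> complex \<Rightarrow> complex" where
  "Q3 g1 g2 = remove_sings (\<lambda>z.
     (deriv g1 z * (deriv ^^ 3) g2 z - deriv g2 z * (deriv ^^ 3) g1 z) /
     (g1 z * deriv g2 z - deriv g1 z * g2 z))"

definition coeff_Q :: "(complex \<Rightarrow> complex) \<Rightarrow> (complex \<Rightarrow> complex) \<Rightarrow> complex \<Rightarrow> complex" where
  "coeff_Q g1 g2 z = Q2 g1 g2 z / (2 * of_real pi * \<i>) ^ 2"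

definition coeff_R :: "(complex \<Rightarrow> complex) \<Rightarrow> (complex \<Rightarrow> complex) \<Rightarrow> complex \<Rightarrow> complex" where
  "coeff_R g1 g2 z = (Q3 g1 g2 z - 1 / 2 * deriv (Q2 g1 g2) z) / (2 * of_real pi * \<i>) ^ 3"

end

theory Submission
  imports Defs
begin

text \<open>
  Let \<open>f\<close> be extremal of weight \<open>k\<close> and depth 2. The functions \<open>h1\<close>, \<open>h2\<close> and \<open>h3 = f\<close> are the
  components of a vector-valued modular form of weight \<open>k - 2\<close>: translation acts on them by a
  unipotent matrix, and the inversion exchanges \<open>h1\<close> and \<open>h3\<close> and changes the sign of \<open>h2\<close>. The Serre
  derivative raises the weight by 2 and commutes with this action. Hence the 3 by 3 minors of the
  matrix of the Serre derivatives of order 0 to 3 are scalar modular forms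
  (\<open>vector_form.S_minus_inverse\<close>), and by Cramer's rule they are the coefficients of a third order
  equation satisfied by all three functions. The leading coefficient is the Wronskian, up to a
  constant factor.

  If \<open>f\<close> vanishes to the order \<open>n\<close> at the cusp, then so do all minors, since \<open>f\<close> fills one of the rows
  (\<open>vector_form.S_tendsto\<close>). Let \<open>N\<close> be the integral part of \<open>k / 4\<close>. The space of quasimodular forms
  contains \<open>N + 1\<close> independent monomials in \<open>E2\<close>, \<open>E4\<close> and \<open>E6\<close>, so that \<open>n\<close> is at least \<open>N\<close>
  (\<open>extremal_order_ge\<close>), and all minors may be divided by the \<open>N\<close>-th power of the discriminant. This
  leaves forms of weights 0, 2, 4, 6 if 4 divides \<open>k\<close>, and of weights 6, 8, 10, 12 otherwise. They are
  known up to a few constants, because forms of weight below 12 are determined by their value at the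
  cusp (\<open>mform_unique\<close>). In particular \<open>n = N\<close>, as the Wronskian does not vanish identically where a
  branch of its cube root is given.

  The values of the minors at the cusp express that the exponents of the equation there are 0, 0 and
  \<open>N\<close>. If 4 divides \<open>k\<close>, then this determines the equation (\<open>equation_weight_0_mod_4\<close>). Otherwise the
  form of weight 12 retains one free constant. In this case the Wronskian has a simple zero at \<open>\<i>\<close>, and
  the constant is determined by the fact that the equation has three independent holomorphic solutions
  at this singular point (\<open>equation_weight_2_mod_4\<close>).

  Division of the solutions by the cube root of the Wronskian removes the term of second order
  (\<open>serre_pow_quotient\<close>). The quotients have weight \<open>-2\<close>, and on functions of this weight the passage
  from Serre derivatives to ordinary ones produces the coefficients \<open>Q\<close> and \<open>1/2 * Dq Q + R\<close> with \<open>Q\<close>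
  and \<open>R\<close> modular of weights 4 and 6 (\<open>serre_equation_to_Dq\<close>). Since the Wronskian of the quotients is
  constant, \<open>Q\<close> and \<open>R\<close> are the functions given by quotients of determinants (\<open>coeff_eq\<close>).

  The theory of modular forms for this is short. Lipschitz's formula and the interchange of a double
  summation yield the transformation laws of the Eisenstein series, with Eisenstein's correction in
  weight 2 (\<open>E2_minus_inverse\<close>). The discriminant, defined through its logarithmic derivative \<open>E2\<close>, has
  no zeros, so that division by it reduces the weight by 12; the maximum modulus principle disposes of
  weight 0. Ramanujan's differential equations follow by comparison of first coefficients.
\<close>

section \<open>The upper half-plane and the nome\<close>

abbreviation \<H> :: "complex set" where "\<H> \<equiv> upper_half_plane"

lemma upper_half_plane_iff [simp]: "z \<in> \<H> \<longleftrightarrow> Im z > 0"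
  by (simp add: upper_half_plane_def)

lemma open_upper_half_plane [simp, intro]: "open \<H>"
  unfolding upper_half_plane_def by (rule open_halfspace_Im_gt)

lemma connected_upper_half_plane: "connected \<H>"
  unfolding upper_half_plane_def by (intro convex_connected convex_halfspace_Im_gt)

lemma Im_minus_inverse: "Im (-1 / z) = Im z / norm z ^ 2"
  by (simp add: Im_divide norm_complex_def power2_eq_square)

lemma minus_inverse_in_upper_half_plane [simp]: "Im z > 0 \<Longrightarrow> Im (-1 / z) > 0"
  by (subst Im_minus_inverse) (auto intro!: divide_pos_pos)

lemma norm_nome: "norm (nome z) = exp (- 2 * pi * Im z)"
  by (simp add: nome_def)

lemma nome_nonzero [simp]: "nome z \<noteq> 0"
  by (simp add: nome_def)

lemma norm_nome_less_1 [simp]: "Im z > 0 \<Longrightarrow> norm (nome z) < 1"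
  by (simp add: norm_nome)

lemma nome_of_nat_mult: "nome (of_nat n * z) = nome z ^ n"
  by (simp add: nome_def exp_of_nat_mult [symmetric] algebra_simps)

lemma has_field_derivative_nome:
  "(nome has_field_derivative 2 * of_real pi * \<i> * nome z) (at z within A)"
  unfolding nome_def by (auto intro!: derivative_eq_intros)

section \<open>Absolutely convergent sums over the integers and over lattices\<close>

text \<open>All absolute convergence below comes from this comparison of norms on the real plane, in
  coordinates with respect to the basis \<open>z\<close>, 1.\<close>

lemma linear_form_lower_bound:
  fixes z :: complex
  assumes "Im z \<noteq> 0"
  obtains c where "c > 0"
    "\<And>s t :: real. c * (\<bar>s\<bar> + \<bar>t\<bar>) \<le> norm (of_real s * z + of_real t)"
proof
  define K where "K = 1 + (1 + norm z) / \<bar>Im z\<bar>"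
  have K: "K > 0" using assms by (simp add: K_def add_pos_nonneg)
  show "1 / K > 0" using K by simp
  fix s t :: real
  define N where "N = norm (of_real s * z + of_real t)"
  have 1: "\<bar>s\<bar> * \<bar>Im z\<bar> \<le> N"
    using abs_Im_le_cmod[of "of_real s * z + of_real t"] by (simp add: N_def abs_mult)
  have "\<bar>t\<bar> = norm ((of_real s * z + of_real t) - of_real s * z)" by simp
  also have "\<dots> \<le> N + \<bar>s\<bar> * norm z"
    unfolding N_def by (rule order.trans[OF norm_triangle_ineq4]) (simp add: norm_mult)
  finally have "\<bar>s\<bar> + \<bar>t\<bar> \<le> N + \<bar>s\<bar> * (1 + norm z)" by (simp add: algebra_simps)
  also have "\<bar>s\<bar> \<le> N / \<bar>Im z\<bar>" using 1 assms by (simp add: field_simps)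
  hence "N + \<bar>s\<bar> * (1 + norm z) \<le> N + N / \<bar>Im z\<bar> * (1 + norm z)"
    by (intro add_left_mono mult_right_mono) auto
  also have "\<dots> = K * N" by (simp add: K_def field_simps)
  finally show "1 / K * (\<bar>s\<bar> + \<bar>t\<bar>) \<le> norm (of_real s * z + of_real t)"
    using K by (simp add: N_def field_simps)
qed

lemma int_UNIV_eq: "(UNIV :: int set) = range int \<union> range (\<lambda>k. - 1 - int k)"
proof -
  have "n \<in> range int \<union> range (\<lambda>k. - 1 - int k)" for n :: int
  proof (cases "n \<ge> 0")
    case True
    hence "n = int (nat n)" by simp
    thus ?thesis by blast
  next
    case False
    hence "n = - 1 - int (nat (- 1 - n))" by simp
    thus ?thesis by blast
  qed
  thus ?thesis by blast
qed

lemma has_sum_int_split: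
  fixes g :: "int \<Rightarrow> 'a :: banach"
  assumes "g summable_on UNIV" "(\<lambda>k. g (int k)) sums a" "(\<lambda>k. g (- 1 - int k)) sums b"
  shows "(g has_sum (a + b)) UNIV"
proof -
  have s1: "g summable_on range int" and s2: "g summable_on range (\<lambda>k. - 1 - int k)"
    using assms(1) by (auto intro: summable_on_subset_banach)
  have i1: "inj int" and i2: "inj (\<lambda>k. - 1 - int k)" by (auto simp: inj_def)
  have "(g \<circ> int) summable_on UNIV" "(g \<circ> (\<lambda>k. - 1 - int k)) summable_on UNIV"
    using s1 s2 summable_on_reindex[OF i1] summable_on_reindex[OF i2] by auto
  then obtain a' b' where h: "((g \<circ> int) has_sum a') UNIV" "((g \<circ> (\<lambda>k. - 1 - int k)) has_sum b') UNIV"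
    unfolding summable_on_def by blast
  have "a' = a" "b' = b"
    using has_sum_imp_sums[OF h(1)] has_sum_imp_sums[OF h(2)] assms(2,3)
    by (auto simp: o_def dest: sums_unique2)
  hence "(g has_sum a) (range int)" "(g has_sum b) (range (\<lambda>k. - 1 - int k))"
    using h has_sum_reindex[OF i1, of g a] has_sum_reindex[OF i2, of g b] by auto
  thus ?thesis unfolding int_UNIV_eq by (rule has_sum_Un_disjoint) auto
qed

lemma summable_on_int_quadratic: "(\<lambda>n::int. 1 / (1 + \<bar>of_int n\<bar>) ^ 2 :: real) summable_on UNIV"
proof -
  define g where "g = (\<lambda>n::int. 1 / (1 + \<bar>of_int n\<bar>) ^ 2 :: real)"
  have s: "summable (\<lambda>k. 1 / (1 + real k) ^ 2)"
    using inverse_squares_sums by (auto simp: add.commute sums_iff)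
  have s': "summable (\<lambda>k. 1 / (2 + real k) ^ 2)"
    using s[THEN summable_ignore_initial_segment[of _ 1]] by (simp add: add.commute add.left_commute)
  have i1: "inj int" and i2: "inj (\<lambda>k. - 1 - int k)" by (auto simp: inj_def)
  have "(g \<circ> int) summable_on UNIV"
    by (intro norm_summable_imp_summable_on) (use s in \<open>simp add: g_def\<close>)
  hence 1: "g summable_on range int" by (simp add: summable_on_reindex i1)
  have eq: "1 + \<bar>real_of_int (- 1 - int k)\<bar> = 2 + real k" for k by simp
  have "(g \<circ> (\<lambda>k. - 1 - int k)) summable_on UNIV"
    by (intro norm_summable_imp_summable_on) (use s' in \<open>simp only: g_def o_def eq; simp\<close>)
  hence 2: "g summable_on range (\<lambda>k. - 1 - int k)" by (simp add: summable_on_reindex i2)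
  have "g summable_on (range int \<union> range (\<lambda>k. - 1 - int k))"
    using 1 2 by (rule summable_on_Un_disjoint) auto
  thus ?thesis by (simp add: g_def int_UNIV_eq)
qed

lemma summable_on_int_comparison:
  fixes g :: "int \<Rightarrow> complex"
  assumes "\<And>n. norm (g n) \<le> C / (1 + \<bar>of_int n\<bar>) ^ 2"
  shows "g summable_on UNIV"
proof (rule Infinite_Sum.abs_summable_summable, rule Infinite_Sum.abs_summable_on_comparison_test')
  show "(\<lambda>n::int. C * (1 / (1 + \<bar>of_int n\<bar>) ^ 2)) summable_on UNIV"
    by (intro summable_on_cmult_right summable_on_int_quadratic)
qed (use assms in auto)

lemma summable_on_int_pair_comparison:
  fixes g :: "int \<times> int \<Rightarrow> complex"
  assumes "\<And>m n. norm (g (m, n)) \<le> C / ((1 + \<bar>of_int m\<bar>) ^ 2 * (1 + \<bar>of_int n\<bar>) ^ 2)"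
  shows "g summable_on UNIV \<times> UNIV"
proof (rule Infinite_Sum.abs_summable_summable, rule Infinite_Sum.abs_summable_on_comparison_test')
  define b where "b = (\<lambda>n::int. 1 / (1 + \<bar>of_int n\<bar>) ^ 2 :: real)"
  obtain S where S: "(b has_sum S) UNIV"
    using summable_on_int_quadratic unfolding b_def summable_on_def by blast
  have nn: "b n \<ge> 0" for n by (simp add: b_def)
  have *: "(\<lambda>(m, n). b m * b n) summable_on (UNIV \<times> UNIV)"
  proof (rule summable_on_SigmaI)
    show "((\<lambda>n. case (m, n) of (m, n) \<Rightarrow> b m * b n) has_sum b m * S) UNIV" for m
      using has_sum_cmult_right[OF S, of "b m"] by simp
    show "(\<lambda>m. b m * S) summable_on UNIV"
      using summable_on_cmult_left[of b UNIV S] S by (auto simp: summable_on_def)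
  qed (auto simp: nn)
  show "(\<lambda>x. C * (case x of (m, n) \<Rightarrow> b m * b n)) summable_on UNIV \<times> UNIV"
    by (rule summable_on_cmult_right[OF *])
  show "norm (g x) \<le> C * (case x of (m, n) \<Rightarrow> b m * b n)" for x
    using assms[of "fst x" "snd x"] by (cases x) (simp add: b_def)
qed

text \<open>The transformation laws of all Eisenstein series are interchanges of summation, and this is the
  form of Fubini's theorem in which they are carried out.\<close>

lemma has_sum_rows_columns:
  fixes g :: "int \<times> int \<Rightarrow> complex"
  assumes "g summable_on UNIV \<times> UNIV"
    and "\<And>m. ((\<lambda>n. g (m, n)) has_sum R m) UNIV"
    and "\<And>n. ((\<lambda>m. g (m, n)) has_sum K n) UNIV"
  obtains S where "(R has_sum S) UNIV" "(K has_sum S) UNIV"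
proof -
  obtain S where S: "(g has_sum S) (UNIV \<times> UNIV)"
    using assms(1) unfolding summable_on_def by blast
  have 1: "(R has_sum S) UNIV"
    by (rule has_sum_SigmaD[OF S]) (use assms(2) in auto)
  have "((\<lambda>(n, m). g (m, n)) has_sum S) (UNIV \<times> UNIV)"
    using S has_sum_swap[of "\<lambda>(n, m). g (m, n)" UNIV UNIV S]  by (simp add: case_prod_unfold)
  hence 2: "(K has_sum S) UNIV"
    by (rule has_sum_SigmaD) (use assms(3) in auto)
  show ?thesis using that 1 2 by blast
qed

section \<open>The cotangent\<close>

lemma not_Int_of_Im_nonzero: "Im z \<noteq> 0 \<Longrightarrow> z \<notin> \<int>"
  by (auto elim!: Ints_cases)

text \<open>The logarithmic derivative of the reflection formula for the Gamma function.\<close>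

lemma Digamma_reflection:
  fixes z :: complex
  assumes z: "z \<notin> \<int>"
  shows "Digamma (1 - z) - Digamma z = of_real pi * cot (of_real pi * z)"
proof -
  define S where "S = sin (of_real pi * z)"
  have S: "S \<noteq> 0"
  proof
    assume "S = 0"
    then obtain n :: int where "complex_of_real pi * z = of_real (of_int n * pi)"
      unfolding S_def sin_eq_0 by blast
    hence "complex_of_real pi * z = complex_of_real pi * of_int n" by (simp add: mult.commute)
    hence "z = of_int n" by simp
    thus False using z by simp
  qed
  have z1: "z \<notin> \<int>\<^sub>\<le>\<^sub>0" "1 - z \<notin> \<int>\<^sub>\<le>\<^sub>0"
    using z Ints_diff[of 1 "1 - z"] nonpos_Ints_Int[of "1 - z"] nonpos_Ints_Int[of z] by auto
  have "((\<lambda>z. Gamma z * Gamma (1 - z)) has_field_derivative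
          Gamma z * Digamma z * Gamma (1 - z) - Gamma z * (Gamma (1 - z) * Digamma (1 - z))) (at z)"
    using z1 by (auto intro!: derivative_eq_intros simp: algebra_simps)
  also have "(\<lambda>z::complex. Gamma z * Gamma (1 - z)) = (\<lambda>z. of_real pi / sin (of_real pi * z))"
    by (simp add: fun_eq_iff Gamma_reflection_complex)
  finally have "((\<lambda>z. of_real pi / sin (of_real pi * z)) has_field_derivative
          Gamma z * Gamma (1 - z) * (Digamma z - Digamma (1 - z))) (at z)"
    by (simp add: algebra_simps)
  moreover have "((\<lambda>z. of_real pi / sin (of_real pi * z)) has_field_derivative
          (- (of_real pi * (cos (of_real pi * z) * of_real pi)) / S ^ 2)) (at z)"
    using S unfolding S_def by (auto intro!: derivative_eq_intros simp: power2_eq_square)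
  ultimately have "of_real pi / S * (Digamma z - Digamma (1 - z)) =
                   - (of_real pi * (cos (of_real pi * z) * of_real pi)) / S ^ 2"
    unfolding Gamma_reflection_complex S_def by (rule DERIV_unique)
  hence "S ^ 2 * (of_real pi / S * (Digamma z - Digamma (1 - z))) =
           S ^ 2 * (- (of_real pi * (cos (of_real pi * z) * of_real pi)) / S ^ 2)"
    by (simp only:)
  hence "S * (of_real pi * (Digamma z - Digamma (1 - z))) = S * (- (of_real pi * (cos (of_real pi * z) * of_real pi)) / S)"
    using S by (simp add: power2_eq_square)
  hence "of_real pi * (Digamma z - Digamma (1 - z)) = of_real pi * (- (of_real pi * cot (of_real pi * z)))"
    using S unfolding cot_def S_def [symmetric] by (simp add: field_simps)
  hence "Digamma z - Digamma (1 - z) = - (of_real pi * cot (of_real pi * z))"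
    by (subst (asm) mult_cancel_left) simp
  thus ?thesis by (simp add: algebra_simps)
qed

lemma sums_Digamma_diff:
  fixes a b :: complex
  assumes "a \<noteq> 0" "b \<noteq> 0"
  shows "(\<lambda>k. 1 / (a + of_nat k) - 1 / (b + of_nat k)) sums (Digamma b - Digamma a)"
proof -
  have "(\<lambda>k. (inverse (of_nat (Suc k)) - inverse (b + of_nat k)) - (inverse (of_nat (Suc k)) - inverse (a + of_nat k)))
          sums ((Digamma b + euler_mascheroni) - (Digamma a + euler_mascheroni))"
    using summable_Digamma[OF assms(1)] summable_Digamma[OF assms(2)]
    by (intro sums_diff) (auto simp: Digamma_def summable_sums)
  thus ?thesis by (simp add: field_simps)
qed

text \<open>Partial fractions of the cotangent, in a form that converges absolutely: differences of the
  Digamma function sum the nonnegative and the negative integers separately, and the reflection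
  formula combines the two halves.\<close>

lemma has_sum_cot_difference:
  assumes "Im a \<noteq> 0" "Im b \<noteq> 0" "a \<noteq> b"
  shows "((\<lambda>m::int. 1 / ((of_int m + a) * (of_int m + b))) has_sum
           of_real pi * (cot (of_real pi * a) - cot (of_real pi * b)) / (b - a)) UNIV"
proof -
  obtain c1 where c1: "c1 > 0" "\<And>s t :: real. c1 * (\<bar>s\<bar> + \<bar>t\<bar>) \<le> norm (of_real s * a + of_real t)"
    using linear_form_lower_bound[OF assms(1)] by metis
  obtain c2 where c2: "c2 > 0" "\<And>s t :: real. c2 * (\<bar>s\<bar> + \<bar>t\<bar>) \<le> norm (of_real s * b + of_real t)"
    using linear_form_lower_bound[OF assms(2)] by metis
  define g where "g = (\<lambda>m::int. 1 / ((of_int m + a) * (of_int m + b)))"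
  have nz: "of_int m + a \<noteq> 0" "of_int m + b \<noteq> 0" for m :: int
    using assms(1,2) by (auto simp: complex_eq_iff)
  have g_eq: "g m = (1 / (a + of_int m) - 1 / (b + of_int m)) / (b - a)" for m
  proof -
    have "1 / (a + of_int m) - 1 / (b + of_int m) = ((b + of_int m) - (a + of_int m)) / ((a + of_int m) * (b + of_int m))"
      using nz[of m] by (subst diff_frac_eq) (auto simp: add.commute)
    also have "\<dots> = (b - a) * g m" by (simp add: g_def add.commute)
    finally show ?thesis using assms(3) by simp
  qed
  have summ: "g summable_on UNIV"
  proof (rule summable_on_int_comparison)
    fix m :: int
    have "c1 * (1 + \<bar>of_int m\<bar>) * (c2 * (1 + \<bar>of_int m\<bar>)) \<le> norm (of_int m + a) * norm (of_int m + b)"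
      using c1(2)[of 1 "of_int m"] c2(2)[of 1 "of_int m"] c1(1) c2(1)
      by (intro mult_mono) (auto simp: add.commute)
    hence "1 / (norm (of_int m + a) * norm (of_int m + b)) \<le> 1 / (c1 * (1 + \<bar>of_int m\<bar>) * (c2 * (1 + \<bar>of_int m\<bar>)))"
      using c1(1) c2(1) by (intro divide_left_mono) (auto intro!: mult_pos_pos add_pos_nonneg simp: nz)
    thus "norm (g m) \<le> (1 / (c1 * c2)) / (1 + \<bar>of_int m\<bar>) ^ 2"
      by (simp add: g_def norm_divide norm_mult power2_eq_square mult_ac)
  qed
  have 1: "(\<lambda>k. g (int k)) sums ((Digamma b - Digamma a) / (b - a))"
    unfolding g_eq using nz[of 0] sums_divide[OF sums_Digamma_diff[of a b]] by simp
  have "(\<lambda>k. (1 / (1 - b + of_nat k) - 1 / (1 - a + of_nat k)) / (b - a)) sums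
          ((Digamma (1 - a) - Digamma (1 - b)) / (b - a))"
    by (intro sums_divide sums_Digamma_diff) (use nz[of "-1"] in auto)
  also have "(\<lambda>k. (1 / (1 - b + of_nat k) - 1 / (1 - a + of_nat k)) / (b - a)) = (\<lambda>k. g (- 1 - int k))"
  proof
    fix k
    have "1 - b + of_nat k = - (b + of_int (-1 - int k))" "1 - a + of_nat k = - (a + of_int (-1 - int k))"
      by simp_all
    thus "(1 / (1 - b + of_nat k) - 1 / (1 - a + of_nat k)) / (b - a) = g (- 1 - int k)"
      unfolding g_eq by (simp only: divide_minus_right) simp
  qed
  finally have "(g has_sum ((Digamma b - Digamma a) / (b - a) + (Digamma (1 - a) - Digamma (1 - b)) / (b - a))) UNIV"
    by (intro has_sum_int_split summ 1)
  also have "(Digamma b - Digamma a) / (b - a) + (Digamma (1 - a) - Digamma (1 - b)) / (b - a) =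
      of_real pi * (cot (of_real pi * a) - cot (of_real pi * b)) / (b - a)"
    using Digamma_reflection[of a] Digamma_reflection[of b] not_Int_of_Im_nonzero[OF assms(1)]
      not_Int_of_Im_nonzero[OF assms(2)]
    by (simp add: algebra_simps flip: add_divide_distrib diff_divide_distrib)
  finally show ?thesis by (simp only: g_def)
qed

section \<open>Lipschitz's formula and Lambert series\<close>

text \<open>The polylogarithm of order \<open>-j\<close>. The case distinction removes the constant term that
  \<open>0 ^ 0 = 1\<close> would add for \<open>j = 0\<close>.\<close>

definition neg_polylog :: "nat \<Rightarrow> complex \<Rightarrow> complex" where
  "neg_polylog j q = (\<Sum>n. (if n = 0 then 0 else of_nat n ^ j) * q ^ n)"

text \<open>The operator \<open>q d/dq\<close> maps each of these series to the next one, so convergence propagates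
  from the geometric series.\<close>

lemma
  assumes "norm (q::complex) < 1"
  shows summable_neg_polylog: "summable (\<lambda>n. (if n = 0 then 0 else of_nat n ^ j) * q ^ n)"
    and has_field_derivative_neg_polylog:
      "\<exists>D. (neg_polylog j has_field_derivative D) (at q) \<and> q * D = neg_polylog (Suc j) q"
proof -
  define c where "c = (\<lambda>(j::nat) (n::nat). if n = 0 then 0 else of_nat n ^ j :: complex)"
  have diffs: "q * (diffs (c j) n * q ^ n) = c (Suc j) (Suc n) * q ^ Suc n" for j n q
    by (simp add: diffs_def c_def)
  have c0: "c j 0 = 0" for j by (simp add: c_def)
  have summ: "summable (\<lambda>n. c j n * q ^ n)" if "norm q < 1" for q j
    using that
  proof (induction j arbitrary: q)
    case 0
    have "summable (\<lambda>n. q ^ n)" using 0 by (rule summable_geometric)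
    hence "summable (\<lambda>n. q ^ Suc n)" by (subst summable_Suc_iff)
    hence "summable (\<lambda>n. c 0 (Suc n) * q ^ Suc n)" by (simp add: c_def)
    thus ?case by (subst (asm) summable_Suc_iff)
  next
    case (Suc j)
    have "summable (\<lambda>n. diffs (c j) n * q ^ n)"
      by (rule termdiff_converges[where K = 1]) (use Suc in auto)
    hence "summable (\<lambda>n. q * (diffs (c j) n * q ^ n))" by (rule summable_mult)
    thus ?case unfolding diffs by (subst (asm) summable_Suc_iff)
  qed
  show "summable (\<lambda>n. (if n = 0 then 0 else of_nat n ^ j) * q ^ n)"
    using summ[OF assms, of j] by (simp add: c_def)
  have np: "neg_polylog j = (\<lambda>q. \<Sum>n. c j n * q ^ n)" for j
    by (simp add: neg_polylog_def c_def fun_eq_iff)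
  have d: "(neg_polylog j has_field_derivative (\<Sum>n. diffs (c j) n * q ^ n)) (at q)"
    unfolding np by (rule termdiffs_strong'[of 1]) (use summ assms in auto)
  have "summable (\<lambda>n. diffs (c j) n * q ^ n)"
    by (rule termdiff_converges[where K = 1]) (use summ assms in auto)
  hence "q * (\<Sum>n. diffs (c j) n * q ^ n) = (\<Sum>n. c (Suc j) (Suc n) * q ^ Suc n)"
    by (subst suminf_mult [symmetric]) (simp_all only: diffs)
  also have "\<dots> = neg_polylog (Suc j) q"
    unfolding np by (subst suminf_split_head) (use summ[OF assms] in \<open>auto simp: c0\<close>)
  finally show "\<exists>D. (neg_polylog j has_field_derivative D) (at q) \<and> q * D = neg_polylog (Suc j) q"
    using d by blast
qed

lemma neg_polylog_0: "norm q < 1 \<Longrightarrow> neg_polylog 0 q = q / (1 - q)"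
proof -
  assume q: "norm q < 1"
  have "neg_polylog 0 q = (\<Sum>n. q ^ Suc n)"
    unfolding neg_polylog_def
    using suminf_split_head[OF summable_neg_polylog[OF q, of 0]] by simp
  also have "\<dots> = q * (\<Sum>n. q ^ n)"
    using q by (subst suminf_mult [symmetric]) (auto intro: summable_geometric)
  finally show ?thesis using q by (simp add: suminf_geometric)
qed

lemma neg_polylog_sums:
  assumes "norm q < 1"
  shows "(\<lambda>n. of_nat (Suc n) ^ j * q ^ Suc n) sums neg_polylog j q"
proof -
  have "(\<lambda>n. (if n = 0 then 0 else of_nat n ^ j) * q ^ n) sums neg_polylog j q"
    unfolding neg_polylog_def by (rule summable_sums[OF summable_neg_polylog[OF assms]])
  from sums_split_initial_segment[OF this, of 1] show ?thesis by simp
qed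

lemma summable_poly_geometric: "0 \<le> r \<Longrightarrow> r < 1 \<Longrightarrow> summable (\<lambda>n. real (Suc n) ^ j * r ^ n)"
proof -
  assume r: "0 \<le> r" "r < 1"
  show ?thesis
  proof (cases "r = 0")
    case False
    have "summable (\<lambda>n. of_nat (Suc n) ^ j * complex_of_real r ^ Suc n)"
      by (rule sums_summable[OF neg_polylog_sums]) (use r in auto)
    also have "(\<lambda>n. of_nat (Suc n) ^ j * complex_of_real r ^ Suc n) = (\<lambda>n. complex_of_real (real (Suc n) ^ j * r ^ Suc n))"
      by simp
    finally have "summable (\<lambda>n. real (Suc n) ^ j * r ^ Suc n)" by (subst (asm) summable_of_real_iff)
    from summable_divide[OF this, of r] False show ?thesis by simp
  next
    case True
    have "summable (\<lambda>n. if n = 0 then 1 else 0 :: real)" by (rule summable_single)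
    also have "(\<lambda>n. if n = 0 then 1 else 0 :: real) = (\<lambda>n. real (Suc n) ^ j * r ^ n)"
      using True by (auto simp: fun_eq_iff)
    finally show ?thesis .
  qed
qed

lemma pi_cot_eq_nome:
  assumes "Im z > 0"
  shows "of_real pi * cot (of_real pi * z) = - of_real pi * \<i> - 2 * of_real pi * \<i> * (nome z / (1 - nome z))"
proof -
  define e where "e = exp (\<i> * (of_real pi * z))"
  have e: "e \<noteq> 0" by (simp add: e_def)
  have q: "nome z = e * e"
    by (simp add: nome_def e_def mult_ac flip: exp_add mult_2)
  have "nome z \<noteq> 1" using norm_nome_less_1[OF assms] by auto
  hence e2: "e * e \<noteq> 1" using q by simp
  have "cos (of_real pi * z) = (e + 1 / e) / 2" "sin (of_real pi * z) = (e - 1 / e) / (2 * \<i>)"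
    by (simp_all add: cos_exp_eq sin_exp_eq e_def exp_minus inverse_eq_divide)
  moreover have "(e + 1 / e) / 2 / ((e - 1 / e) / (2 * \<i>)) = \<i> * ((e * e + 1) / (e * e - 1))"
    using e e2 by (simp add: divide_simps)
  ultimately have "cot (of_real pi * z) = \<i> * ((e * e + 1) / (e * e - 1))" by (simp only: cot_def)
  also have "(e * e + 1) / (e * e - 1) = - 1 - 2 * (e * e / (1 - e * e))" using e2 by (simp add: divide_simps) (simp add: algebra_simps)
  finally have *: "cot (of_real pi * z) = \<i> * (- 1 - 2 * (nome z / (1 - nome z)))" by (simp only: q)
  show ?thesis unfolding * by (simp only: right_diff_distrib mult_minus_right mult_1_right mult_ac minus_mult_left)
qed

text \<open>Repeated differentiation of the reflection formula, after the cotangent has been expanded in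
  the nome.\<close>

lemma Polygamma_reflection_nome:
  assumes "Im z > 0"
  shows "(-1) ^ j * Polygamma j (1 - z) - Polygamma j z =
           (if j = 0 then - of_real pi * \<i> else 0) - (2 * of_real pi * \<i>) ^ Suc j * neg_polylog j (nome z)"
  using assms
proof (induction j arbitrary: z)
  case 0
  thus ?case using Digamma_reflection[of z] not_Int_of_Im_nonzero[of z] pi_cot_eq_nome[of z]
    by (simp add: neg_polylog_0)
next
  case (Suc j)
  let ?k = "2 * of_real pi * \<i> :: complex"
  have ni: "z \<notin> \<int>\<^sub>\<le>\<^sub>0" "1 - z \<notin> \<int>\<^sub>\<le>\<^sub>0"
    using Suc.prems by (auto simp: nonpos_Ints_def complex_eq_iff)
  obtain D where D: "(neg_polylog j has_field_derivative D) (at (nome z))"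
    "nome z * D = neg_polylog (Suc j) (nome z)"
    using has_field_derivative_neg_polylog[of "nome z" j] Suc.prems by auto
  have 1: "((\<lambda>z. (-1) ^ j * Polygamma j (1 - z) - Polygamma j z) has_field_derivative
          (-1) ^ j * (- Polygamma (Suc j) (1 - z)) - Polygamma (Suc j) z) (at z)"
    using ni by (auto intro!: derivative_eq_intros)
  have 2: "((\<lambda>z. (if j = 0 then - of_real pi * \<i> else 0) - ?k ^ Suc j * neg_polylog j (nome z)) has_field_derivative
           - (?k ^ Suc j * (D * (?k * nome z)))) (at z)"
    by (rule derivative_eq_intros DERIV_chain2[where f = "neg_polylog j" and g = nome, OF D(1) has_field_derivative_nome] refl | simp)+
  have "((\<lambda>z. (-1) ^ j * Polygamma j (1 - z) - Polygamma j z) has_field_derivative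
           - (?k ^ Suc j * (D * (?k * nome z)))) (at z)"
    by (rule has_field_derivative_transform_within_open[OF 2 open_upper_half_plane])
       (use Suc in auto)
  from DERIV_unique[OF 1 this]
  show ?case by (simp add: D(2) [symmetric] mult_ac)
qed

lemma int_shift_power_norm_bound:
  assumes "Im z \<noteq> 0" "s \<ge> 2"
  shows "\<exists>C. \<forall>n::int. norm (1 / (z + of_int n) ^ s) \<le> C / (1 + \<bar>of_int n\<bar>) ^ 2"
proof -
  obtain c where c: "c > 0" "\<And>s t :: real. c * (\<bar>s\<bar> + \<bar>t\<bar>) \<le> norm (of_real s * z + of_real t)"
    using linear_form_lower_bound[OF assms(1)] by metis
  have "norm (1 / (z + of_int n) ^ s) \<le> (1 / c ^ s) / (1 + \<bar>of_int n\<bar>) ^ 2" for n :: int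
  proof -
    have nz: "z + of_int n \<noteq> 0" using assms(1) by (auto simp: complex_eq_iff)
    have "(c * (1 + \<bar>of_int n\<bar>)) ^ s \<le> norm (z + of_int n) ^ s"
      using c(2)[of 1 "of_int n"] c(1) by (intro power_mono) auto
    hence "norm (1 / (z + of_int n) ^ s) \<le> 1 / (c * (1 + \<bar>of_int n\<bar>)) ^ s"
      unfolding norm_divide norm_power norm_one using c(1)
      by (intro divide_left_mono mult_pos_pos zero_less_power) (auto intro!: add_pos_nonneg nz)
    also have "\<dots> = (1 / c ^ s) * (1 / (1 + \<bar>of_int n\<bar>) ^ s)" by (simp add: power_mult_distrib)
    also have "\<dots> \<le> (1 / c ^ s) * (1 / (1 + \<bar>of_int n\<bar>) ^ 2)"
      using c(1) assms(2) by (intro mult_left_mono divide_left_mono power_increasing) auto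
    finally show ?thesis by simp
  qed
  thus ?thesis by blast
qed

text \<open>Lipschitz's formula. The sum over the integers splits into Polygamma series at \<open>z\<close> and at
  \<open>1 - z\<close>, which the reflection formula turns into a power series in the nome.\<close>

lemma Lipschitz_formula:
  assumes z: "Im z > 0" and j: "j \<ge> 1"
  shows "((\<lambda>n::int. 1 / (z + of_int n) ^ Suc j) has_sum
           (- 2 * of_real pi * \<i>) ^ Suc j / fact j * neg_polylog j (nome z)) UNIV"
proof -
  define g where "g = (\<lambda>n::int. 1 / (z + of_int n) ^ Suc j)"
  have "z \<noteq> 0" using z by auto
  have summ: "g summable_on UNIV"
  proof -
    obtain C where "\<And>n::int. norm (1 / (z + of_int n) ^ Suc j) \<le> C / (1 + \<bar>of_int n\<bar>) ^ 2"
      using int_shift_power_norm_bound[of z "Suc j"] z j by auto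
    thus ?thesis unfolding g_def by (rule summable_on_int_comparison)
  qed
  have ps: "(\<lambda>k. 1 / (z + of_nat k) ^ Suc j) sums ((-1) ^ Suc j * Polygamma j z / fact j)"
    if "z \<noteq> 0" for z :: complex
  proof -
    have "(\<lambda>k. inverse ((z + of_nat k) ^ Suc j)) sums (\<Sum>k. inverse ((z + of_nat k) ^ Suc j))"
      using j that by (intro summable_sums Polygamma_converges') auto
    moreover have "Polygamma j z = (-1) ^ Suc j * fact j * (\<Sum>k. inverse ((z + of_nat k) ^ Suc j))"
      using j by (simp add: Polygamma_def)
    ultimately show ?thesis by (simp add: inverse_eq_divide)
  qed
  have 1: "(\<lambda>k. g (int k)) sums ((-1) ^ Suc j * Polygamma j z / fact j)"
    using ps[OF \<open>z \<noteq> 0\<close>] by (simp add: g_def)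
  have "(\<lambda>k. (-1) ^ Suc j * (1 / (1 - z + of_nat k) ^ Suc j)) sums
          ((-1) ^ Suc j * ((-1) ^ Suc j * Polygamma j (1 - z) / fact j))"
    by (intro sums_mult ps) (use z in auto)
  also have "(\<lambda>k. (-1) ^ Suc j * (1 / (1 - z + of_nat k) ^ Suc j)) = (\<lambda>k. g (- 1 - int k))"
  proof
    fix k
    have "(1 - z + of_nat k) = - (z + of_int (-1 - int k))" by simp
    hence "(1 - z + of_nat k) ^ Suc j = (-1) ^ Suc j * (z + of_int (-1 - int k)) ^ Suc j"
      by (metis power_minus)
    thus "(-1) ^ Suc j * (1 / (1 - z + of_nat k) ^ Suc j) = g (- 1 - int k)"
      unfolding g_def by (cases "even j") auto
  qed
  finally have 2: "(\<lambda>k. g (- 1 - int k)) sums (Polygamma j (1 - z) / fact j)"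
    by (simp flip: power_mult_distrib)
  have "(-1) ^ Suc j * Polygamma j z / fact j + Polygamma j (1 - z) / fact j =
        (-1) ^ j / fact j * ((-1) ^ j * Polygamma j (1 - z) - Polygamma j z)"
    by (cases "even j") (auto simp: field_simps)
  also have "\<dots> = (- 2 * of_real pi * \<i>) ^ Suc j / fact j * neg_polylog j (nome z)"
    unfolding Polygamma_reflection_nome[OF z] using j
    by (cases "even j") (auto simp: power_mult_distrib)
  finally show ?thesis using has_sum_int_split[OF summ 1 2] unfolding g_def by simp
qed

definition lambert :: "nat \<Rightarrow> complex \<Rightarrow> complex" where
  "lambert j q = (\<Sum>n. of_nat (Suc n) ^ j * q ^ Suc n / (1 - q ^ Suc n))"

text \<open>The double series with terms \<open>d ^ j * q ^ (d * m)\<close>, summed over \<open>d\<close> first on the left-hand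
  side and over \<open>m\<close> first on the right-hand side.\<close>

lemma lambert_double_sum:
  assumes q: "norm q < 1"
  shows "(\<lambda>m. neg_polylog j (q ^ Suc m)) sums lambert j q"
proof -
  define r where "r = norm q"
  have r: "0 \<le> r" "r < 1" using q by (auto simp: r_def)
  define g where "g = (\<lambda>(d::nat, m::nat). of_nat (Suc d) ^ j * (q ^ Suc d) ^ Suc m :: complex)"
  define gr where "gr = (\<lambda>(d::nat, m::nat). real (Suc d) ^ j * (r ^ Suc d) ^ Suc m)"
  have ng: "norm (g x) = gr x" for x
    by (cases x) (simp only: g_def gr_def r_def case_prod_conv norm_mult norm_power norm_of_nat)
  have geo: "(\<lambda>m. c * x ^ Suc m) sums (c * (x / (1 - x)))" if "norm x < 1" for c x :: "'a :: {real_normed_field,banach}"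
    using sums_mult[OF geometric_sums[OF that], of "c * x"] by (simp add: mult_ac)
  have pw: "norm (x ^ Suc d) < 1" if "norm x < 1" for x :: "'a :: {real_normed_field,banach}" and d
    using that by (cases "x = 0") (auto simp only: norm_power zero_less_norm_iff power_0_Suc norm_zero zero_less_one intro!: power_Suc_less_one)
  have rd: "norm (r ^ Suc d) < 1" for d using pw[of r d] r by simp
  have gr_summ: "gr summable_on UNIV \<times> UNIV"
  proof (rule summable_on_SigmaI)
    fix d
    show "((\<lambda>m. gr (d, m)) has_sum (real (Suc d) ^ j * (r ^ Suc d / (1 - r ^ Suc d)))) UNIV"
      unfolding gr_def case_prod_conv by (rule sums_nonneg_imp_has_sum[OF geo[OF rd]]) (use r in auto)
  next
    have np: "summable (\<lambda>d. real (Suc d) ^ j * r ^ Suc d)"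
      using summable_mult[OF summable_poly_geometric[OF r, of j], of r] by (simp add: mult_ac)
    show "(\<lambda>d. real (Suc d) ^ j * (r ^ Suc d / (1 - r ^ Suc d))) summable_on UNIV"
    proof (rule norm_summable_imp_summable_on, rule summable_comparison_test'[OF summable_mult2[OF np, of "1 / (1 - r)"]])
      fix d :: nat assume "d \<ge> 0"
      have "r ^ Suc d \<le> r ^ 1" using r by (intro power_decreasing) auto
      hence "r ^ Suc d / (1 - r ^ Suc d) \<le> r ^ Suc d / (1 - r)"
        using r by (intro divide_left_mono mult_pos_pos) auto
      moreover have "0 \<le> r ^ Suc d / (1 - r ^ Suc d)" using rd[of d] r by auto
      ultimately show "norm (norm (real (Suc d) ^ j * (r ^ Suc d / (1 - r ^ Suc d)))) \<le> real (Suc d) ^ j * r ^ Suc d * (1 / (1 - r))"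
      proof -
        assume *: "r ^ Suc d / (1 - r ^ Suc d) \<le> r ^ Suc d / (1 - r)" "0 \<le> r ^ Suc d / (1 - r ^ Suc d)"
        have "norm (norm (real (Suc d) ^ j * (r ^ Suc d / (1 - r ^ Suc d)))) = real (Suc d) ^ j * (r ^ Suc d / (1 - r ^ Suc d))"
          using *(2) by (simp only: real_norm_def abs_idempotent abs_mult abs_of_nonneg abs_of_nonneg[OF *(2)] zero_le_power of_nat_0_le_iff)
        also have "\<dots> \<le> real (Suc d) ^ j * (r ^ Suc d / (1 - r))"
          using *(1) by (intro mult_left_mono) auto
        finally show ?thesis by simp
      qed
    qed
  qed (use r in \<open>auto simp: gr_def\<close>)
  have "g summable_on UNIV \<times> UNIV"
    by (rule Infinite_Sum.abs_summable_summable) (use gr_summ in \<open>simp add: ng\<close>)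
  then obtain S where S: "(g has_sum S) (UNIV \<times> UNIV)" unfolding summable_on_def by blast
  have 1: "((\<lambda>d. of_nat (Suc d) ^ j * (q ^ Suc d / (1 - q ^ Suc d))) has_sum S) UNIV"
  proof (rule has_sum_SigmaD[OF S])
    fix d
    have "(\<lambda>m. g (d, m)) summable_on UNIV"
      using summable_on_SigmaD1[of "\<lambda>d m. g (d, m)" UNIV "\<lambda>_. UNIV" d] S by (auto simp: summable_on_def)
    then obtain x where x: "((\<lambda>m. g (d, m)) has_sum x) UNIV" unfolding summable_on_def by blast
    from has_sum_imp_sums[OF this] geo[OF pw[OF q], of "of_nat (Suc d) ^ j" d]
    have "x = of_nat (Suc d) ^ j * (q ^ Suc d / (1 - q ^ Suc d))"
      unfolding g_def case_prod_conv by (rule sums_unique2)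
    thus "((\<lambda>m. g (d, m)) has_sum of_nat (Suc d) ^ j * (q ^ Suc d / (1 - q ^ Suc d))) UNIV" using x by simp
  qed
  have S': "((\<lambda>(m, d). g (d, m)) has_sum S) (UNIV \<times> UNIV)"
    using S unfolding has_sum_swap[of g] .
  have 2: "((\<lambda>m. neg_polylog j (q ^ Suc m)) has_sum S) UNIV"
  proof (rule has_sum_SigmaD[OF S'])
    fix m
    have "(\<lambda>d. g (d, m)) summable_on UNIV"
      using summable_on_SigmaD1[of "\<lambda>m d. g (d, m)" UNIV "\<lambda>_. UNIV" m] S' by (auto simp: summable_on_def)
    then obtain x where x: "((\<lambda>d. g (d, m)) has_sum x) UNIV" unfolding summable_on_def by blast
    have "(\<lambda>d. g (d, m)) sums neg_polylog j (q ^ Suc m)"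
      using neg_polylog_sums[OF pw[OF q], of j m]
      by (simp add: g_def flip: power_mult power_Suc) (simp add: algebra_simps)
    with has_sum_imp_sums[OF x] have "x = neg_polylog j (q ^ Suc m)" by (rule sums_unique2)
    thus "((\<lambda>d. case (m, d) of (m, d) \<Rightarrow> g (d, m)) has_sum neg_polylog j (q ^ Suc m)) UNIV" using x by simp
  qed
  have "S = lambert j q"
    using sums_unique[OF has_sum_imp_sums[OF 1]] by (simp add: lambert_def)
  thus ?thesis using has_sum_imp_sums[OF 2] by simp
qed

lemma E2_lambert: "E2 z = 1 - 24 * lambert 1 (nome z)"
  by (simp add: E2_def lambert_def)

lemma E4_lambert: "E4 z = 1 + 240 * lambert 3 (nome z)"
  by (simp add: E4_def lambert_def)

lemma E6_lambert: "E6 z = 1 - 504 * lambert 5 (nome z)"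
  by (simp add: E6_def lambert_def)

section \<open>The transformation laws of the Eisenstein series\<close>

lemma has_sum_diff:
  fixes f g :: "'a \<Rightarrow> complex"
  assumes "(f has_sum a) A" "(g has_sum b) A"
  shows "((\<lambda>x. f x - g x) has_sum (a - b)) A"
  using has_sum_add[OF assms(1), of "\<lambda>x. - g x" "- b"] assms(2) by (simp add: has_sum_uminus)

lemma lattice_row:
  assumes z: "Im z > 0" and j: "odd j" and m: "m \<noteq> (0::int)"
  shows "((\<lambda>n::int. 1 / (of_int m * z + of_int n) ^ Suc j) has_sum
           (2 * of_real pi * \<i>) ^ Suc j / fact j * neg_polylog j (nome z ^ nat \<bar>m\<bar>)) UNIV"
proof -
  have j1: "j \<ge> 1" using j by (cases j) auto
  define M where "M = nat \<bar>m\<bar>"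
  have M: "M > 0" using m by (simp add: M_def)
  have Mz: "Im (of_nat M * z) > 0" using M z by simp
  have *: "((\<lambda>n::int. 1 / (of_nat M * z + of_int n) ^ Suc j) has_sum
           (2 * of_real pi * \<i>) ^ Suc j / fact j * neg_polylog j (nome z ^ M)) UNIV"
    using Lipschitz_formula[OF Mz j1] j by (simp add: nome_of_nat_mult power_mult_distrib)
  show ?thesis
  proof (cases "m > 0")
    case True
    hence "of_int m = (of_nat M :: complex)" by (simp add: M_def of_nat_nat)
    thus ?thesis using * by (simp add: M_def)
  next
    case False
    hence mM: "of_int m = - (of_nat M :: complex)" by (simp add: M_def of_nat_nat)
    have bij: "bij_betw uminus (UNIV :: int set) UNIV" by (rule bij_uminus)
    have eq: "1 / (of_int m * z + of_int (- n)) ^ Suc j = 1 / (of_nat M * z + of_int n) ^ Suc j" for n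
    proof -
      have "of_int m * z + of_int (- n) = - (of_nat M * z + of_int n)" by (simp add: mM)
      moreover have "(- (of_nat M * z + of_int n)) ^ Suc j = (of_nat M * z + of_int n) ^ Suc j"
        by (rule power_minus_even) (use j in simp)
      ultimately show ?thesis by (simp only:)
    qed
    have "((\<lambda>n. 1 / (of_int m * z + of_int (- n)) ^ Suc j) has_sum
           (2 * of_real pi * \<i>) ^ Suc j / fact j * neg_polylog j (nome z ^ M)) UNIV"
      unfolding eq by (rule *)
    thus ?thesis using has_sum_reindex_bij_betw[OF bij, of "\<lambda>n. 1 / (of_int m * z + of_int n) ^ Suc j"]
      by (simp add: M_def)
  qed
qed

text \<open>The rows \<open>m\<close> and \<open>-m\<close> of the lattice sum contribute equally, hence the factor 2.\<close>

lemma lattice_row_sum: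
  assumes q: "norm q < 1"
    and S: "((\<lambda>m::int. if m = 0 then c else K * neg_polylog j (q ^ nat \<bar>m\<bar>)) has_sum S) UNIV"
  shows "S = c + 2 * K * lambert j q"
proof -
  define R where "R = (\<lambda>m::int. if m = 0 then c else K * neg_polylog j (q ^ nat \<bar>m\<bar>))"
  have L: "(\<lambda>k. K * neg_polylog j (q ^ Suc k)) sums (K * lambert j q)"
    by (rule sums_mult[OF lambert_double_sum[OF q]])
  have na: "nat \<bar>1 + int k\<bar> = Suc k" "nat \<bar>- 1 - int k\<bar> = Suc k" "nat (1 + int k) = Suc k" "nat (int k + 1) = Suc k" for k by auto
  have "(\<lambda>k. R (int (Suc k))) sums (K * lambert j q)"
    using L by (simp add: R_def na del: power_Suc)
  hence 1: "(\<lambda>k. R (int k)) sums (K * lambert j q + c)"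
    by (subst (asm) sums_Suc_iff) (simp add: R_def)
  have 2: "(\<lambda>k. R (- 1 - int k)) sums (K * lambert j q)"
    using L by (simp add: R_def na del: power_Suc)
  have "(R has_sum (K * lambert j q + c + K * lambert j q)) UNIV"
    by (rule has_sum_int_split[OF _ 1 2]) (use S in \<open>auto simp: R_def summable_on_def\<close>)
  from has_sum_unique[OF this, of S] S show ?thesis by (simp add: R_def algebra_simps)
qed

lemma int_pair_weight_bound:
  fixes m n :: int
  assumes "(m, n) \<noteq> (0, 0)"
  shows "(1 + \<bar>of_int m\<bar>) ^ 2 * (1 + \<bar>of_int n\<bar>) ^ 2 \<le> 16 * (\<bar>of_int m\<bar> + \<bar>of_int n\<bar> :: real) ^ 4"
    and "1 \<le> (\<bar>of_int m\<bar> + \<bar>of_int n\<bar> :: real)"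
proof -
  define x y where "x = (\<bar>of_int m\<bar> :: real)" "y = (\<bar>of_int n\<bar> :: real)"
  have "1 \<le> \<bar>m\<bar> + \<bar>n\<bar>" using assms by auto
  hence "1 \<le> (of_int (\<bar>m\<bar> + \<bar>n\<bar>) :: real)" by linarith
  hence xy: "x \<ge> 0" "y \<ge> 0" "1 \<le> x + y" by (simp_all add: x_y_def)
  have "(1 + x) ^ 2 * (1 + y) ^ 2 \<le> (2 * (x + y)) ^ 2 * (2 * (x + y)) ^ 2"
    using xy by (intro mult_mono power_mono) auto
  also have "\<dots> = 16 * (x + y) ^ 4" by algebra
  finally show "(1 + \<bar>of_int m\<bar>) ^ 2 * (1 + \<bar>of_int n\<bar>) ^ 2 \<le> 16 * (\<bar>of_int m\<bar> + \<bar>of_int n\<bar> :: real) ^ 4"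
    by (simp add: x_y_def)
  show "1 \<le> (\<bar>of_int m\<bar> + \<bar>of_int n\<bar> :: real)" using xy by (simp add: x_y_def)
qed

lemma lattice_point_nonzero:
  assumes "Im z \<noteq> 0" "(m, n) \<noteq> (0, 0)"
  shows "of_int m * z + of_int n \<noteq> (0 :: complex)"
proof
  assume *: "of_int m * z + of_int n = 0"
  from arg_cong[OF this, of Im] assms(1) have "m = 0" by simp
  with * assms(2) show False by simp
qed

lemma lattice_power_summable:
  assumes z: "Im z > 0" and s: "s \<ge> 4"
  shows "(\<lambda>(m::int, n::int). if (m, n) = (0, 0) then 0 else 1 / (of_int m * z + of_int n) ^ s) summable_on UNIV \<times> UNIV"
proof -
  obtain c where c: "c > 0" "\<And>s t :: real. c * (\<bar>s\<bar> + \<bar>t\<bar>) \<le> norm (of_real s * z + of_real t)"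
    using linear_form_lower_bound[of z] z by (metis less_irrefl)
  show ?thesis
  proof (rule summable_on_int_pair_comparison)
    fix m n :: int
    show "norm (case (m, n) of (m, n) \<Rightarrow> if (m, n) = (0, 0) then 0 else 1 / (of_int m * z + of_int n) ^ s)
       \<le> (16 / c ^ s) / ((1 + \<bar>of_int m\<bar>) ^ 2 * (1 + \<bar>of_int n\<bar>) ^ 2)"
    proof (cases "(m, n) = (0, 0)")
      case False
      define x where "x = (\<bar>of_int m\<bar> + \<bar>of_int n\<bar> :: real)"
      have x: "x \<ge> 1" "(1 + \<bar>of_int m\<bar>) ^ 2 * (1 + \<bar>of_int n\<bar>) ^ 2 \<le> 16 * x ^ 4"
        using int_pair_weight_bound[OF False] by (simp_all add: x_def)
      have "1 / norm (of_int m * z + of_int n) ^ s \<le> 1 / (c * x) ^ s"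
        using c(2)[of "of_int m" "of_int n"] c(1) x(1) lattice_point_nonzero[OF _ False, of z] z
        by (intro divide_left_mono power_mono mult_pos_pos zero_less_power) (auto simp: x_def)
      also have "\<dots> = 1 / c ^ s * (1 / x ^ s)" by (simp add: power_mult_distrib)
      also have "\<dots> \<le> 1 / c ^ s * (1 / x ^ 4)"
        using x(1) s c(1) by (intro mult_left_mono divide_left_mono power_increasing mult_pos_pos zero_less_power) auto
      also have "\<dots> \<le> 1 / c ^ s * (16 / ((1 + \<bar>of_int m\<bar>) ^ 2 * (1 + \<bar>of_int n\<bar>) ^ 2))"
      proof (rule mult_left_mono)
        show "1 / x ^ 4 \<le> 16 / ((1 + \<bar>of_int m\<bar>) ^ 2 * (1 + \<bar>of_int n\<bar>) ^ 2)"
          using x by (simp add: field_simps)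
      qed (use c(1) in simp)
      finally show ?thesis using False c(1) by (simp add: norm_divide norm_power)
    next
      case True
      have "0 \<le> 16 / c ^ s / ((1 + \<bar>of_int m\<bar>) ^ 2 * (1 + \<bar>of_int n\<bar>) ^ 2)"
        using c(1) by simp
      thus ?thesis using True by simp
    qed
  qed
qed

text \<open>The transformation law of the Eisenstein series of even weight \<open>j + 1 \<ge> 4\<close>, whose constant term
  \<open>c\<close> is left undetermined. The sum of \<open>1 / (m * z + n) ^ (j + 1)\<close> over the nonzero lattice points
  is evaluated by rows at \<open>z\<close>; its columns are the rows of the same sum at \<open>-1 / z\<close>, up to the
  factor \<open>z ^ (j + 1)\<close>.\<close>

lemma lambert_minus_inverse:
  assumes j: "odd j" "j \<ge> 3"
  obtains c where "\<And>z. Im z > 0 \<Longrightarrow>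
     c + 2 * ((2 * of_real pi * \<i>) ^ Suc j / fact j) * lambert j (nome (-1 / z)) =
     z ^ Suc j * (c + 2 * ((2 * of_real pi * \<i>) ^ Suc j / fact j) * lambert j (nome z))"
proof -
  define K :: complex where "K = (2 * of_real pi * \<i>) ^ Suc j / fact j"
  define g where "g = (\<lambda>z (m::int, n::int). if (m, n) = (0, 0) then 0 else 1 / (of_int m * z + of_int n) ^ Suc j :: complex)"
  define c where "c = infsum (\<lambda>n. g \<i> (0, n)) UNIV"
  define R where "R = (\<lambda>z (m::int). if m = 0 then c else K * neg_polylog j (nome z ^ nat \<bar>m\<bar>))"
  have summ: "g z summable_on UNIV \<times> UNIV" if "Im z > 0" for z
    unfolding g_def by (rule lattice_power_summable[OF that]) (use j in auto)
  have row: "((\<lambda>n. g z (m, n)) has_sum R z m) UNIV" if z: "Im z > 0" for z m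
  proof (cases "m = 0")
    case False
    have "(\<lambda>n. g z (m, n)) = (\<lambda>n. 1 / (of_int m * z + of_int n) ^ Suc j)"
      using False by (simp add: g_def)
    thus ?thesis using lattice_row[OF z j(1) False] False by (simp only: R_def K_def if_False)
  next
    case True
    have "(\<lambda>n. g \<i> (0, n)) summable_on UNIV"
      using summable_on_SigmaD1[of "\<lambda>m n. g \<i> (m, n)" UNIV "\<lambda>_. UNIV" 0] summ[of \<i>] by simp
    moreover have "g z (0, n) = g \<i> (0, n)" for n by (simp add: g_def)
    ultimately show ?thesis using True by (simp add: R_def c_def)
  qed
  have "c + 2 * K * lambert j (nome (-1 / z)) = z ^ Suc j * (c + 2 * K * lambert j (nome z))"
    if z: "Im z > 0" for z
  proof -
    have tz: "Im (-1 / z) > 0" using z by (rule minus_inverse_in_upper_half_plane)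
    have z0: "z \<noteq> 0" using z by auto
    have col: "((\<lambda>m. g z (m, l)) has_sum (1 / z ^ Suc j * R (-1 / z) l)) UNIV" for l
    proof -
      have "g z (m, l) = 1 / z ^ Suc j * g (-1 / z) (- l, m)" for m
      proof -
        have "(of_int m * z + of_int l) = z * (of_int (- l) * (-1 / z) + of_int m)"
          using z0 by (simp add: field_simps)
        hence "(of_int m * z + of_int l) ^ Suc j = z ^ Suc j * (of_int (- l) * (-1 / z) + of_int m) ^ Suc j"
          by (simp only: power_mult_distrib)
        thus ?thesis by (auto simp: g_def simp del: power_Suc)
      qed
      moreover have "((\<lambda>m. 1 / z ^ Suc j * g (-1 / z) (- l, m)) has_sum (1 / z ^ Suc j * R (-1 / z) (- l))) UNIV"
        by (intro has_sum_cmult_right row tz)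
      moreover have "R (-1 / z) (- l) = R (-1 / z) l" by (simp add: R_def)
      ultimately show ?thesis by simp
    qed
    obtain S where S: "(R z has_sum S) UNIV" "((\<lambda>l. 1 / z ^ Suc j * R (-1 / z) l) has_sum S) UNIV"
      using has_sum_rows_columns[OF summ[OF z] row[OF z] col] by blast
    have "((\<lambda>l. z ^ Suc j * (1 / z ^ Suc j * R (-1 / z) l)) has_sum (z ^ Suc j * S)) UNIV"
      by (rule has_sum_cmult_right[OF S(2)])
    hence "(R (-1 / z) has_sum (z ^ Suc j * S)) UNIV" using z0 by (simp del: power_Suc)
    hence "z ^ Suc j * S = c + 2 * K * lambert j (nome (-1 / z))"
      by (intro lattice_row_sum norm_nome_less_1 tz) (simp only: R_def)
    moreover have "S = c + 2 * K * lambert j (nome z)"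
      by (intro lattice_row_sum) (use z S(1) in \<open>auto simp: R_def\<close>)
    ultimately show ?thesis by simp
  qed
  thus ?thesis using that[of c] unfolding K_def by blast
qed

lemma has_sum_inverse_squares_int:
  "((\<lambda>n::int. if n = 0 then 0 else 1 / of_int n ^ 2 :: complex) has_sum of_real (pi ^ 2 / 3)) UNIV"
proof -
  define g where "g = (\<lambda>n::int. if n = 0 then 0 else 1 / of_int n ^ 2 :: complex)"
  have B: "(\<lambda>k. complex_of_real (1 / (real k + 1) ^ 2)) sums of_real (pi ^ 2 / 6)"
    unfolding sums_of_real_iff using inverse_squares_sums by (simp add: add.commute)
  have 1: "(\<lambda>k. g (int k)) sums (of_real (pi ^ 2 / 6))"
  proof -
    have "(\<lambda>k. g (int (Suc k))) sums (of_real (pi ^ 2 / 6))"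
      using B by (simp add: g_def add.commute)
    thus ?thesis by (subst (asm) sums_Suc_iff) (simp add: g_def)
  qed
  have e: "of_int (- 1 - int k) = - (complex_of_nat k + 1)" for k by simp
  have 2: "(\<lambda>k. g (- 1 - int k)) sums (of_real (pi ^ 2 / 6))"
    using B unfolding g_def e by (simp add: add.commute power2_eq_square flip: minus_add_distrib)
  have "g summable_on UNIV"
  proof (rule summable_on_int_comparison[where C = 4])
    fix n :: int
    show "norm (g n) \<le> 4 / (1 + \<bar>of_int n\<bar>) ^ 2"
    proof (cases "n = 0")
      case False
      hence n: "1 \<le> \<bar>of_int n :: real\<bar>" by linarith
      hence "(1 + \<bar>of_int n\<bar>) ^ 2 \<le> (2 * \<bar>of_int n :: real\<bar>) ^ 2" by (intro power_mono) auto
      thus ?thesis using False n by (simp add: g_def norm_divide norm_power field_simps)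
    qed (auto simp: g_def)
  qed
  from has_sum_int_split[OF this 1 2] show ?thesis by (simp add: g_def)
qed

text \<open>The rows of the comparison series in Eisenstein's argument. A shift by one half makes them
  telescope and keeps every term finite.\<close>

lemma telescoping_row:
  assumes "w - 1 / 2 \<notin> \<int>" "(\<lambda>n::int. 1 / ((w + of_int n) ^ 2 - 1 / 4)) summable_on UNIV"
  shows "((\<lambda>n::int. 1 / ((w + of_int n) ^ 2 - 1 / 4 :: complex)) has_sum 0) UNIV"
proof -
  define u where "u = (\<lambda>n::int. 1 / (w - 1 / 2 + of_int n))"
  have nz: "w - 1 / 2 + of_int n \<noteq> 0" for n :: int
    using assms(1) by (metis Ints_minus Ints_of_int add_eq_0_iff2)
  have eq: "1 / ((w + of_int n) ^ 2 - 1 / 4) = u n - u (n + 1)" for n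
  proof -
    define a where "a = w - 1 / 2 + of_int n"
    have a: "a \<noteq> 0" "a + 1 \<noteq> 0" using nz[of n] nz[of "n + 1"] by (simp_all add: a_def add_ac)
    have "(w + of_int n) ^ 2 - 1 / 4 = a * (a + 1)" by (simp add: a_def power2_eq_square algebra_simps)
    moreover have "u (n + 1) = 1 / (a + 1)" "u n = 1 / a" by (simp_all add: u_def a_def add_ac)
    moreover have "1 / (a * (a + 1)) = 1 / a - 1 / (a + 1)" using a by (simp add: divide_simps)
    ultimately show ?thesis by (simp only:)
  qed
  have lim: "(\<lambda>k. u (int k)) \<longlonglongrightarrow> 0" "(\<lambda>k. u (- int k)) \<longlonglongrightarrow> 0"
  proof -
    have *: "filterlim (\<lambda>k. x + of_nat k) at_infinity sequentially" for x :: complex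
      by (intro tendsto_add_filterlim_at_infinity[OF tendsto_const] tendsto_of_nat)
    have "(\<lambda>k. inverse (w - 1 / 2 + of_nat k)) \<longlonglongrightarrow> 0" "(\<lambda>k. - inverse (1 / 2 - w + of_nat k)) \<longlonglongrightarrow> - 0"
      by (intro tendsto_minus filterlim_compose[OF tendsto_inverse_0 *])+
    moreover have "- inverse (1 / 2 - w + of_nat k) = inverse (w - 1 / 2 - of_nat k)" for k
      by (simp flip: inverse_minus_eq)
    ultimately show "(\<lambda>k. u (int k)) \<longlonglongrightarrow> 0" "(\<lambda>k. u (- int k)) \<longlonglongrightarrow> 0"
      by (simp_all add: u_def inverse_eq_divide)
  qed
  have "(\<lambda>k. u (int k) - u (int (Suc k))) sums (u (int 0) - 0)"
    by (rule telescope_sums'[OF lim(1)])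
  hence 1: "(\<lambda>k. 1 / ((w + of_int (int k)) ^ 2 - 1 / 4)) sums u 0"
    unfolding eq by (simp add: add.commute)
  have "(\<lambda>k. u (- int (Suc k)) - u (- int k)) sums (0 - u (- int 0))"
    by (rule telescope_sums[OF lim(2)])
  hence 2: "(\<lambda>k. 1 / ((w + of_int (- 1 - int k)) ^ 2 - 1 / 4)) sums (- u 0)"
    unfolding eq by (simp add: algebra_simps)
  show ?thesis using has_sum_int_split[OF assms(2) 1 2] by simp
qed

text \<open>The boundary term that the telescoping columns of the comparison series leave behind.\<close>

lemma cot_tendsto_upper:
  "(\<lambda>N. cot (of_real pi * ((of_nat N + 1 / 2) * \<tau>))) \<longlonglongrightarrow> - \<i>" if "Im \<tau> > 0"
proof -
  define x where "x = (\<lambda>N. (of_nat N + 1 / 2) * \<tau>)"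
  have x: "Im (x N) > 0" for N using that by (simp add: x_def add_pos_pos)
  have nx: "nome (x N) = nome (\<tau> / 2) * nome \<tau> ^ N" for N
    by (simp add: nome_def x_def algebra_simps flip: exp_of_nat_mult exp_add)
  have "(\<lambda>N. nome (x N)) \<longlonglongrightarrow> nome (\<tau> / 2) * 0"
    unfolding nx by (intro tendsto_mult tendsto_const LIMSEQ_power_zero) (use that in auto)
  hence "(\<lambda>N. - \<i> - 2 * \<i> * (nome (x N) / (1 - nome (x N)))) \<longlonglongrightarrow> - \<i> - 2 * \<i> * (0 / (1 - 0))"
    by (intro tendsto_intros) auto
  moreover have "- \<i> - 2 * \<i> * (nome (x N) / (1 - nome (x N))) = cot (of_real pi * x N)" for N
  proof -
    have "of_real pi * cot (of_real pi * x N) = of_real pi * (- \<i> - 2 * \<i> * (nome (x N) / (1 - nome (x N))))"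
      unfolding pi_cot_eq_nome[OF x]
      by (simp only: right_diff_distrib mult_minus_right mult_minus_left mult_ac)
    thus ?thesis by (subst (asm) mult_cancel_left) simp
  qed
  ultimately show ?thesis by (simp add: x_def)
qed

text \<open>The comparison series improves the decay from order 2 to order 4, and thereby makes the double
  series converge absolutely.\<close>

lemma lattice_difference_summable:
  assumes z: "Im z > 0"
  shows "(\<lambda>(m::int, n::int). if (m, n) = (0, 0) then 0 else
           1 / (of_int m * z + of_int n) ^ 2 - 1 / ((of_int m * z + of_int n) ^ 2 - 1 / 4))
         summable_on UNIV \<times> UNIV"
    and "(m, n) \<noteq> (0, 0) \<Longrightarrow> (of_int m * z + of_int n) ^ 2 \<noteq> (1 / 4 :: complex)"
proof -
  obtain c where c: "c > 0" "\<And>s t :: real. c * (\<bar>s\<bar> + \<bar>t\<bar>) \<le> norm (of_real s * z + of_real t)"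
    using linear_form_lower_bound[of z] z by (metis less_irrefl)
  have bound: "c ^ 2 / 4 * (\<bar>of_int m\<bar> + \<bar>of_int n\<bar>) ^ 2 \<le> norm ((of_int m * z + of_int n) ^ 2 - 1 / 4)"
    if "(m, n) \<noteq> (0, 0)" for m n :: int
  proof -
    have h: "\<bar>of_int n\<bar> / 2 \<le> \<bar>of_int n - 1 / 2 :: real\<bar>" "\<bar>of_int n\<bar> / 2 \<le> \<bar>of_int n + 1 / 2 :: real\<bar>"
    proof -
      have "n = 0 \<or> 1 \<le> n \<or> n \<le> -1" by linarith
      hence "n = 0 \<or> 1 \<le> real_of_int n \<or> real_of_int n \<le> -1" by linarith
      thus "\<bar>of_int n\<bar> / 2 \<le> \<bar>of_int n - 1 / 2 :: real\<bar>" "\<bar>of_int n\<bar> / 2 \<le> \<bar>of_int n + 1 / 2 :: real\<bar>"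
        by auto
    qed
    have 1: "c / 2 * (\<bar>of_int m\<bar> + \<bar>of_int n\<bar>) \<le> norm (of_real (of_int m) * z + of_real (of_int n - 1 / 2))"
    proof (rule order.trans[OF _ c(2)])
      have "c * ((\<bar>of_int m\<bar> + \<bar>of_int n\<bar>) / 2) \<le> c * (\<bar>of_int m\<bar> + \<bar>of_int n - 1 / 2\<bar>)"
        using h(1) c(1) by (intro mult_left_mono) auto
      thus "c / 2 * (\<bar>of_int m\<bar> + \<bar>of_int n\<bar>) \<le> c * (\<bar>of_int m\<bar> + \<bar>of_int n - 1 / 2\<bar>)"
        by simp
    qed
    have 2: "c / 2 * (\<bar>of_int m\<bar> + \<bar>of_int n\<bar>) \<le> norm (of_real (of_int m) * z + of_real (of_int n + 1 / 2))"
    proof (rule order.trans[OF _ c(2)])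
      have "c * ((\<bar>of_int m\<bar> + \<bar>of_int n\<bar>) / 2) \<le> c * (\<bar>of_int m\<bar> + \<bar>of_int n + 1 / 2\<bar>)"
        using h(2) c(1) by (intro mult_left_mono) auto
      thus "c / 2 * (\<bar>of_int m\<bar> + \<bar>of_int n\<bar>) \<le> c * (\<bar>of_int m\<bar> + \<bar>of_int n + 1 / 2\<bar>)"
        by simp
    qed
    have "c ^ 2 / 4 * (\<bar>of_int m\<bar> + \<bar>of_int n\<bar>) ^ 2 =
          c / 2 * (\<bar>of_int m\<bar> + \<bar>of_int n\<bar>) * (c / 2 * (\<bar>of_int m\<bar> + \<bar>of_int n\<bar>))"
      by (simp add: power2_eq_square)
    also have "\<dots> \<le> norm (of_real (of_int m) * z + of_real (of_int n - 1 / 2)) * norm (of_real (of_int m) * z + of_real (of_int n + 1 / 2))"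
      using c(1) by (intro mult_mono 1 2) auto
    also have "\<dots> = norm ((of_int m * z + of_int n) ^ 2 - 1 / 4)"
      by (simp flip: norm_mult) (simp add: power2_eq_square algebra_simps)
    finally show ?thesis .
  qed
  show nz: "(of_int m * z + of_int n) ^ 2 \<noteq> (1 / 4 :: complex)" if "(m, n) \<noteq> (0, 0)" for m n
  proof
    assume "(of_int m * z + of_int n) ^ 2 = (1 / 4 :: complex)"
    with bound[OF that] have "c ^ 2 / 4 * (\<bar>of_int m\<bar> + \<bar>of_int n\<bar>) ^ 2 \<le> 0" by simp
    moreover have "c ^ 2 / 4 * (\<bar>of_int m\<bar> + \<bar>of_int n\<bar>) ^ 2 > 0"
      using c(1) int_pair_weight_bound(2)[OF that] by simp
    ultimately show False by linarith
  qed
  show "(\<lambda>(m::int, n::int). if (m, n) = (0, 0) then 0 else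
           1 / (of_int m * z + of_int n) ^ 2 - 1 / ((of_int m * z + of_int n) ^ 2 - 1 / 4))
         summable_on UNIV \<times> UNIV"
  proof (rule summable_on_int_pair_comparison)
    fix m n :: int
    define w where "w = of_int m * z + of_int n"
    show "norm (case (m, n) of (m, n) \<Rightarrow> if (m, n) = (0, 0) then 0 else
           1 / (of_int m * z + of_int n) ^ 2 - 1 / ((of_int m * z + of_int n) ^ 2 - 1 / 4))
       \<le> (16 / c ^ 4) / ((1 + \<bar>of_int m\<bar>) ^ 2 * (1 + \<bar>of_int n\<bar>) ^ 2)"
    proof (cases "(m, n) = (0, 0)")
      case False
      define x where "x = (\<bar>of_int m\<bar> + \<bar>of_int n\<bar> :: real)"
      have x: "x \<ge> 1" "(1 + \<bar>of_int m\<bar>) ^ 2 * (1 + \<bar>of_int n\<bar>) ^ 2 \<le> 16 * x ^ 4"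
        using int_pair_weight_bound[OF False] by (simp_all add: x_def)
      have w0: "w \<noteq> 0" "w ^ 2 - 1 / 4 \<noteq> 0"
        using lattice_point_nonzero[OF _ False, of z] nz[OF False] z by (auto simp: w_def)
      have "1 / w ^ 2 - 1 / (w ^ 2 - 1 / 4) = - (1 / 4) / (w ^ 2 * (w ^ 2 - 1 / 4))"
        using w0 by (subst diff_frac_eq) auto
      hence "norm (1 / w ^ 2 - 1 / (w ^ 2 - 1 / 4)) = (1 / 4) / (norm w ^ 2 * norm (w ^ 2 - 1 / 4))"
        by (simp add: norm_divide norm_mult norm_power)
      also have "\<dots> \<le> (1 / 4) / ((c * x) ^ 2 * (c ^ 2 / 4 * x ^ 2))"
        using bound[OF False] c(2)[of "of_int m" "of_int n"] c(1) x(1) w0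
        by (intro divide_left_mono mult_mono power_mono mult_pos_pos zero_less_power) (auto simp: x_def w_def)
      also have "\<dots> = 1 / c ^ 4 * (1 / x ^ 4)"
        using c(1) x(1) by (simp add: field_simps flip: power_add)
      also have "\<dots> \<le> 1 / c ^ 4 * (16 / ((1 + \<bar>of_int m\<bar>) ^ 2 * (1 + \<bar>of_int n\<bar>) ^ 2))"
      proof (rule mult_left_mono)
        show "1 / x ^ 4 \<le> 16 / ((1 + \<bar>of_int m\<bar>) ^ 2 * (1 + \<bar>of_int n\<bar>) ^ 2)"
          using x by (simp add: field_simps)
      qed (use c(1) in simp)
      finally show ?thesis using False by (simp add: w_def)
    next
      case True
      have "0 \<le> 16 / c ^ 4 / ((1 + \<bar>of_int m\<bar>) ^ 2 * (1 + \<bar>of_int n\<bar>) ^ 2)"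
        using c(1) by simp
      thus ?thesis using True by simp
    qed
  qed
qed

text \<open>Eisenstein's argument. The series of \<open>1 / w ^ 2\<close> over the lattice points \<open>w = m * z + n\<close> does not
  converge absolutely, but its difference to the series of \<open>1 / (w ^ 2 - 1 / 4)\<close> does. The rows of
  the latter sum to 0, whereas its columns have sums \<open>t n\<close> that add up to \<open>2 * pi * \<i> * \<tau>\<close>; this is
  the term by which the transformation law of \<open>E2\<close> deviates from that of a modular form.\<close>

lemma E2_minus_inverse:
  assumes z: "Im z > 0"
  shows "E2 (-1 / z) = z ^ 2 * E2 z + alpha * z"
proof -
  define \<tau> where "\<tau> = -1 / z"
  have \<tau>: "Im \<tau> > 0" unfolding \<tau>_def using z by (rule minus_inverse_in_upper_half_plane)
  have z0: "z \<noteq> 0" "\<tau> \<noteq> 0" using z \<tau> by auto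
  have z\<tau>: "z = -1 / \<tau>" using z0 by (simp add: \<tau>_def)
  define p2 :: complex where "p2 = of_real (pi ^ 2 / 3)"
  define K :: complex where "K = (2 * of_real pi * \<i>) ^ 2"
  define g where "g = (\<lambda>z (m::int, n::int). if (m, n) = (0, 0) then 0 else
           1 / (of_int m * z + of_int n) ^ 2 - 1 / ((of_int m * z + of_int n) ^ 2 - 1 / 4 :: complex))"
  define R where "R = (\<lambda>z (m::int). if m = 0 then p2 else K * neg_polylog 1 (nome z ^ nat \<bar>m\<bar>))"
  define t where "t = (\<lambda>n::int. \<tau> * (of_real pi * (cot (of_real pi * ((of_int n - 1 / 2) * \<tau>)) - cot (of_real pi * ((of_int n + 1 / 2) * \<tau>)))))"
  \<comment> \<open>The comparison term at the omitted lattice point 0 is \<open>-4\<close>; both orders of summation account for it by \<open>d\<close>.\<close>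
  define d where "d = (\<lambda>n::int. if n = 0 then 4 else 0 :: complex)"
  have summ: "g z summable_on UNIV \<times> UNIV" if "Im z > 0" for z
    using lattice_difference_summable(1)[OF that] by (simp only: g_def)
  have inv2: "((\<lambda>n::int. if (m, n) = (0, 0) then 0 else 1 / (of_int m * z + of_int n) ^ 2) has_sum R z m) UNIV"
    if z: "Im z > 0" for z m
  proof (cases "m = 0")
    case True
    thus ?thesis using has_sum_inverse_squares_int by (simp add: R_def p2_def if_distrib cong: if_cong)
  next
    case False
    have "((\<lambda>n::int. 1 / (of_int m * z + of_int n) ^ 2) has_sum K * neg_polylog 1 (nome z ^ nat \<bar>m\<bar>)) UNIV"
      unfolding K_def using lattice_row[OF z, of 1 m] False
      by (simp only: One_nat_def numeral_2_eq_2 fact_Suc fact_0 div_by_1 mult_1_right of_nat_1) simp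
    thus ?thesis using False by (simp add: R_def)
  qed
  have tel: "((\<lambda>n::int. if (m, n) = (0, 0) then 0 else 1 / ((of_int m * z + of_int n) ^ 2 - 1 / 4)) has_sum d m) UNIV"
    if z: "Im z > 0" for z m
  proof -
    define G where "G = (\<lambda>n::int. 1 / ((of_int m * z + of_int n) ^ 2 - 1 / 4))"
    define G' where "G' = (\<lambda>n::int. if (m, n) = (0, 0) then 0 else G n)"
    have "(\<lambda>n. g z (m, n)) summable_on UNIV"
      using summable_on_SigmaD1[of "\<lambda>m n. g z (m, n)" UNIV "\<lambda>_. UNIV" m] summ[OF z] by simp
    moreover have "(\<lambda>n. if (m, n) = (0, 0) then 0 else 1 / (of_int m * z + of_int n) ^ 2) summable_on UNIV"
      using inv2[OF z, of m] by (auto simp: summable_on_def)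
    ultimately have "(\<lambda>n. (if (m, n) = (0, 0) then 0 else 1 / (of_int m * z + of_int n) ^ 2) - g z (m, n)) summable_on UNIV"
      unfolding summable_on_def by (elim exE) (rule exI, rule has_sum_diff)
    also have "(\<lambda>n. (if (m, n) = (0, 0) then 0 else 1 / (of_int m * z + of_int n) ^ 2) - g z (m, n)) = G'"
      by (auto simp: g_def G'_def G_def fun_eq_iff)
    finally have s: "G' summable_on UNIV" .
    have del: "((\<lambda>n. if n = 0 then - d m else 0) has_sum - d m) (UNIV :: int set)"
      by (rule has_sum_finite_neutralI[where B = "{0}"]) auto
    have GG: "G = (\<lambda>n. G' n + (if n = 0 then - d m else 0))"
      by (auto simp: G_def G'_def d_def fun_eq_iff)
    have "G summable_on UNIV"
      unfolding GG using s del by (intro summable_on_add) (auto simp: summable_on_def)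
    moreover have "of_int m * z - 1 / 2 \<notin> \<int>"
    proof
      assume "of_int m * z - 1 / 2 \<in> \<int>"
      then obtain k :: int where k: "of_int m * z - 1 / 2 = of_int k" by (elim Ints_cases)
      from arg_cong[OF k, of Im] z have "m = 0" by simp
      with k have "of_int k = (- 1 / 2 :: complex)" by simp
      hence "2 * of_int k + 1 = (0 :: complex)" by simp
      hence "of_int (2 * k + 1) = (0 :: complex)" by simp
      thus False by (simp only: of_int_eq_0_iff) presburger
    qed
    ultimately have "(G has_sum 0) UNIV" unfolding G_def by (intro telescoping_row)
    from has_sum_diff[OF this del] have "(G' has_sum d m) UNIV" unfolding GG by simp
    thus ?thesis unfolding G'_def G_def .
  qed
  have g_eq: "g z (m, n) = (if (m, n) = (0, 0) then 0 else 1 / (of_int m * z + of_int n) ^ 2)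
                - (if (m, n) = (0, 0) then 0 else 1 / ((of_int m * z + of_int n) ^ 2 - 1 / 4))" for z m n
    by (simp add: g_def)
  have row: "((\<lambda>n. g z (m, n)) has_sum (R z m - d m)) UNIV" if z: "Im z > 0" for z m
    unfolding g_eq by (rule has_sum_diff[OF inv2[OF z] tel[OF z]])
  have col1: "((\<lambda>m::int. if (m, n) = (0, 0) then 0 else 1 / (of_int m * z + of_int n) ^ 2) has_sum \<tau> ^ 2 * R \<tau> n) UNIV" for n
  proof -
    have "((\<lambda>m::int. \<tau> ^ 2 * (if (- n, m) = (0, 0) then 0 else 1 / (of_int (- n) * \<tau> + of_int m) ^ 2)) has_sum \<tau> ^ 2 * R \<tau> (- n)) UNIV"
      by (intro has_sum_cmult_right inv2 \<tau>)
    moreover have "\<tau> ^ 2 * (if (- n, m) = (0, 0) then 0 else 1 / (of_int (- n) * \<tau> + of_int m) ^ 2) =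
                     (if (m, n) = (0, 0) then 0 else 1 / (of_int m * z + of_int n) ^ 2)" for m
    proof -
      have "of_int (- n) * \<tau> + of_int m = - \<tau> * (of_int m * z + of_int n)"
        using z0 by (simp add: z\<tau> field_simps)
      hence "(of_int (- n) * \<tau> + of_int m) ^ 2 = \<tau> ^ 2 * (of_int m * z + of_int n) ^ 2"
        by (simp add: power_mult_distrib)
      thus ?thesis using z0 by auto
    qed
    moreover have "R \<tau> (- n) = R \<tau> n" by (simp add: R_def)
    ultimately show ?thesis by simp
  qed
  have col2: "((\<lambda>m::int. if (m, n) = (0, 0) then 0 else 1 / ((of_int m * z + of_int n) ^ 2 - 1 / 4)) has_sum (t n + d n)) UNIV" for n
  proof -
    define a where "a = - ((of_int n + 1 / 2) * \<tau>)"
    define b where "b = - ((of_int n - 1 / 2) * \<tau>)"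
    have half: "of_int n + 1 / 2 \<noteq> (0 :: real)" "of_int n - 1 / 2 \<noteq> (0 :: real)"
    proof -
      have "2 * n + 1 \<noteq> 0" "2 * n - 1 \<noteq> 0" by presburger+
      hence "of_int (2 * n + 1) \<noteq> (0 :: real)" "of_int (2 * n - 1) \<noteq> (0 :: real)" by (simp_all only: of_int_eq_0_iff not_False_eq_True)
      thus "of_int n + 1 / 2 \<noteq> (0 :: real)" "of_int n - 1 / 2 \<noteq> (0 :: real)" by simp_all
    qed
    have "Im a = - ((of_int n + 1 / 2) * Im \<tau>)" "Im b = - ((of_int n - 1 / 2) * Im \<tau>)"
      by (simp_all add: a_def b_def)
    hence ab: "Im a \<noteq> 0" "Im b \<noteq> 0" using half \<tau> by auto
    have ba: "b - a = \<tau>" by (simp add: a_def b_def algebra_simps)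
    hence "a \<noteq> b" using z0 by auto
    have ct: "cot (of_real pi * a) - cot (of_real pi * b) =
        cot (of_real pi * ((of_int n - 1 / 2) * \<tau>)) - cot (of_real pi * ((of_int n + 1 / 2) * \<tau>))"
      unfolding a_def b_def mult_minus_right cot_minus by simp
    have eq: "\<tau> ^ 2 * (1 / ((of_int m + a) * (of_int m + b))) = 1 / ((of_int m * z + of_int n) ^ 2 - 1 / 4)" for m :: int
    proof -
      have "(of_int m + a) * (of_int m + b) = \<tau> ^ 2 * ((of_int m * z + of_int n) ^ 2 - 1 / 4)"
        using z0 by (simp add: a_def b_def z\<tau> field_simps power2_eq_square)
      thus ?thesis using z0 by simp
    qed
    have "((\<lambda>m::int. \<tau> ^ 2 * (1 / ((of_int m + a) * (of_int m + b)))) has_sum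
           \<tau> ^ 2 * (of_real pi * (cot (of_real pi * a) - cot (of_real pi * b)) / (b - a))) UNIV"
      by (intro has_sum_cmult_right has_sum_cot_difference ab \<open>a \<noteq> b\<close>)
    hence *: "((\<lambda>m::int. 1 / ((of_int m * z + of_int n) ^ 2 - 1 / 4)) has_sum t n) UNIV"
      unfolding eq ct ba t_def using z0 by (simp add: power2_eq_square)
    have del: "((\<lambda>m. if m = 0 then d n else 0) has_sum d n) (UNIV :: int set)"
      by (rule has_sum_finite_neutralI[where B = "{0}"]) auto
    have "(\<lambda>m::int. if (m, n) = (0, 0) then 0 else 1 / ((of_int m * z + of_int n) ^ 2 - 1 / 4)) =
          (\<lambda>m. 1 / ((of_int m * z + of_int n) ^ 2 - 1 / 4) + (if m = 0 then d n else 0))"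
      by (auto simp: d_def fun_eq_iff)
    thus ?thesis using has_sum_add[OF * del] by simp
  qed
  have col: "((\<lambda>m. g z (m, n)) has_sum (\<tau> ^ 2 * R \<tau> n - (t n + d n))) UNIV" for n
    unfolding g_eq by (rule has_sum_diff[OF col1 col2])
  obtain S where S: "((\<lambda>m. R z m - d m) has_sum S) UNIV"
      "((\<lambda>n. \<tau> ^ 2 * R \<tau> n - (t n + d n)) has_sum S) UNIV"
    using has_sum_rows_columns[OF summ[OF z] row[OF z] col] by blast
  have d: "(d has_sum 4) UNIV"
    by (rule has_sum_finite_neutralI[where B = "{0}"]) (auto simp: d_def)
  have Rz0: "(R z has_sum p2 * E2 z) UNIV" if z: "Im z > 0" "(R z has_sum s) UNIV" for z s
  proof -
    have "s = p2 + 2 * K * lambert 1 (nome z)"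
      by (rule lattice_row_sum) (use that in \<open>auto simp: R_def\<close>)
    also have "\<dots> = p2 * E2 z"
      by (simp add: E2_lambert K_def p2_def power_mult_distrib algebra_simps)
    finally show ?thesis using that by simp
  qed
  have Rz: "(R z has_sum p2 * E2 z) UNIV" if z: "Im z > 0" for z
  proof -
    have "(g z has_sum infsum (g z) (UNIV \<times> UNIV)) (UNIV \<times> UNIV)"
      using summ[OF z] by (rule has_sum_infsum)
    hence "((\<lambda>m. R z m - d m) has_sum infsum (g z) (UNIV \<times> UNIV)) UNIV"
      by (rule has_sum_SigmaD) (use row[OF z] in auto)
    from has_sum_add[OF this d] show ?thesis by (intro Rz0 z) simp
  qed
  have "(R z has_sum (S + 4)) UNIV" using has_sum_add[OF S(1) d] by simp
  from has_sum_unique[OF this Rz[OF z]] have S_eq: "S + 4 = p2 * E2 z" .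
  note R\<tau> = Rz[OF \<tau>]
  have "((\<lambda>n. \<tau> ^ 2 * R \<tau> n - (\<tau> ^ 2 * R \<tau> n - (t n + d n)) - d n) has_sum (\<tau> ^ 2 * (p2 * E2 \<tau>) - S - 4)) UNIV"
    by (intro has_sum_diff has_sum_cmult_right R\<tau> S(2) d)
  hence T: "(t has_sum (\<tau> ^ 2 * (p2 * E2 \<tau>) - S - 4)) UNIV" by (simp add: algebra_simps)
  define c where "c = (\<lambda>x. cot (of_real pi * (x * \<tau>)))"
  have c_minus: "c (- x) = - c x" for x unfolding c_def mult_minus_left mult_minus_right cot_minus ..
  have clim: "(\<lambda>N. c (of_nat N + 1 / 2)) \<longlonglongrightarrow> - \<i>"
    unfolding c_def by (rule cot_tendsto_upper[OF \<tau>])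
  have t_eq: "t n = \<tau> * (of_real pi * (c (of_int n - 1 / 2) - c (of_int n + 1 / 2)))" for n
    by (simp only: t_def c_def)
  have "(\<lambda>k. \<tau> * (of_real pi * (c (of_nat k + 1 / 2) - c (of_nat (Suc k) + 1 / 2)))) sums
          (\<tau> * (of_real pi * (c (of_nat 0 + 1 / 2) - (- \<i>))))"
    by (intro sums_mult telescope_sums'[OF clim])
  hence 1: "(\<lambda>k. \<tau> * (of_real pi * (c (of_nat k + 1 / 2) - c (of_nat k + 3 / 2)))) sums (\<tau> * (of_real pi * (c (1 / 2) + \<i>)))"
    by (simp add: add_ac)
  have "t (- 1 - int k) = \<tau> * (of_real pi * (c (of_nat k + 1 / 2) - c (of_nat k + 3 / 2)))" for k
  proof -
    have "of_int (- 1 - int k) - 1 / 2 = - (of_nat k + 3 / 2 :: complex)"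
         "of_int (- 1 - int k) + 1 / 2 = - (of_nat k + 1 / 2 :: complex)"
      by (simp_all add: field_simps)
    thus ?thesis unfolding t_eq by (simp only: c_minus) simp
  qed
  with 1 have t2: "(\<lambda>k. t (- 1 - int k)) sums (\<tau> * (of_real pi * (c (1 / 2) + \<i>)))" by simp
  have "t (int (Suc k)) = \<tau> * (of_real pi * (c (of_nat k + 1 / 2) - c (of_nat k + 3 / 2)))" for k
    unfolding t_eq by (simp add: field_simps)
  with 1 have "(\<lambda>k. t (int (Suc k))) sums (\<tau> * (of_real pi * (c (1 / 2) + \<i>)))" by simp
  hence t1: "(\<lambda>k. t (int k)) sums (\<tau> * (of_real pi * (c (1 / 2) + \<i>)) + t (int 0))"
    by (subst (asm) sums_Suc_iff)
  have "t 0 = - (\<tau> * (of_real pi * (2 * c (1 / 2))))"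
    unfolding t_eq using c_minus[of "1 / 2"] by (simp add: algebra_simps)
  hence "(t has_sum (2 * of_real pi * \<i> * \<tau>)) UNIV"
    using has_sum_int_split[OF _ t1 t2] T by (simp add: algebra_simps summable_on_def) blast
  from has_sum_unique[OF this T] have "\<tau> ^ 2 * (p2 * E2 \<tau>) = p2 * E2 z + 2 * of_real pi * \<i> * \<tau>"
    using S_eq by (simp add: algebra_simps)
  moreover have "z * \<tau> = - 1" using z0 by (simp add: \<tau>_def)
  ultimately have "p2 * E2 \<tau> = p2 * (z ^ 2 * E2 z) - 2 * of_real pi * \<i> * z" by algebra
  also have "\<dots> = p2 * (z ^ 2 * E2 z + alpha * z)"
    by (simp add: p2_def alpha_def field_simps power2_eq_square)
  finally show ?thesis by (simp add: p2_def \<tau>_def)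
qed

section \<open>Lambert series as functions of the nome\<close>

text \<open>The quotient by \<open>q\<close> exhibits the zero of the Lambert series at the cusp and, as its value there,
  the first coefficient.\<close>

definition lambert_quotient :: "nat \<Rightarrow> complex \<Rightarrow> complex" where
  "lambert_quotient j q = (\<Sum>n. of_nat (Suc n) ^ j * q ^ n / (1 - q ^ Suc n))"

lemma lambert_quotient_bound:
  fixes q :: complex
  assumes "0 \<le> r" "r < 1" "norm q \<le> r"
  shows "norm (of_nat (Suc n) ^ j * q ^ n / (1 - q ^ Suc n)) \<le> real (Suc n) ^ j * r ^ n * (1 / (1 - r))"
proof -
  have "norm q ^ Suc n \<le> r ^ Suc n" using assms by (intro power_mono) auto
  also have "r ^ Suc n \<le> r ^ 1" using assms by (intro power_decreasing) auto
  finally have "1 - r \<le> norm (1::complex) - norm (q ^ Suc n)" by (simp only: norm_power norm_one power_one_right)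
  also have "\<dots> \<le> norm (1 - q ^ Suc n)" by (rule norm_triangle_ineq2)
  finally have *: "1 - r \<le> norm (1 - q ^ Suc n)" .
  have "norm (of_nat (Suc n) ^ j * q ^ n / (1 - q ^ Suc n)) = real (Suc n) ^ j * norm q ^ n * (1 / norm (1 - q ^ Suc n))"
    by (simp only: norm_divide norm_mult norm_power norm_of_nat times_divide_eq_right mult_1_right)
  also have "\<dots> \<le> real (Suc n) ^ j * r ^ n * (1 / (1 - r))"
    using assms * by (intro mult_mono power_mono divide_left_mono mult_pos_pos) auto
  finally show ?thesis .
qed

lemma holomorphic_lambert_quotient: "lambert_quotient j holomorphic_on ball 0 1"
proof (rule holomorphic_uniform_sequence)
  define t where "t = (\<lambda>n q. of_nat (Suc n) ^ j * q ^ n / (1 - q ^ Suc n) :: complex)"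
  have nz: "1 - q ^ Suc n \<noteq> 0" if "q \<in> ball 0 1" for q :: complex and n
  proof
    assume "1 - q ^ Suc n = 0"
    hence "norm (q ^ Suc n) = norm (1 :: complex)" by simp
    hence "norm q ^ Suc n = 1" by (simp only: norm_power norm_one)
    moreover have "norm q ^ Suc n < 1"
      using that power_strict_mono[of "norm q" 1 "Suc n"] by simp
    ultimately show False by simp
  qed
  show "(\<lambda>q. \<Sum>i<n. t i q) holomorphic_on ball 0 1" for n
    unfolding t_def by (intro holomorphic_intros) (use nz in auto)
  show "open (ball 0 (1::real) :: complex set)" by simp
  fix x :: complex assume x: "x \<in> ball 0 1"
  define d where "d = (1 - norm x) / 2"
  define r where "r = (1 + norm x) / 2"
  have d: "d > 0" and r: "0 \<le> r" "r < 1" using x by (auto simp: d_def r_def)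
  have nq: "norm q \<le> r" if "q \<in> cball x d" for q
  proof -
    have "norm q \<le> norm x + norm (q - x)" using norm_triangle_ineq[of x "q - x"] by simp
    also have "norm (q - x) \<le> d" using that by (simp add: dist_norm norm_minus_commute)
    finally show ?thesis by (simp add: d_def r_def field_simps)
  qed
  have "uniform_limit (cball x d) (\<lambda>n q. \<Sum>i<n. t i q) (\<lambda>q. \<Sum>i. t i q) sequentially"
  proof (rule Weierstrass_m_test)
    show "norm (t n q) \<le> real (Suc n) ^ j * r ^ n * (1 / (1 - r))" if "q \<in> cball x d" for n q
      unfolding t_def by (rule lambert_quotient_bound) (use r nq that in auto)
    show "summable (\<lambda>n. real (Suc n) ^ j * r ^ n * (1 / (1 - r)))"
      by (intro summable_mult2 summable_poly_geometric r)
  qed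
  moreover have "(\<lambda>q. \<Sum>i. t i q) = lambert_quotient j"
    by (simp add: fun_eq_iff lambert_quotient_def t_def)
  moreover have "cball x d \<subseteq> ball 0 1" using nq r by force
  ultimately show "\<exists>d>0. cball x d \<subseteq> ball 0 1 \<and> uniform_limit (cball x d) (\<lambda>n q. \<Sum>i<n. t i q) (lambert_quotient j) sequentially"
    using d by auto
qed

lemma lambert_quotient_0: "lambert_quotient j 0 = 1"
proof -
  have "lambert_quotient j 0 = (\<Sum>n. if n = 0 then 1 else 0 :: complex)"
    unfolding lambert_quotient_def by (intro suminf_cong) auto
  also have "\<dots> = 1" by (subst suminf_finite[of "{0}"]) auto
  finally show ?thesis .
qed

lemma lambert_eq: "norm q < 1 \<Longrightarrow> lambert j q = q * lambert_quotient j q"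
proof -
  assume q: "norm q < 1"
  have "summable (\<lambda>n. of_nat (Suc n) ^ j * q ^ n / (1 - q ^ Suc n))"
    by (rule summable_comparison_test'[OF summable_mult2[OF summable_poly_geometric[of "norm q" j], of "1 / (1 - norm q)"]])
       (use q lambert_quotient_bound[of "norm q" q _ j] in auto)
  hence "q * lambert_quotient j q = (\<Sum>n. q * (of_nat (Suc n) ^ j * q ^ n / (1 - q ^ Suc n)))"
    unfolding lambert_quotient_def by (rule suminf_mult [symmetric])
  thus ?thesis by (simp add: lambert_def mult_ac)
qed

section \<open>The derivation and the Serre derivative\<close>

lemma Dq_eqI: "(f has_field_derivative 2 * of_real pi * \<i> * d) (at z) \<Longrightarrow> Dq f z = d"
  by (simp add: Dq_def DERIV_imp_deriv)

lemma has_field_derivative_Dq: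
  assumes "f holomorphic_on S" "open S" "z \<in> S"
  shows "(f has_field_derivative 2 * of_real pi * \<i> * Dq f z) (at z)"
  using holomorphic_derivI[OF assms] by (simp add: Dq_def)

lemma holomorphic_Dq [holomorphic_intros]: "f holomorphic_on S \<Longrightarrow> open S \<Longrightarrow> Dq f holomorphic_on S"
  unfolding Dq_def by (intro holomorphic_intros) auto

lemma Dq_cong:
  assumes "\<And>z. z \<in> S \<Longrightarrow> f z = g z" "open S" "z \<in> S"
  shows "Dq f z = Dq g z"
proof -
  have "eventually (\<lambda>x. f x = g x) (nhds z)"
    using eventually_nhds_in_open[OF assms(2,3)] by eventually_elim (use assms(1) in auto)
  thus ?thesis unfolding Dq_def by (auto intro!: arg_cong2[where f = "(/)"] deriv_cong_ev)
qed

context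
  fixes S f g and z :: complex
  assumes S: "open S" "z \<in> S" and f: "f holomorphic_on S" and g: "g holomorphic_on S"
begin

lemma Dq_add: "Dq (\<lambda>z. f z + g z) z = Dq f z + Dq g z"
  by (rule Dq_eqI) (auto intro!: derivative_eq_intros has_field_derivative_Dq[OF f S] has_field_derivative_Dq[OF g S] simp: algebra_simps)

lemma Dq_diff: "Dq (\<lambda>z. f z - g z) z = Dq f z - Dq g z"
  by (rule Dq_eqI) (auto intro!: derivative_eq_intros has_field_derivative_Dq[OF f S] has_field_derivative_Dq[OF g S] simp: algebra_simps)

lemma Dq_mult: "Dq (\<lambda>z. f z * g z) z = Dq f z * g z + f z * Dq g z"
  by (rule Dq_eqI) (auto intro!: derivative_eq_intros has_field_derivative_Dq[OF f S] has_field_derivative_Dq[OF g S] simp: algebra_simps)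

lemma Dq_divide: "g z \<noteq> 0 \<Longrightarrow> Dq (\<lambda>z. f z / g z) z = (Dq f z * g z - f z * Dq g z) / g z ^ 2"
  by (rule Dq_eqI) (auto intro!: derivative_eq_intros has_field_derivative_Dq[OF f S] has_field_derivative_Dq[OF g S] simp: field_simps power2_eq_square)

end

context
  fixes S f and z :: complex
  assumes S: "open S" "z \<in> S" and f: "f holomorphic_on S"
begin

lemma Dq_cmult: "Dq (\<lambda>z. c * f z) z = c * Dq f z"
  by (rule Dq_eqI) (auto intro!: derivative_eq_intros has_field_derivative_Dq[OF f S] simp: algebra_simps)

lemma Dq_power: "Dq (\<lambda>z. f z ^ n) z = of_nat n * f z ^ (n - 1) * Dq f z"
  by (rule Dq_eqI) (auto intro!: derivative_eq_intros has_field_derivative_Dq[OF f S] simp: algebra_simps)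

end

lemma Dq_const [simp]: "Dq (\<lambda>_. c) z = 0"
  by (simp add: Dq_def)

lemma Dq_minus_inverse:
  assumes "h holomorphic_on \<H>" "Im z > 0"
  shows "Dq (\<lambda>z. h (-1 / z)) z = Dq h (-1 / z) / z ^ 2"
proof -
  have "z \<noteq> 0" using assms(2) by auto
  have *: "-1 / z \<in> \<H>" using assms(2) minus_inverse_in_upper_half_plane by simp
  have i: "((\<lambda>z. -1 / z) has_field_derivative 1 / z ^ 2) (at z)"
    using \<open>z \<noteq> 0\<close> by (auto intro!: derivative_eq_intros simp: power2_eq_square)
  show ?thesis
    by (rule Dq_eqI)
       (use DERIV_chain2[where f = h and g = "\<lambda>z. -1 / z",
              OF has_field_derivative_Dq[OF assms(1) open_upper_half_plane *] i] in simp)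
qed

text \<open>The Serre derivative on functions of weight \<open>m\<close>.\<close>

definition serre :: "int \<Rightarrow> (complex \<Rightarrow> complex) \<Rightarrow> complex \<Rightarrow> complex" where
  "serre m h z = Dq h z - of_int m / 12 * E2 z * h z"

lemma Dq_power_int:
  assumes "Im z > 0"
  shows "Dq (\<lambda>z. z powi m) z = of_int m * z powi m / (2 * of_real pi * \<i> * z)"
proof -
  have "z \<noteq> 0" using assms by auto
  show ?thesis
    by (rule Dq_eqI) (use \<open>z \<noteq> 0\<close> in \<open>auto intro!: derivative_eq_intros simp: power_int_diff field_simps\<close>)
qed

text \<open>The Serre derivative raises the weight by 2, also for vector-valued functions: the function
  on the right-hand side of the transformation law may differ from the one on the left.\<close>

lemma serre_minus_inverse:
  assumes h: "h holomorphic_on \<H>" and h': "h' holomorphic_on \<H>"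
    and law: "\<And>z. Im z > 0 \<Longrightarrow> h (-1 / z) = z powi m * h' z" and z: "Im z > 0"
  shows "serre m h (-1 / z) = z powi (m + 2) * serre m h' z"
proof -
  have z0: "z \<noteq> 0" using z by auto
  have "Dq h (-1 / z) / z ^ 2 = Dq (\<lambda>z. h (-1 / z)) z"
    by (rule Dq_minus_inverse [OF h z, symmetric])
  also have "\<dots> = Dq (\<lambda>z. z powi m * h' z) z"
    by (rule Dq_cong[of \<H>]) (use law z in auto)
  also have "\<dots> = Dq (\<lambda>z. z powi m) z * h' z + z powi m * Dq h' z"
    by (rule Dq_mult[of \<H>]) (use z in \<open>auto intro!: h' holomorphic_intros\<close>)
  finally have D: "Dq h (-1 / z) = z ^ 2 * (of_int m * z powi m / (2 * of_real pi * \<i> * z) * h' z + z powi m * Dq h' z)"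
    using z0 z by (simp add: Dq_power_int field_simps)
  have p: "z powi (m + 2) = z powi m * z ^ 2" using z0 by (simp add: power_int_add)
  have a: "alpha = 12 * (1 / (2 * of_real pi * \<i>))" by (simp add: alpha_def)
  define k :: complex where "k = 1 / (2 * of_real pi * \<i>)"
  have "of_int m * z powi m / (2 * of_real pi * \<i> * z) * z = of_int m * z powi m * k"
    using z0 by (simp add: k_def)
  moreover define X where "X = of_int m * z powi m / (2 * of_real pi * \<i> * z)"
  ultimately have X: "X * z = of_int m * z powi m * k" by simp
  have "serre m h (-1 / z) = z ^ 2 * (X * h' z + z powi m * Dq h' z) - of_int m / 12 * (z ^ 2 * E2 z + 12 * k * z) * (z powi m * h' z)"
    unfolding serre_def D law[OF z] E2_minus_inverse[OF z] X_def a k_def ..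
  also have "\<dots> = z * (X * z) * h' z + z ^ 2 * z powi m * Dq h' z - of_int m / 12 * (z ^ 2 * E2 z + 12 * k * z) * (z powi m * h' z)"
    by (simp add: algebra_simps power2_eq_square)
  also have "\<dots> = z powi m * z ^ 2 * serre m h' z"
    unfolding X serre_def by (simp add: algebra_simps)
  finally show ?thesis unfolding p .
qed

section \<open>Holomorphic functions of the nome\<close>

text \<open>The filter of neighbourhoods of the cusp: the imaginary part tends to infinity, uniformly in the
  real part.\<close>

definition at_cusp :: "complex filter" where "at_cusp = filtercomap Im at_top"

lemma eventually_at_cusp: "eventually P at_cusp \<longleftrightarrow> (\<exists>B. \<forall>z. Im z > B \<longrightarrow> P z)"
  unfolding at_cusp_def eventually_filtercomap eventually_at_top_dense by blast

lemma eventually_at_cusp_Im: "eventually (\<lambda>z. Im z > B) at_cusp"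
  unfolding eventually_at_cusp by blast

lemma at_cusp_neq_bot [simp]: "at_cusp \<noteq> bot"
proof
  assume "at_cusp = bot"
  hence "eventually (\<lambda>_. False) at_cusp" by simp
  then obtain B where "\<And>z. Im z > B \<Longrightarrow> False" unfolding eventually_at_cusp by blast
  from this[of "Complex 0 (B + 1)"] show False by simp
qed

lemma tendsto_nome: "(nome \<longlongrightarrow> 0) at_cusp"
proof -
  have "((\<lambda>x. exp (- 2 * pi * x)) \<longlongrightarrow> 0) at_top"
    by (rule filterlim_compose[OF exp_at_bot])
       (intro filterlim_tendsto_neg_mult_at_bot[OF tendsto_const _ filterlim_ident]; simp)
  hence "((\<lambda>z. norm (nome z)) \<longlongrightarrow> 0) at_cusp"
    unfolding norm_nome at_cusp_def by (rule filterlim_compose) (rule filterlim_filtercomap)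
  thus ?thesis by (rule tendsto_norm_zero_cancel)
qed

text \<open>Periodic functions that are holomorphic on the upper half-plane and at the cusp. As functions of
  the nome they are visibly closed under all operations used below, including differentiation.\<close>

definition q_holomorphic :: "(complex \<Rightarrow> complex) \<Rightarrow> bool" where
  "q_holomorphic F \<longleftrightarrow> (\<exists>G. G holomorphic_on ball 0 1 \<and> (\<forall>z\<in>\<H>. F z = G (nome z)))"

named_theorems q_intros

lemma q_holomorphic_const [q_intros]: "q_holomorphic (\<lambda>_. c)"
  unfolding q_holomorphic_def by (intro exI[of _ "\<lambda>_. c"]) auto

lemma q_holomorphic_nome [q_intros]: "q_holomorphic nome"
  unfolding q_holomorphic_def by (intro exI[of _ "\<lambda>q. q"]) auto

lemma q_holomorphic_add [q_intros]: "q_holomorphic F \<Longrightarrow> q_holomorphic G \<Longrightarrow> q_holomorphic (\<lambda>z. F z + G z)"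
  unfolding q_holomorphic_def
proof safe
  fix A B assume "A holomorphic_on ball 0 1" "B holomorphic_on ball 0 1" "\<forall>z\<in>\<H>. F z = A (nome z)" "\<forall>z\<in>\<H>. G z = B (nome z)"
  thus "\<exists>C. C holomorphic_on ball 0 1 \<and> (\<forall>z\<in>\<H>. F z + G z = C (nome z))"
    by (intro exI[of _ "\<lambda>q. A q + B q"]) (auto intro!: holomorphic_intros)
qed

lemma q_holomorphic_mult [q_intros]: "q_holomorphic F \<Longrightarrow> q_holomorphic G \<Longrightarrow> q_holomorphic (\<lambda>z. F z * G z)"
  unfolding q_holomorphic_def
proof safe
  fix A B assume "A holomorphic_on ball 0 1" "B holomorphic_on ball 0 1" "\<forall>z\<in>\<H>. F z = A (nome z)" "\<forall>z\<in>\<H>. G z = B (nome z)"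
  thus "\<exists>C. C holomorphic_on ball 0 1 \<and> (\<forall>z\<in>\<H>. F z * G z = C (nome z))"
    by (intro exI[of _ "\<lambda>q. A q * B q"]) (auto intro!: holomorphic_intros)
qed

lemma q_holomorphic_diff [q_intros]: "q_holomorphic F \<Longrightarrow> q_holomorphic G \<Longrightarrow> q_holomorphic (\<lambda>z. F z - G z)"
  using q_holomorphic_add[of F "\<lambda>z. -1 * G z"] q_holomorphic_mult[OF q_holomorphic_const[of "-1"], of G] by simp

lemma q_holomorphic_power [q_intros]: "q_holomorphic F \<Longrightarrow> q_holomorphic (\<lambda>z. F z ^ n)"
  by (induction n) (auto intro!: q_intros)

lemma q_holomorphic_compose [q_intros]: "G holomorphic_on ball 0 1 \<Longrightarrow> q_holomorphic (\<lambda>z. G (nome z))"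
  unfolding q_holomorphic_def by auto

lemma q_holomorphic_cong: "q_holomorphic F \<Longrightarrow> (\<And>z. Im z > 0 \<Longrightarrow> F z = G z) \<Longrightarrow> q_holomorphic G"
  unfolding q_holomorphic_def by auto

lemma q_holomorphic_lambert [q_intros]: "q_holomorphic (\<lambda>z. lambert j (nome z))"
  by (rule q_holomorphic_cong[of "\<lambda>z. nome z * lambert_quotient j (nome z)"])
     (auto intro!: q_holomorphic_mult[OF q_holomorphic_nome q_holomorphic_compose] holomorphic_lambert_quotient simp: lambert_eq)

lemma q_holomorphic_E2 [q_intros]: "q_holomorphic E2"
  unfolding E2_lambert[abs_def] by (intro q_intros)

lemma q_holomorphic_E4 [q_intros]: "q_holomorphic E4"
  unfolding E4_lambert[abs_def] by (intro q_intros)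

lemma q_holomorphic_E6 [q_intros]: "q_holomorphic E6"
  unfolding E6_lambert[abs_def] by (intro q_intros)

lemma q_holomorphic_imp_holomorphic:
  assumes "q_holomorphic F"
  shows "F holomorphic_on \<H>"
proof -
  obtain G where G: "G holomorphic_on ball 0 1" "\<And>z. z \<in> \<H> \<Longrightarrow> F z = G (nome z)"
    using assms unfolding q_holomorphic_def by blast
  have "G \<circ> nome holomorphic_on \<H>"
  proof (rule holomorphic_on_compose_gen[OF _ G(1)])
    show "nome holomorphic_on \<H>" unfolding nome_def by (intro holomorphic_intros)
  qed auto
  thus ?thesis by (rule holomorphic_transform) (use G(2) in auto)
qed

lemma q_holomorphic_Dq_expansion:
  assumes G: "G holomorphic_on ball 0 1" "\<And>z. Im z > 0 \<Longrightarrow> F z = G (nome z)" and z: "Im z > 0"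
  shows "Dq F z = nome z * deriv G (nome z)"
proof -
  have "Dq F z = Dq (\<lambda>z. G (nome z)) z" by (rule Dq_cong[of \<H>]) (use G z in auto)
  also have "\<dots> = nome z * deriv G (nome z)"
  proof (rule Dq_eqI)
    have "(G has_field_derivative deriv G (nome z)) (at (nome z))"
      using G(1) z by (intro holomorphic_derivI[of _ "ball 0 1"]) auto
    from DERIV_chain2[where f = G and g = nome, OF this has_field_derivative_nome]
    show "((\<lambda>z. G (nome z)) has_field_derivative 2 * of_real pi * \<i> * (nome z * deriv G (nome z))) (at z)"
      by (simp add: mult_ac)
  qed
  finally show ?thesis .
qed

lemma q_holomorphic_Dq [q_intros]: "q_holomorphic F \<Longrightarrow> q_holomorphic (Dq F)"
proof -
  assume "q_holomorphic F"
  then obtain G where G: "G holomorphic_on ball 0 1" "\<And>z. Im z > 0 \<Longrightarrow> F z = G (nome z)"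
    unfolding q_holomorphic_def by auto
  show ?thesis
    by (rule q_holomorphic_cong[of "\<lambda>z. nome z * deriv G (nome z)"])
       (use q_holomorphic_Dq_expansion[OF G] in
        \<open>auto intro!: q_holomorphic_mult[OF q_holomorphic_nome q_holomorphic_compose] holomorphic_deriv G(1)\<close>)
qed

lemma q_holomorphic_serre [q_intros]: "q_holomorphic F \<Longrightarrow> q_holomorphic (serre m F)"
  unfolding serre_def[abs_def] by (intro q_intros)

lemma holomorphic_E2 [holomorphic_intros]: "E2 holomorphic_on \<H>"
  and holomorphic_E4 [holomorphic_intros]: "E4 holomorphic_on \<H>"
  and holomorphic_E6 [holomorphic_intros]: "E6 holomorphic_on \<H>"
  by (intro q_holomorphic_imp_holomorphic q_intros)+

lemma holomorphic_serre [holomorphic_intros]: "h holomorphic_on \<H> \<Longrightarrow> serre m h holomorphic_on \<H>"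
  unfolding serre_def[abs_def] by (intro holomorphic_intros) auto

lemma nome_add_of_int: "nome (z + of_int n) = nome z"
proof -
  have "2 * of_real pi * \<i> * (z + of_int n) = 2 * of_real pi * \<i> * z + \<i> * (of_int n * (of_real pi * 2))"
    by (simp add: algebra_simps)
  thus ?thesis unfolding nome_def by (simp only: exp_plus_2pin)
qed

lemma q_holomorphic_periodic: "q_holomorphic F \<Longrightarrow> Im z > 0 \<Longrightarrow> F (z + of_int n) = F z"
  unfolding q_holomorphic_def by (auto simp: nome_add_of_int)

lemma tendsto_compose_nome:
  assumes "G holomorphic_on ball 0 1"
  shows "((\<lambda>z. G (nome z)) \<longlongrightarrow> G 0) at_cusp"
proof -
  have "continuous_on (ball 0 1) G" by (rule holomorphic_on_imp_continuous_on[OF assms])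
  hence "isCont G 0" by (simp add: continuous_on_eq_continuous_at)
  thus ?thesis using tendsto_nome by (rule isCont_tendsto_compose)
qed

lemma q_holomorphic_tendsto:
  assumes "q_holomorphic F"
  obtains L where "(F \<longlongrightarrow> L) at_cusp"
proof -
  obtain G where G: "G holomorphic_on ball 0 1" "\<And>z. Im z > 0 \<Longrightarrow> F z = G (nome z)"
    using assms unfolding q_holomorphic_def by auto
  have "(F \<longlongrightarrow> G 0) at_cusp"
    by (rule Lim_transform_eventually[OF tendsto_compose_nome[OF G(1)]])
       (use eventually_at_cusp_Im[of 0] in eventually_elim, auto simp: G(2))
  thus ?thesis using that by blast
qed

lemma q_holomorphic_factor:
  assumes "q_holomorphic F" "(F \<longlongrightarrow> L) at_cusp"
  obtains F1 where "q_holomorphic F1" "\<And>z. Im z > 0 \<Longrightarrow> F z = L + nome z * F1 z"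
    "\<And>d. (F1 \<longlongrightarrow> d) at_cusp \<Longrightarrow> ((\<lambda>z. Dq F z / nome z) \<longlongrightarrow> d) at_cusp"
proof -
  obtain G where G: "G holomorphic_on ball 0 1" "\<And>z. Im z > 0 \<Longrightarrow> F z = G (nome z)"
    using assms unfolding q_holomorphic_def by auto
  have "(F \<longlongrightarrow> G 0) at_cusp"
    by (rule Lim_transform_eventually[OF tendsto_compose_nome[OF G(1)]])
       (use eventually_at_cusp_Im[of 0] in eventually_elim, auto simp: G(2))
  hence L: "L = G 0" using assms(2) tendsto_unique[OF at_cusp_neq_bot] by blast
  define G1 where "G1 = (\<lambda>q. if q = 0 then deriv G 0 else (G q - G 0) / (q - 0))"
  have G1: "G1 holomorphic_on ball 0 1"
    unfolding G1_def by (rule pole_lemma_open[OF G(1)]) auto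
  show ?thesis
  proof (rule that)
    show "q_holomorphic (\<lambda>z. G1 (nome z))" by (intro q_intros G1)
    show "F z = L + nome z * G1 (nome z)" if "Im z > 0" for z
      using that by (simp add: G G1_def L)
    fix d assume "((\<lambda>z. G1 (nome z)) \<longlongrightarrow> d) at_cusp"
    hence "d = deriv G 0"
      using tendsto_unique[OF at_cusp_neq_bot _ tendsto_compose_nome[OF G1]] by (simp add: G1_def)
    moreover have "((\<lambda>z. deriv G (nome z)) \<longlongrightarrow> deriv G 0) at_cusp"
      by (intro tendsto_compose_nome holomorphic_deriv G(1)) auto
    hence "((\<lambda>z. Dq F z / nome z) \<longlongrightarrow> deriv G 0) at_cusp"
      by (rule Lim_transform_eventually)
         (use eventually_at_cusp_Im[of 0] in eventually_elim, auto simp: q_holomorphic_Dq_expansion[OF G])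
    ultimately show "((\<lambda>z. Dq F z / nome z) \<longlongrightarrow> d) at_cusp" by simp
  qed
qed

lemma tendsto_Dq_cusp: "q_holomorphic F \<Longrightarrow> (Dq F \<longlongrightarrow> 0) at_cusp"
proof -
  assume "q_holomorphic F"
  then obtain G where G: "G holomorphic_on ball 0 1" "\<And>z. Im z > 0 \<Longrightarrow> F z = G (nome z)"
    unfolding q_holomorphic_def by auto
  have "((\<lambda>z. nome z * deriv G (nome z)) \<longlongrightarrow> 0 * deriv G 0) at_cusp"
    by (intro tendsto_mult tendsto_nome tendsto_compose_nome holomorphic_deriv G(1)) auto
  hence "((\<lambda>z. nome z * deriv G (nome z)) \<longlongrightarrow> 0) at_cusp" by simp
  thus ?thesis
    by (rule Lim_transform_eventually)
       (use eventually_at_cusp_Im[of 0] in eventually_elim, auto simp: q_holomorphic_Dq_expansion[OF G])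
qed

text \<open>Both limits are the coefficient of \<open>q\<close> in the expansion of \<open>F\<close>.\<close>

lemma tendsto_Dq_over_nome:
  assumes "q_holomorphic F" "((\<lambda>z. (F z - L) / nome z) \<longlongrightarrow> d) at_cusp"
  shows "((\<lambda>z. Dq F z / nome z) \<longlongrightarrow> d) at_cusp" and "(F \<longlongrightarrow> L) at_cusp"
proof -
  have "((\<lambda>z. L + nome z * ((F z - L) / nome z)) \<longlongrightarrow> L + 0 * d) at_cusp"
    by (intro tendsto_intros tendsto_nome assms(2))
  thus L: "(F \<longlongrightarrow> L) at_cusp" by simp
  obtain F1 where F1: "q_holomorphic F1" "\<And>z. Im z > 0 \<Longrightarrow> F z = L + nome z * F1 z"
    "\<And>d. (F1 \<longlongrightarrow> d) at_cusp \<Longrightarrow> ((\<lambda>z. Dq F z / nome z) \<longlongrightarrow> d) at_cusp"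
    by (rule q_holomorphic_factor[OF assms(1) L]) blast
  have "(F1 \<longlongrightarrow> d) at_cusp"
    by (rule Lim_transform_eventually[OF assms(2)])
       (use eventually_at_cusp_Im[of 0] in eventually_elim, auto simp: F1(2))
  thus "((\<lambda>z. Dq F z / nome z) \<longlongrightarrow> d) at_cusp" by (rule F1(3))
qed

text \<open>Boundedness near the cusp suffices, by Riemann's theorem on removable singularities.\<close>

lemma q_holomorphicI:
  assumes F: "F holomorphic_on \<H>" and per: "\<And>z. Im z > 0 \<Longrightarrow> F (z + 1) = F z"
    and bd: "eventually (\<lambda>z. norm (F z) \<le> C) at_cusp"
  shows "q_holomorphic F"
proof -
  have pern: "F (z + of_nat n) = F z" if "Im z > 0" for z n
    using that by (induction n) (auto simp: per add.assoc[symmetric] add.commute[of 1])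
  have peri: "F (z + of_int n) = F z" if "Im z > 0" for z n
  proof (cases "n \<ge> 0")
    case True
    thus ?thesis using pern[OF that, of "nat n"] by simp
  next
    case False
    thus ?thesis using pern[of "z + of_int n" "nat (- n)"] that by simp
  qed
  define k :: complex where "k = 2 * of_real pi * \<i>"
  have k: "k \<noteq> 0" by (simp add: k_def)
  have Im: "Im (w / k) > 0" if "Re w < 0" for w
    using that by (simp add: k_def Im_divide power2_eq_square field_simps)
  have Fexp: "F (w / k) = F (w' / k)" if "exp w = exp w'" "Re w < 0" for w w'
  proof -
    from that(1) obtain n where n: "w = w' + (of_int (2 * n) * pi) * \<i>"
      unfolding exp_eq by blast
    have "w / k = w' / k + of_int n" unfolding n using k by (simp add: k_def field_simps)
    moreover have "Im (w' / k) > 0" using that n by (intro Im) simp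
    ultimately show ?thesis by (simp add: peri)
  qed
  define G0 where "G0 = (\<lambda>q. F (Ln q / k))"
  have nome: "nome z = exp (k * z)" for z by (simp add: nome_def k_def)
  have ReLn: "Re (Ln q) < 0" if "q \<in> ball 0 1 - {0}" for q
    using that by (simp add: ln_less_zero_iff)
  have G0_nome: "G0 (nome z) = F z" if "Im z > 0" for z
  proof -
    have "F (Ln (nome z) / k) = F (k * z / k)"
      by (rule Fexp) (use that ReLn[of "nome z"] in \<open>simp_all flip: nome\<close>)
    thus ?thesis using k by (simp add: G0_def)
  qed
  have hol: "G0 holomorphic_on ball 0 1 - {0}"
  proof -
    define A B where "A = ball 0 1 - (\<real>\<^sub>\<le>\<^sub>0 :: complex set)" "B = ball 0 1 - (\<real>\<^sub>\<ge>\<^sub>0 :: complex set)"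
    have A: "G0 holomorphic_on A"
    proof -
      have "F \<circ> (\<lambda>q. Ln q / k) holomorphic_on A"
        by (rule holomorphic_on_compose_gen[OF _ F])
           (use k in \<open>auto simp: A_B_def intro!: holomorphic_intros Im ReLn\<close>)
      thus ?thesis by (simp add: G0_def o_def)
    qed
    \<comment> \<open>Across the cut of \<open>Ln\<close>, the branch \<open>Ln (- q) + \<i> * pi\<close> yields the same values, since \<open>F\<close> is periodic.\<close>
    have B: "G0 holomorphic_on B"
    proof -
      have re: "Re (Ln (- q) + \<i> * of_real pi) < 0" if "q \<in> B" for q
        using ReLn[of "- q"] that unfolding A_B_def by (cases "q = 0") auto
      have "F \<circ> (\<lambda>q. (Ln (- q) + \<i> * of_real pi) / k) holomorphic_on B"
      proof (rule holomorphic_on_compose_gen[OF _ F])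
        show "(\<lambda>q. (Ln (- q) + \<i> * of_real pi) / k) holomorphic_on B"
          using k by (intro holomorphic_intros) (auto simp: A_B_def complex_nonpos_Reals_iff complex_nonneg_Reals_iff)
      qed (use Im re in auto)
      thus ?thesis
      proof (rule holomorphic_transform)
        fix q assume q: "q \<in> B"
        hence "q \<noteq> 0" by (auto simp: A_B_def)
        hence "exp (Ln (- q) + \<i> * of_real pi) = exp (Ln q)" by (simp add: exp_add)
        from Fexp[OF this re[OF q]]
        show "(F \<circ> (\<lambda>q. (Ln (- q) + \<i> * of_real pi) / k)) q = G0 q"
          by (simp add: G0_def)
      qed
    qed
    have "open A" "open B" by (auto simp: A_B_def intro!: open_Diff)
    hence "G0 holomorphic_on A \<union> B" using A B by (intro holomorphic_on_Un) auto
    moreover have "ball 0 1 - {0} \<subseteq> A \<union> B"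
      by (auto simp: A_B_def complex_nonpos_Reals_iff complex_nonneg_Reals_iff complex_eq_iff)
    ultimately show ?thesis by (rule holomorphic_on_subset)
  qed
  obtain b where b: "\<And>z. Im z > b \<Longrightarrow> norm (F z) \<le> C"
    using bd unfolding eventually_at_cusp by blast
  have "eventually (\<lambda>q::complex. norm q < exp (- 2 * pi * \<bar>b\<bar>)) (at 0)"
    by (rule eventually_at_ball'[of "exp (- 2 * pi * \<bar>b\<bar>)" 0 UNIV, simplified, THEN eventually_mono]) auto
  moreover have "eventually (\<lambda>q::complex. q \<noteq> 0) (at 0)" by (simp add: eventually_neq_at_within)
  ultimately have bdd: "eventually (\<lambda>q. norm (G0 q) \<le> C) (at 0)"
  proof eventually_elim
    case (elim q)
    have "Im (Ln q / k) = - ln (norm q) / (2 * pi)"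
      using elim by (simp add: k_def Im_divide power2_eq_square field_simps)
    moreover have "ln (norm q) < - 2 * pi * \<bar>b\<bar>"
      using elim by (metis exp_less_cancel_iff exp_ln zero_less_norm_iff)
    ultimately have "2 * pi * \<bar>b\<bar> < 2 * pi * Im (Ln q / k)" by simp
    hence "Im (Ln q / k) > \<bar>b\<bar>" by (subst (asm) mult_less_cancel_left_pos) auto
    thus ?case unfolding G0_def by (intro b) auto
  qed
  obtain G where G: "G holomorphic_on ball 0 1" "\<And>q. q \<in> ball 0 1 - {0} \<Longrightarrow> G q = G0 q"
  proof -
    have "\<exists>g. g holomorphic_on ball 0 1 \<and> (\<forall>z\<in>ball 0 1 - {0}. g z = G0 z)"
      by (subst holomorphic_on_extend_bounded[OF hol]) (use bdd in auto)
    thus ?thesis using that by blast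
  qed
  show ?thesis unfolding q_holomorphic_def
    by (intro exI[of _ G]) (use G G0_nome in auto)
qed

section \<open>Modular forms\<close>

text \<open>Modular forms on the modular group, described by its two generators: invariance under the
  translation is part of the first conjunct, and the second one is the law for the inversion.\<close>

definition mform :: "int \<Rightarrow> (complex \<Rightarrow> complex) \<Rightarrow> bool" where
  "mform k F \<longleftrightarrow> q_holomorphic F \<and> (\<forall>z\<in>\<H>. F (-1 / z) = z powi k * F z)"

lemma mformI: "q_holomorphic F \<Longrightarrow> (\<And>z. Im z > 0 \<Longrightarrow> F (-1 / z) = z powi k * F z) \<Longrightarrow> mform k F"
  by (simp add: mform_def)

lemma mform_q_holomorphic: "mform k F \<Longrightarrow> q_holomorphic F"
  and mform_minus_inverse: "mform k F \<Longrightarrow> Im z > 0 \<Longrightarrow> F (-1 / z) = z powi k * F z"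
  by (simp_all add: mform_def)

lemma mform_cong: "mform k F \<Longrightarrow> (\<And>z. Im z > 0 \<Longrightarrow> F z = G z) \<Longrightarrow> mform k G"
  using minus_inverse_in_upper_half_plane unfolding mform_def q_holomorphic_def by simp

lemma mform_const: "mform 0 (\<lambda>_. c)"
  by (auto intro!: mformI q_intros)

lemma mform_cmult:
  assumes "mform k F"
  shows "mform k (\<lambda>z. c * F z)"
  by (intro mformI q_intros mform_q_holomorphic[OF assms])
     (simp only: mform_minus_inverse[OF assms] mult_ac)

lemma mform_diff:
  assumes "mform k F" "mform k G"
  shows "mform k (\<lambda>z. F z - G z)"
  by (intro mformI q_intros assms[THEN mform_q_holomorphic])
     (simp only: assms[THEN mform_minus_inverse] right_diff_distrib)

lemma mform_mult: "mform k F \<Longrightarrow> mform l G \<Longrightarrow> mform (k + l) (\<lambda>z. F z * G z)"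
proof (rule mformI)
  fix z :: complex assume *: "mform k F" "mform l G" "Im z > 0"
  have "z \<noteq> 0" using * by auto
  thus "F (- 1 / z) * G (- 1 / z) = z powi (k + l) * (F z * G z)"
    using * by (simp only: mform_minus_inverse power_int_add mult_ac simp_thms)
qed (auto intro!: q_intros simp: mform_q_holomorphic)

lemma mform_power: "mform k F \<Longrightarrow> mform (int n * k) (\<lambda>z. F z ^ n)"
proof (induction n)
  case 0
  show ?case using mform_const[of 1] by simp
next
  case (Suc n)
  show ?case using mform_mult[OF Suc.prems Suc.IH[OF Suc.prems]] by (simp add: algebra_simps)
qed

lemma mform_serre:
  assumes "mform k F"
  shows "mform (k + 2) (serre k F)"
proof (rule mformI)
  show "q_holomorphic (serre k F)" using assms by (intro q_intros mform_q_holomorphic)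
  show "serre k F (-1 / z) = z powi (k + 2) * serre k F z" if "Im z > 0" for z
    using q_holomorphic_imp_holomorphic[OF mform_q_holomorphic[OF assms]] mform_minus_inverse[OF assms] that
    by (intro serre_minus_inverse)
qed

text \<open>Let \<open>L\<close> be the value at the cusp. If \<open>F\<close> takes another value, then the modulus of \<open>F - L\<close> attains
  a positive maximum over the points of imaginary part at least \<open>y\<close>. Below the height of the
  fundamental domain, the inversion moves a maximum on the boundary line into the interior, so that
  the maximum modulus principle applies.\<close>

lemma mform_0_const:
  assumes F: "mform 0 F"
  obtains c where "\<And>z. Im z > 0 \<Longrightarrow> F z = c"
proof -
  note hol = q_holomorphic_imp_holomorphic[OF mform_q_holomorphic[OF F]]
  obtain L where L: "(F \<longlongrightarrow> L) at_cusp"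
    by (rule q_holomorphic_tendsto[OF mform_q_holomorphic[OF F]])
  have "F z0 = L" if z0: "Im z0 > 0" for z0
  proof (rule ccontr)
    assume neq: "F z0 \<noteq> L"
    define e where "e = norm (F z0 - L)"
    have e: "e > 0" using neq by (simp add: e_def)
    have "eventually (\<lambda>z. dist (F z) L < e) at_cusp" using L e by (rule tendstoD)
    then obtain B where B: "\<And>z. Im z > B \<Longrightarrow> norm (F z - L) < e"
      unfolding eventually_at_cusp dist_norm by blast
    define y where "y = min (Im z0) (1 / 2)"
    have y: "y > 0" "y \<le> Im z0" "y \<le> 1 / 2" using z0 by (auto simp: y_def)
    have yB: "Im z0 \<le> B" using B[of z0] by (force simp: e_def)
    define K where "K = cbox (Complex (-1/2) y) (Complex (1/2) B)"
    have K_iff: "z \<in> K \<longleftrightarrow> \<bar>Re z\<bar> \<le> 1 / 2 \<and> y \<le> Im z \<and> Im z \<le> B" for z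
      by (auto simp: K_def in_cbox_complex_iff)
    have per: "F (z + of_int n) = F z" if "Im z > 0" for z n
      by (rule q_holomorphic_periodic[OF mform_q_holomorphic[OF F] that])
    have red: "\<exists>w. \<bar>Re w\<bar> \<le> 1 / 2 \<and> Im w = Im z \<and> F w = F z" if "Im z > 0" for z
      using per[OF that, of "- round (Re z)"] of_int_round_abs_le[of "Re z"]
      by (intro exI[of _ "z + of_int (- round (Re z))"]) (auto simp: abs_minus_commute)
    obtain w0 where w0: "w0 \<in> K" "F w0 = F z0"
      using red[OF z0] y yB unfolding K_iff by metis
    have KH: "K \<subseteq> \<H>" using y by (auto simp: K_iff)
    have "continuous_on K (\<lambda>z. norm (F z - L))"
      using holomorphic_on_imp_continuous_on[OF hol] KH
      by (intro continuous_intros) (rule continuous_on_subset)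
    moreover have "compact K" by (simp add: K_def)
    ultimately obtain z1 where z1: "z1 \<in> K" "\<And>z. z \<in> K \<Longrightarrow> norm (F z - L) \<le> norm (F z1 - L)"
      using continuous_attains_sup[of K "\<lambda>z. norm (F z - L)"] w0(1) by blast
    have e1: "e \<le> norm (F z1 - L)" using z1(2)[OF w0(1)] by (simp add: w0(2) e_def)
    have max: "norm (F z - L) \<le> norm (F z1 - L)" if "Im z \<ge> y" for z
    proof (cases "Im z > B")
      case True
      thus ?thesis using B[of z] e1 by simp
    next
      case False
      obtain w where "\<bar>Re w\<bar> \<le> 1 / 2" "Im w = Im z" "F w = F z" using red[of z] \<open>Im z \<ge> y\<close> y by auto
      thus ?thesis using z1(2)[of w] False that by (simp add: K_iff)
    qed
    obtain w where w: "Im w > y" "F w = F z1"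
    proof (cases "norm z1 < 1")
      case True
      have I: "Im z1 > 0" "Im z1 \<ge> y" using z1(1) y by (auto simp: K_iff)
      hence "z1 \<noteq> 0" by auto
      hence "norm z1 ^ 2 < 1" "norm z1 ^ 2 > 0" using True by (auto simp: power_less_one_iff)
      hence "Im z1 < Im z1 / norm z1 ^ 2" using I by (simp add: field_simps)
      hence "Im (-1 / z1) > y" using I by (simp only: Im_minus_inverse)
      moreover have "F (-1 / z1) = F z1" using mform_minus_inverse[OF F I(1)] by simp
      ultimately show ?thesis using that by blast
    next
      case False
      hence "1 \<le> norm z1 ^ 2" by simp
      also have "\<dots> = \<bar>Re z1\<bar> ^ 2 + Im z1 ^ 2" by (simp add: cmod_power2)
      also have "\<bar>Re z1\<bar> ^ 2 \<le> (1 / 2) ^ 2" using z1(1) by (intro power_mono) (auto simp: K_iff)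
      finally have "Im z1 ^ 2 > (1 / 2) ^ 2" by (simp add: power2_eq_square)
      hence "Im z1 > 1 / 2" using z1(1) y by (intro power2_less_imp_less[of "1 / 2" "Im z1"]) (auto simp: K_iff)
      thus ?thesis using that[of z1] y by simp
    qed
    have "(\<lambda>z. F z - L) constant_on \<H>"
    proof (rule maximum_modulus_principle)
      show "open {z. Im z > y}" by (rule open_halfspace_Im_gt)
      show "w \<in> {z. Im z > y}" using w by simp
      show "norm (F z - L) \<le> norm (F w - L)" if "z \<in> {z. Im z > y}" for z
        using max[of z] that w(2) by simp
    qed (use y hol in \<open>auto intro!: holomorphic_intros connected_upper_half_plane\<close>)
    then obtain c where c: "\<And>z. Im z > 0 \<Longrightarrow> F z - L = c" unfolding constant_on_def by auto
    define z2 where "z2 = Complex 0 (max B 0 + 1)"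
    have z2: "Im z2 > B" "Im z2 > 0" by (auto simp: z2_def)
    have "e = norm (F z2 - L)" unfolding e_def using c[OF z0] c[OF z2(2)] by simp
    thus False using B[OF z2(1)] by simp
  qed
  thus ?thesis using that by blast
qed

section \<open>The discriminant\<close>

definition lambert_primitive :: "complex \<Rightarrow> complex" where
  "lambert_primitive = (SOME P. P 0 = 0 \<and> (\<forall>q\<in>ball 0 1. (P has_field_derivative lambert_quotient 1 q) (at q)))"

lemma lambert_primitive:
  "lambert_primitive 0 = 0"
  "norm q < 1 \<Longrightarrow> (lambert_primitive has_field_derivative lambert_quotient 1 q) (at q)"
proof -
  obtain g where g: "\<And>q. q \<in> ball 0 1 \<Longrightarrow> (g has_field_derivative lambert_quotient 1 q) (at q within ball 0 1)"
    using holomorphic_convex_primitive'[OF _ _ holomorphic_lambert_quotient[of 1]] by (metis convex_ball open_ball)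
  have "\<exists>P. P 0 = 0 \<and> (\<forall>q\<in>ball 0 1. (P has_field_derivative lambert_quotient 1 q) (at q))"
  proof (intro exI[of _ "\<lambda>q. g q - g 0"] conjI ballI)
    fix q :: complex assume q: "q \<in> ball 0 1"
    have "(g has_field_derivative lambert_quotient 1 q) (at q)"
      using g[OF q] at_within_open[OF q] by simp
    thus "((\<lambda>q. g q - g 0) has_field_derivative lambert_quotient 1 q) (at q)"
      by (auto intro!: derivative_eq_intros)
  qed auto
  from someI_ex[OF this]
  show "lambert_primitive 0 = 0"
    "norm q < 1 \<Longrightarrow> (lambert_primitive has_field_derivative lambert_quotient 1 q) (at q)"
    unfolding lambert_primitive_def by auto
qed

text \<open>The modular discriminant, defined through its logarithmic derivative \<open>E2\<close>. In this form it
  visibly has no zeros, and its transformation law is an integral of that of \<open>E2\<close>.\<close>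

definition discriminant :: "complex \<Rightarrow> complex" where
  "discriminant z = nome z * exp (- 24 * lambert_primitive (nome z))"

lemma holomorphic_lambert_primitive: "lambert_primitive holomorphic_on ball 0 1"
proof (subst holomorphic_on_open)
  show "\<forall>q\<in>ball 0 1. \<exists>f'. (lambert_primitive has_field_derivative f') (at q)"
  proof
    fix q :: complex assume "q \<in> ball 0 1"
    thus "\<exists>f'. (lambert_primitive has_field_derivative f') (at q)"
      using lambert_primitive(2)[of q] by auto
  qed
qed simp

lemma discriminant_nonzero [simp]: "discriminant z \<noteq> 0"
  by (simp add: discriminant_def)

lemma q_holomorphic_discriminant [q_intros]: "q_holomorphic discriminant"
  unfolding discriminant_def
  by (intro q_holomorphic_mult q_holomorphic_nome q_holomorphic_compose[of "\<lambda>q. exp (- 24 * lambert_primitive q)"]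
        holomorphic_intros holomorphic_lambert_primitive)

lemma discriminant_over_nome: "((\<lambda>z. discriminant z / nome z) \<longlongrightarrow> 1) at_cusp"
proof -
  have "((\<lambda>z. exp (- 24 * lambert_primitive (nome z))) \<longlongrightarrow> exp (- 24 * lambert_primitive 0)) at_cusp"
    by (rule tendsto_compose_nome[of "\<lambda>q. exp (- 24 * lambert_primitive q)"])
       (intro holomorphic_intros holomorphic_lambert_primitive)
  thus ?thesis by (simp add: discriminant_def lambert_primitive(1))
qed

lemma discriminant_tendsto_0: "(discriminant \<longlongrightarrow> 0) at_cusp"
  using tendsto_mult[OF tendsto_nome discriminant_over_nome] by simp

lemma Dq_discriminant:
  assumes "Im z > 0"
  shows "Dq discriminant z = E2 z * discriminant z"
proof (rule Dq_eqI)
  have "((\<lambda>z. lambert_primitive (nome z)) has_field_derivative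
           (lambert_quotient 1 (nome z) * (2 * of_real pi * \<i> * nome z))) (at z)"
    by (rule DERIV_chain2[where f = lambert_primitive and g = nome, OF lambert_primitive(2) has_field_derivative_nome])
       (use assms in auto)
  moreover have "E2 z = 1 - 24 * (nome z * lambert_quotient 1 (nome z))"
    using assms by (simp add: E2_lambert lambert_eq)
  ultimately show "(discriminant has_field_derivative 2 * of_real pi * \<i> * (E2 z * discriminant z)) (at z)"
    unfolding discriminant_def[abs_def]
    by (auto intro!: derivative_eq_intros has_field_derivative_nome) (simp add: algebra_simps)
qed

text \<open>The quotient of the two sides of the transformation law has derivative 0, and it equals 1 at the
  fixed point \<open>\<i>\<close> of the inversion.\<close>

lemma mform_discriminant: "mform 12 discriminant"
proof (rule mformI)
  show "q_holomorphic discriminant" by (intro q_intros)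
  have hol: "discriminant holomorphic_on \<H>" by (intro q_holomorphic_imp_holomorphic q_intros)
  define g where "g = (\<lambda>z. discriminant (-1 / z) / (z powi 12 * discriminant z))"
  have g': "(g has_field_derivative 0) (at z)" if z: "Im z > 0" for z
  proof -
    define k :: complex where "k = 2 * of_real pi * \<i>"
    have k: "k \<noteq> 0" "k * alpha = 12" by (simp_all add: k_def alpha_def)
    have "z \<noteq> 0" using z by auto
    have *: "-1 / z \<in> \<H>" using z minus_inverse_in_upper_half_plane by simp
    have i: "((\<lambda>z. -1 / z) has_field_derivative 1 / z ^ 2) (at z)"
      using \<open>z \<noteq> 0\<close> by (auto intro!: derivative_eq_intros simp: power2_eq_square)
    have 1: "((\<lambda>z. discriminant (-1 / z)) has_field_derivative
             (k * ((z ^ 2 * E2 z + alpha * z) * discriminant (-1 / z)) * (1 / z ^ 2))) (at z)"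
      using DERIV_chain2[where f = discriminant and g = "\<lambda>z. -1 / z",
              OF has_field_derivative_Dq[OF hol open_upper_half_plane *] i] *
      by (simp only: Dq_discriminant E2_minus_inverse[OF z] upper_half_plane_iff k_def)
    have 2: "(discriminant has_field_derivative (k * (E2 z * discriminant z))) (at z)"
      using has_field_derivative_Dq[OF hol open_upper_half_plane, of z] z
      by (simp add: Dq_discriminant k_def)
    have nz: "z powi 12 * discriminant z \<noteq> 0" using \<open>z \<noteq> 0\<close> by simp
    have "(g has_field_derivative
       ((k * ((z ^ 2 * E2 z + alpha * z) * discriminant (-1 / z)) * (1 / z ^ 2)) * (z powi 12 * discriminant z)
        - discriminant (-1 / z) * (12 * z ^ 11 * discriminant z + z powi 12 * (k * (E2 z * discriminant z))))
        / ((z powi 12 * discriminant z) * (z powi 12 * discriminant z))) (at z)"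
      unfolding g_def
    proof (rule DERIV_divide[where f = "\<lambda>z. discriminant (-1 / z)" and g = "\<lambda>z. z powi 12 * discriminant z", OF 1 _ nz])
      show "((\<lambda>z. z powi 12 * discriminant z) has_field_derivative
              12 * z ^ 11 * discriminant z + z powi 12 * (k * (E2 z * discriminant z))) (at z)"
        by (auto intro!: derivative_eq_intros 2 simp: mult_ac)
    qed
    moreover have "(k * ((z ^ 2 * E2 z + alpha * z) * discriminant (-1 / z)) * (1 / z ^ 2)) * (z powi 12 * discriminant z)
        = discriminant (-1 / z) * (12 * z ^ 11 * discriminant z + z powi 12 * (k * (E2 z * discriminant z)))"
    proof -
      have "z powi 12 = z ^ 12" by simp
      hence "(k * ((z ^ 2 * E2 z + alpha * z) * discriminant (-1 / z)) * (1 / z ^ 2)) * (z powi 12 * discriminant z)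
         = (k * ((z ^ 2 * E2 z + alpha * z) * discriminant (-1 / z))) * (z ^ 10 * discriminant z)"
        using \<open>z \<noteq> 0\<close> by (simp add: power_eq_if)
      also have "\<dots> = discriminant (-1 / z) * ((k * alpha) * z ^ 11 * discriminant z + z ^ 12 * (k * (E2 z * discriminant z)))"
        by algebra
      finally show ?thesis unfolding k(2) by simp
    qed
    ultimately show ?thesis by simp
  qed
  have "continuous_on \<H> g"
    using g' by (intro continuous_at_imp_continuous_on ballI) (auto intro: DERIV_isCont)
  then obtain c where c: "\<And>z. z \<in> \<H> \<Longrightarrow> g z = c"
    using DERIV_zero_connected_constant[OF connected_upper_half_plane open_upper_half_plane, of "{}" g] g'
    by (metis Diff_empty finite.emptyI upper_half_plane_iff)
  have "\<i> ^ 12 = ((\<i> ^ 2) ^ 6 :: complex)" by (simp only: flip: power_mult) simp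
  hence "g \<i> = 1" by (simp add: g_def)
  hence c1: "c = 1" using c[of \<i>] by simp
  show "discriminant (-1 / z) = z powi 12 * discriminant z" if "Im z > 0" for z
  proof -
    have "z \<noteq> 0" using that by auto
    thus ?thesis using c[of z] that unfolding c1 g_def by (simp add: divide_simps)
  qed
qed

section \<open>Forms of small weight\<close>

text \<open>Since the discriminant has no zeros, division by it is controlled by the behaviour at the cusp
  alone.\<close>

lemma mform_divide_discriminant_power:
  assumes F: "F holomorphic_on \<H>" and per: "\<And>z. Im z > 0 \<Longrightarrow> F (z + 1) = F z"
    and law: "\<And>z. Im z > 0 \<Longrightarrow> F (-1 / z) = z powi k * F z"
    and lim: "((\<lambda>z. F z / nome z ^ n) \<longlongrightarrow> L) at_cusp"
  shows "mform (k - 12 * int n) (\<lambda>z. F z / discriminant z ^ n)"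
    and "((\<lambda>z. F z / discriminant z ^ n) \<longlongrightarrow> L) at_cusp"
proof -
  have "((\<lambda>z. (F z / nome z ^ n) / (discriminant z / nome z) ^ n) \<longlongrightarrow> L / 1 ^ n) at_cusp"
    by (intro tendsto_intros lim discriminant_over_nome) auto
  thus lim': "((\<lambda>z. F z / discriminant z ^ n) \<longlongrightarrow> L) at_cusp" by (simp add: power_divide)
  have hd: "discriminant holomorphic_on \<H>" by (intro q_holomorphic_imp_holomorphic q_intros)
  show "mform (k - 12 * int n) (\<lambda>z. F z / discriminant z ^ n)"
  proof (rule mformI)
    show "q_holomorphic (\<lambda>z. F z / discriminant z ^ n)"
    proof (rule q_holomorphicI)
      show "(\<lambda>z. F z / discriminant z ^ n) holomorphic_on \<H>"
        by (intro holomorphic_intros F hd) auto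
      show "F (z + 1) / discriminant (z + 1) ^ n = F z / discriminant z ^ n" if "Im z > 0" for z
        using q_holomorphic_periodic[OF q_holomorphic_discriminant that, of 1] per[OF that] by simp
      have "eventually (\<lambda>z. dist (F z / discriminant z ^ n) L < 1) at_cusp"
        using lim' by (rule tendstoD) simp
      thus "eventually (\<lambda>z. norm (F z / discriminant z ^ n) \<le> norm L + 1) at_cusp"
      proof eventually_elim
        case (elim z)
        thus ?case using norm_triangle_ineq2[of "F z / discriminant z ^ n" L] by (simp add: dist_norm)
      qed
    qed
    fix z :: complex assume z: "Im z > 0"
    have z0: "z \<noteq> 0" using z by auto
    have "F (-1 / z) / discriminant (-1 / z) ^ n = z powi k * F z / (z powi 12 * discriminant z) ^ n"
      by (simp only: law[OF z] mform_minus_inverse[OF mform_discriminant z])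
    also have "\<dots> = z powi (k - 12 * int n) * (F z / discriminant z ^ n)"
      using z0 by (simp add: power_int_diff power_mult_distrib power_int_mult)
    finally show "F (-1 / z) / discriminant (-1 / z) ^ n = z powi (k - 12 * int n) * (F z / discriminant z ^ n)" .
  qed
qed

lemma mform_divide_discriminant:
  assumes F: "mform k F" and lim: "(F \<longlongrightarrow> 0) at_cusp"
  shows "mform (k - 12) (\<lambda>z. F z / discriminant z)"
proof -
  note q = mform_q_holomorphic[OF F]
  obtain F1 where F1: "q_holomorphic F1" "\<And>z. Im z > 0 \<Longrightarrow> F z = 0 + nome z * F1 z"
    using q_holomorphic_factor[OF q lim] by metis
  obtain L where "(F1 \<longlongrightarrow> L) at_cusp" using q_holomorphic_tendsto[OF F1(1)] by blast
  hence "((\<lambda>z. F z / nome z ^ 1) \<longlongrightarrow> L) at_cusp"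
    by (rule Lim_transform_eventually)
       (use eventually_at_cusp_Im[of 0] in eventually_elim, auto simp: F1(2))
  from mform_divide_discriminant_power(1)[OF q_holomorphic_imp_holomorphic[OF q] _ mform_minus_inverse[OF F] this]
    q_holomorphic_periodic[OF q, of _ 1] show ?thesis by simp
qed

text \<open>A suitable product of powers of the form and of the discriminant has weight 0 and vanishes at the
  cusp.\<close>

lemma mform_neg:
  assumes F: "mform k F" and k: "k < 0" and z: "Im z > 0"
  shows "F z = 0"
proof -
  define n where "n = nat (- k)"
  have n: "n > 0" "int 12 * k + int n * 12 = 0" using k by (auto simp: n_def)
  have "mform (int 12 * k + int n * 12) (\<lambda>z. F z ^ 12 * discriminant z ^ n)"
    by (intro mform_mult mform_power F mform_discriminant)
  hence "mform 0 (\<lambda>z. F z ^ 12 * discriminant z ^ n)" unfolding n(2) .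
  then obtain c where c: "\<And>z. Im z > 0 \<Longrightarrow> F z ^ 12 * discriminant z ^ n = c"
    by (rule mform_0_const) blast
  obtain L where L: "(F \<longlongrightarrow> L) at_cusp" using q_holomorphic_tendsto[OF mform_q_holomorphic[OF F]] by blast
  have "((\<lambda>z. F z ^ 12 * discriminant z ^ n) \<longlongrightarrow> L ^ 12 * 0 ^ n) at_cusp"
    by (intro tendsto_intros L discriminant_tendsto_0)
  moreover have "((\<lambda>z. F z ^ 12 * discriminant z ^ n) \<longlongrightarrow> c) at_cusp"
    by (rule tendsto_eventually) (use eventually_at_cusp_Im[of 0] in eventually_elim, rule c)
  ultimately have "c = 0" using tendsto_unique[OF at_cusp_neq_bot] n(1) by fastforce
  with c[OF z] show ?thesis by simp
qed

text \<open>A form of weight below 12 that vanishes at the cusp is zero, since its quotient by the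
  discriminant has negative weight.\<close>

lemma mform_unique:
  assumes F: "mform k F" and G: "mform k G" and k: "k < 12"
    and "(F \<longlongrightarrow> a) at_cusp" "(G \<longlongrightarrow> 1) at_cusp" and z: "Im z > 0"
  shows "F z = a * G z"
proof -
  have "mform k (\<lambda>z. F z - a * G z)" by (intro mform_diff mform_cmult F G)
  moreover have "((\<lambda>z. F z - a * G z) \<longlongrightarrow> a - a * 1) at_cusp" by (intro tendsto_intros assms)
  ultimately have "mform (k - 12) (\<lambda>z. (F z - a * G z) / discriminant z)"
    by (intro mform_divide_discriminant) auto
  from mform_neg[OF this _ z] k show ?thesis by simp
qed

section \<open>Ramanujan's equations\<close>

lemma lambert_over_nome: "((\<lambda>z. lambert j (nome z) / nome z) \<longlongrightarrow> 1) at_cusp"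
proof -
  have "((\<lambda>z. lambert_quotient j (nome z)) \<longlongrightarrow> 1) at_cusp"
    using tendsto_compose_nome[OF holomorphic_lambert_quotient] by (simp add: lambert_quotient_0)
  thus ?thesis
    by (rule Lim_transform_eventually)
       (use eventually_at_cusp_Im[of 0] in eventually_elim, auto simp: lambert_eq)
qed

lemma lambert_tendsto_0: "((\<lambda>z. lambert j (nome z)) \<longlongrightarrow> 0) at_cusp"
  using tendsto_mult[OF tendsto_nome lambert_over_nome[of j]] by simp

lemma E2_over_nome: "((\<lambda>z. (E2 z - 1) / nome z) \<longlongrightarrow> - 24) at_cusp"
  and E4_over_nome: "((\<lambda>z. (E4 z - 1) / nome z) \<longlongrightarrow> 240) at_cusp"
  and E6_over_nome: "((\<lambda>z. (E6 z - 1) / nome z) \<longlongrightarrow> - 504) at_cusp"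
  using tendsto_mult_left[OF lambert_over_nome[of 1], of "- 24"]
    tendsto_mult_left[OF lambert_over_nome[of 3], of 240]
    tendsto_mult_left[OF lambert_over_nome[of 5], of "- 504"]
  by (simp_all add: E2_lambert E4_lambert E6_lambert)

lemma E2_tendsto_1: "(E2 \<longlongrightarrow> 1) at_cusp"
  and E4_tendsto_1: "(E4 \<longlongrightarrow> 1) at_cusp"
  and E6_tendsto_1: "(E6 \<longlongrightarrow> 1) at_cusp"
  by (rule tendsto_Dq_over_nome(2)[OF q_holomorphic_E2 E2_over_nome]
        tendsto_Dq_over_nome(2)[OF q_holomorphic_E4 E4_over_nome]
        tendsto_Dq_over_nome(2)[OF q_holomorphic_E6 E6_over_nome])+

lemma Dq_E2_over_nome: "((\<lambda>z. Dq E2 z / nome z) \<longlongrightarrow> - 24) at_cusp"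
  and Dq_E4_over_nome: "((\<lambda>z. Dq E4 z / nome z) \<longlongrightarrow> 240) at_cusp"
  by (rule tendsto_Dq_over_nome(1)[OF q_holomorphic_E2 E2_over_nome]
        tendsto_Dq_over_nome(1)[OF q_holomorphic_E4 E4_over_nome])+

text \<open>The terms with \<open>alpha\<close> in the transformation laws of \<open>E2 ^ 2\<close> and of the derivative of \<open>E2\<close>
  cancel.\<close>

lemma mform_E2_square_minus_derivative: "mform 4 (\<lambda>z. E2 z ^ 2 - 12 * Dq E2 z)"
proof (rule mformI)
  show "q_holomorphic (\<lambda>z. E2 z ^ 2 - 12 * Dq E2 z)" by (intro q_intros)
  fix z :: complex assume z: "Im z > 0"
  have z0: "z \<noteq> 0" using z by auto
  define k :: complex where "k = 1 / (2 * of_real pi * \<i>)"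
  have a: "alpha = 12 * k" by (simp add: alpha_def k_def)
  have kid: "Dq (\<lambda>z. z) z = k" by (rule Dq_eqI) (auto intro!: derivative_eq_intros simp: k_def)
  have "Dq E2 (-1 / z) / z ^ 2 = Dq (\<lambda>z. E2 (-1 / z)) z"
    by (rule Dq_minus_inverse [OF _ z, symmetric]) (intro holomorphic_intros)
  also have "\<dots> = Dq (\<lambda>z. z ^ 2 * E2 z + alpha * z) z"
    by (rule Dq_cong[of \<H>]) (use E2_minus_inverse z in auto)
  also have "\<dots> = Dq (\<lambda>z. z ^ 2 * E2 z) z + Dq (\<lambda>z. alpha * z) z"
    by (rule Dq_add[of \<H>]) (use z in \<open>auto intro!: holomorphic_intros\<close>)
  also have "Dq (\<lambda>z. z ^ 2 * E2 z) z = Dq (\<lambda>z. z ^ 2) z * E2 z + z ^ 2 * Dq E2 z"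
    by (rule Dq_mult[of \<H>]) (use z in \<open>auto intro!: holomorphic_intros\<close>)
  also have "Dq (\<lambda>z. z ^ 2) z = 2 * z * k"
    by (subst Dq_power[of \<H>]) (use z kid in auto)
  also have "Dq (\<lambda>z. alpha * z) z = alpha * k"
    by (subst Dq_cmult[of \<H>]) (use z kid in auto)
  finally have D: "Dq E2 (-1 / z) = z ^ 2 * (2 * z * k * E2 z + z ^ 2 * Dq E2 z + 12 * k * k)"
    using z0 by (simp add: a field_simps)
  show "E2 (-1 / z) ^ 2 - 12 * Dq E2 (-1 / z) = z powi 4 * (E2 z ^ 2 - 12 * Dq E2 z)"
    unfolding D E2_minus_inverse[OF z] a by (simp add: power2_eq_square power4_eq_xxxx algebra_simps)
qed

text \<open>The lattice sum provides a form whose \<open>q\<close>-expansion is a multiple of a Lambert series up to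
  its constant term. In weight below 12 it is a multiple of \<open>A\<close>, so that the first coefficient of
  \<open>A\<close> determines all others.\<close>

lemma mform_eq_lambert:
  assumes A: "mform (int (Suc j)) A" and j: "odd j" "3 \<le> j" "Suc j < 12"
    and lim: "((\<lambda>z. (A z - 1) / nome z) \<longlongrightarrow> d) at_cusp" and z: "Im z > 0"
  shows "A z = 1 + d * lambert j (nome z)"
proof -
  define K :: complex where "K = 2 * ((2 * of_real pi * \<i>) ^ Suc j / fact j)"
  obtain c where c: "\<And>z. Im z > 0 \<Longrightarrow> c + K * lambert j (nome (-1 / z)) = z ^ Suc j * (c + K * lambert j (nome z))"
    using lambert_minus_inverse[OF j(1,2)] unfolding K_def by auto
  have X: "mform (int (Suc j)) (\<lambda>z. c + K * lambert j (nome z))"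
  proof (rule mformI)
    show "q_holomorphic (\<lambda>z. c + K * lambert j (nome z))" by (intro q_intros)
    show "c + K * lambert j (nome (-1 / z)) = z powi int (Suc j) * (c + K * lambert j (nome z))" if "Im z > 0" for z
      unfolding power_int_of_nat by (rule c[OF that])
  qed
  have A_lim: "(A \<longlongrightarrow> 1) at_cusp"
    using tendsto_Dq_over_nome(2)[OF mform_q_holomorphic[OF A] lim] .
  have "((\<lambda>z. c + K * lambert j (nome z)) \<longlongrightarrow> c + K * 0) at_cusp"
    by (intro tendsto_intros lambert_tendsto_0)
  hence XA: "c + K * lambert j (nome z) = c * A z" if "Im z > 0" for z
    using mform_unique[OF X A _ _ A_lim that] j(3) by simp
  have "((\<lambda>z. K * (lambert j (nome z) / nome z)) \<longlongrightarrow> K * 1) at_cusp"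
    by (intro tendsto_intros lambert_over_nome)
  moreover have "((\<lambda>z. K * (lambert j (nome z) / nome z)) \<longlongrightarrow> c * d) at_cusp"
  proof (rule Lim_transform_eventually)
    show "((\<lambda>z. c * ((A z - 1) / nome z)) \<longlongrightarrow> c * d) at_cusp" by (intro tendsto_intros lim)
    show "eventually (\<lambda>z. c * ((A z - 1) / nome z) = K * (lambert j (nome z) / nome z)) at_cusp"
      using eventually_at_cusp_Im[of 0]
    proof eventually_elim
      case (elim z)
      have "K * lambert j (nome z) = c * (A z - 1)" using XA[OF elim] by (simp add: algebra_simps)
      thus ?case by simp
    qed
  qed
  ultimately have K: "K = c * d" using tendsto_unique[OF at_cusp_neq_bot] by force
  moreover have "K \<noteq> 0" by (simp add: K_def)
  ultimately have "c \<noteq> 0" by auto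
  have "c * A z = c * (1 + d * lambert j (nome z))" using XA[OF z] by (simp add: K algebra_simps)
  thus ?thesis using \<open>c \<noteq> 0\<close> by simp
qed

lemma E2_square_minus_derivative: "Im z > 0 \<Longrightarrow> E2 z ^ 2 - 12 * Dq E2 z = E4 z"
  and mform_E4: "mform 4 E4"
proof -
  define A where "A = (\<lambda>z. E2 z ^ 2 - 12 * Dq E2 z)"
  have A: "mform 4 A" unfolding A_def by (rule mform_E2_square_minus_derivative)
  have "((\<lambda>z. (E2 z + 1) * ((E2 z - 1) / nome z) - 12 * (Dq E2 z / nome z)) \<longlongrightarrow> (1 + 1) * (- 24) - 12 * (- 24)) at_cusp"
    by (intro tendsto_intros E2_tendsto_1 E2_over_nome Dq_E2_over_nome)
  moreover have "(E2 z + 1) * ((E2 z - 1) / nome z) - 12 * (Dq E2 z / nome z) = (A z - 1) / nome z" for z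
    by (simp add: A_def field_simps power2_eq_square)
  ultimately have "((\<lambda>z. (A z - 1) / nome z) \<longlongrightarrow> 240) at_cusp" by simp
  from mform_eq_lambert[OF _ _ _ _ this, of 3] A
  have *: "A z = E4 z" if "Im z > 0" for z using that by (simp add: E4_lambert)
  show "Im z > 0 \<Longrightarrow> E2 z ^ 2 - 12 * Dq E2 z = E4 z" using * by (simp add: A_def)
  show "mform 4 E4" by (rule mform_cong[OF A]) (use * in auto)
qed

lemma serre_E4: "Im z > 0 \<Longrightarrow> serre 4 E4 z = - E6 z / 3"
  and mform_E6: "mform 6 E6"
proof -
  define A where "A = (\<lambda>z. - 3 * serre 4 E4 z)"
  have A: "mform 6 A" unfolding A_def using mform_cmult[OF mform_serre[OF mform_E4], of "- 3"] by simp
  have "((\<lambda>z. E4 z * ((E2 z - 1) / nome z) + (E4 z - 1) / nome z - 3 * (Dq E4 z / nome z)) \<longlongrightarrow> 1 * (- 24) + 240 - 3 * 240) at_cusp"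
    by (intro tendsto_intros E4_tendsto_1 E2_over_nome E4_over_nome Dq_E4_over_nome)
  moreover have "E4 z * ((E2 z - 1) / nome z) + (E4 z - 1) / nome z - 3 * (Dq E4 z / nome z) = (A z - 1) / nome z" for z
    by (simp add: A_def serre_def field_simps)
  ultimately have "((\<lambda>z. (A z - 1) / nome z) \<longlongrightarrow> - 504) at_cusp" by simp
  from mform_eq_lambert[OF _ _ _ _ this, of 5] A
  have *: "A z = E6 z" if "Im z > 0" for z using that by (simp add: E6_lambert)
  show "serre 4 E4 z = - E6 z / 3" if "Im z > 0"
  proof -
    have "- 3 * serre 4 E4 z = E6 z" using *[OF that] by (simp add: A_def)
    hence "(- 3 * serre 4 E4 z) / (- 3) = E6 z / (- 3)" by (simp only:)
    thus ?thesis by simp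
  qed
  show "mform 6 E6" by (rule mform_cong[OF A]) (use * in auto)
qed

lemma serre_E6: "Im z > 0 \<Longrightarrow> serre 6 E6 z = - (E4 z ^ 2) / 2"
proof -
  assume z: "Im z > 0"
  have 1: "mform 8 (\<lambda>z. - 2 * serre 6 E6 z)" using mform_cmult[OF mform_serre[OF mform_E6], of "- 2"] by simp
  have 2: "mform 8 (\<lambda>z. E4 z ^ 2)" using mform_power[OF mform_E4, of 2] by simp
  have "((\<lambda>z. - 2 * serre 6 E6 z) \<longlongrightarrow> - 2 * (0 - of_int 6 / 12 * 1 * 1)) at_cusp"
    unfolding serre_def by (intro tendsto_intros tendsto_Dq_cusp q_intros E2_tendsto_1 E6_tendsto_1)
  moreover have "((\<lambda>z. E4 z ^ 2) \<longlongrightarrow> 1 ^ 2) at_cusp" by (intro tendsto_intros E4_tendsto_1)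
  ultimately have "- 2 * serre 6 E6 z = 1 * E4 z ^ 2"
    by (intro mform_unique[OF 1 2 _ _ _ z]) auto
  hence "(- 2 * serre 6 E6 z) / (- 2) = (1 * E4 z ^ 2) / (- 2)" by (simp only:)
  thus ?thesis by simp
qed

text \<open>Ramanujan's differential equations: each of them identifies a form of weight 4, 6 or 8, which is
  determined by its value at the cusp.\<close>

lemma Ramanujan:
  assumes "Im z > 0"
  shows "Dq E2 z = (E2 z ^ 2 - E4 z) / 12"
    and "Dq E4 z = (E2 z * E4 z - E6 z) / 3"
    and "Dq E6 z = (E2 z * E6 z - E4 z ^ 2) / 2"
  using E2_square_minus_derivative[OF assms] serre_E4[OF assms] serre_E6[OF assms]
  by (simp_all add: serre_def field_simps)

text \<open>A cusp form of weight 12 is a multiple of the discriminant; the factor is its coefficient of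
  \<open>q\<close>.\<close>

lemma E4_cube_minus_E6_square:
  assumes "Im z > 0"
  shows "E4 z ^ 3 - E6 z ^ 2 = 1728 * discriminant z"
proof -
  define F where "F = (\<lambda>z. E4 z ^ 3 - E6 z ^ 2)"
  have F: "mform 12 F"
    unfolding F_def using mform_power[OF mform_E4, of 3] mform_power[OF mform_E6, of 2] by (intro mform_diff) simp_all
  have "(F \<longlongrightarrow> 1 ^ 3 - 1 ^ 2) at_cusp" unfolding F_def
    by (intro tendsto_intros E4_tendsto_1 E6_tendsto_1)
  hence "mform (12 - 12) (\<lambda>z. F z / discriminant z)" by (intro mform_divide_discriminant F) auto
  hence "mform 0 (\<lambda>z. F z / discriminant z)" by simp
  then obtain c where c: "\<And>z. Im z > 0 \<Longrightarrow> F z / discriminant z = c" by (rule mform_0_const) blast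
  have "((\<lambda>z. c * (discriminant z / nome z)) \<longlongrightarrow> c * 1) at_cusp"
    by (intro tendsto_intros discriminant_over_nome)
  moreover have "((\<lambda>z. c * (discriminant z / nome z)) \<longlongrightarrow> 1728) at_cusp"
  proof (rule Lim_transform_eventually)
    have "((\<lambda>z. (E4 z ^ 2 + E4 z + 1) * ((E4 z - 1) / nome z) - (E6 z + 1) * ((E6 z - 1) / nome z)) \<longlongrightarrow>
             (1 ^ 2 + 1 + 1) * 240 - (1 + 1) * (- 504)) at_cusp"
      by (intro tendsto_intros E4_tendsto_1 E4_over_nome E6_tendsto_1 E6_over_nome)
    thus "((\<lambda>z. (E4 z ^ 2 + E4 z + 1) * ((E4 z - 1) / nome z) - (E6 z + 1) * ((E6 z - 1) / nome z)) \<longlongrightarrow> 1728) at_cusp"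
      by simp
    show "eventually (\<lambda>z. (E4 z ^ 2 + E4 z + 1) * ((E4 z - 1) / nome z) - (E6 z + 1) * ((E6 z - 1) / nome z) =
                 c * (discriminant z / nome z)) at_cusp"
      using eventually_at_cusp_Im[of 0]
    proof eventually_elim
      case (elim z)
      have "F z = c * discriminant z" using c[OF elim] by (simp add: field_simps)
      moreover have "(E4 z ^ 2 + E4 z + 1) * (E4 z - 1) - (E6 z + 1) * (E6 z - 1) = F z"
        unfolding F_def by algebra
      ultimately show ?case by (simp flip: diff_divide_distrib)
    qed
  qed
  ultimately have "c = 1728" using tendsto_unique[OF at_cusp_neq_bot] by force
  thus ?thesis using c[OF assms] by (simp add: F_def field_simps)
qed

text \<open>The factor \<open>z ^ 6\<close> of the transformation law is \<open>-1\<close> at the fixed point of the inversion.\<close>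

lemma E6_i: "E6 \<i> = 0" and E4_i: "E4 \<i> \<noteq> 0"
proof -
  have "\<i> powi 6 = (\<i> ^ 2) ^ 3" by (simp flip: power_mult)
  hence "E6 (-1 / \<i>) = - E6 \<i>" using mform_minus_inverse[OF mform_E6, of \<i>] by simp
  thus "E6 \<i> = 0" by simp
  thus "E4 \<i> \<noteq> 0" using E4_cube_minus_E6_square[of \<i>] by auto
qed

section \<open>The full modular group\<close>

lemma modular_form_imp_mform:
  assumes "modular_form k f"
  shows "mform k f"
proof (rule mformI)
  from assms have hol: "f holomorphic_on \<H>"
    and law: "\<And>a b c d z. a * d - b * c = (1::int) \<Longrightarrow> z \<in> \<H> \<Longrightarrow>
        f ((of_int a * z + of_int b) / (of_int c * z + of_int d)) = (of_int c * z + of_int d) powi k * f z"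
    and bd: "\<exists>B C. \<forall>z. Im z > B \<longrightarrow> norm (f z) \<le> C"
    unfolding modular_form_def by blast+
  show "f (-1 / z) = z powi k * f z" if "Im z > 0" for z
    using law[of 0 0 "-1" 1 z] that by simp
  obtain B C where "\<And>z. Im z > B \<Longrightarrow> norm (f z) \<le> C" using bd by blast
  thus "q_holomorphic f"
    using law[of 1 1 1 0] by (intro q_holomorphicI[OF hol, of C]) (auto simp: eventually_at_cusp)
qed

lemma modular_form_odd_weight:
  assumes "modular_form k f" "odd k"
  shows "f z = 0"
proof (cases "z \<in> \<H>")
  case True
  hence "f ((of_int (-1) * z + of_int 0) / (of_int 0 * z + of_int (-1))) = (of_int 0 * z + of_int (-1)) powi k * f z"
    using assms(1) unfolding modular_form_def by (metis mult_minus_right mult.right_neutral mult_zero_left minus_minus diff_zero)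
  thus ?thesis using assms(2) by simp
next
  case False
  thus ?thesis using assms(1) by (auto simp: modular_form_def)
qed

text \<open>The translation and the inversion generate the modular group, by the Euclidean algorithm on the
  bottom row of the matrix.\<close>

lemma mform_SL2:
  assumes F: "mform k F" and k: "even k"
    and det: "a * d - b * c = (1::int)" and z: "Im z > 0"
  shows "F ((of_int a * z + of_int b) / (of_int c * z + of_int d)) = (of_int c * z + of_int d) powi k * F z"
  using det z
proof (induction "nat \<bar>c\<bar>" arbitrary: a b c d z rule: less_induct)
  case less
  note per = q_holomorphic_periodic[OF mform_q_holomorphic[OF F]]
  show ?case
  proof (cases "c = 0")
    case True
    with less.prems have "a * d = 1" by simp
    hence "a = 1 \<and> d = 1 \<or> a = -1 \<and> d = -1" by (auto simp: zmult_eq_1_iff)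
    thus ?thesis using per[OF less.prems(2), of b] per[OF less.prems(2), of "-b"] k True by auto
  next
    case False
    define q r where "q = d div c" "r = d mod c"
    have d: "d = q * c + r" by (simp add: q_r_def)
    have r: "nat \<bar>r\<bar> < nat \<bar>c\<bar>" using False by (simp add: q_r_def abs_mod_less)
    define z' where "z' = z + of_int q"
    define w where "w = -1 / z'"
    have z': "Im z' > 0" using less.prems by (simp add: z'_def)
    have z'0: "z' \<noteq> 0" using z' by auto
    have w: "Im w > 0" unfolding w_def using z' by (rule minus_inverse_in_upper_half_plane)
    have "(b - q * a) * (- c) - (- a) * r = 1" using less.prems(1) by (simp add: d algebra_simps)
    from less.hyps[OF r this w]
    have IH: "F ((of_int (b - q * a) * w + of_int (- a)) / (of_int r * w + of_int (- c))) =
                (of_int r * w + of_int (- c)) powi k * F w" .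
    have den: "of_int r * w + of_int (- c) = - ((of_int c * z + of_int d) / z')"
      using z'0 by (simp add: w_def z'_def d field_simps)
    have num: "of_int (b - q * a) * w + of_int (- a) = - ((of_int a * z + of_int b) / z')"
      using z'0 by (simp add: w_def z'_def field_simps)
    have "F ((of_int a * z + of_int b) / (of_int c * z + of_int d)) = (- ((of_int c * z + of_int d) / z')) powi k * F w"
      proof -
      have "- ((of_int a * z + of_int b) / z') / - ((of_int c * z + of_int d) / z') =
              (of_int a * z + of_int b) / (of_int c * z + of_int d)"
        unfolding minus_divide_divide using z'0 by simp
      thus ?thesis using IH unfolding den num by (simp only:)
    qed
    also have "F w = z' powi k * F z'" unfolding w_def by (rule mform_minus_inverse[OF F z'])
    also have "F z' = F z" unfolding z'_def by (rule per) (use less.prems in auto)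
    also have "(- ((of_int c * z + of_int d) / z')) powi k * (z' powi k * F z) = (of_int c * z + of_int d) powi k * F z"
      using z'0 k by (simp add: power_int_divide_distrib)
    finally show ?thesis .
  qed
qed

lemma mform_imp_modular_form:
  assumes F: "mform k F" and k: "even k"
  shows "modular_form k (\<lambda>z. if z \<in> \<H> then F z else 0)"
  unfolding modular_form_def
proof (intro conjI allI impI ballI)
  show "(\<lambda>z. if z \<in> \<H> then F z else 0) holomorphic_on \<H>"
    by (rule holomorphic_transform[OF q_holomorphic_imp_holomorphic[OF mform_q_holomorphic[OF F]]]) auto
  obtain L where "(F \<longlongrightarrow> L) at_cusp" using q_holomorphic_tendsto[OF mform_q_holomorphic[OF F]] by blast
  hence "eventually (\<lambda>z. dist (F z) L < 1) at_cusp" by (rule tendstoD) simp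
  then obtain B where B: "\<And>z. Im z > B \<Longrightarrow> dist (F z) L < 1" unfolding eventually_at_cusp by blast
  have "norm (if z \<in> \<H> then F z else 0) \<le> norm L + 1" if "Im z > B" for z
    using B[OF that] norm_triangle_ineq2[of "F z" L] by (auto simp: dist_norm)
  thus "\<exists>B C. \<forall>z. Im z > B \<longrightarrow> norm (if z \<in> \<H> then F z else 0) \<le> C" by blast
next
  fix a b c d :: int and z assume det: "a * d - b * c = 1" and z: "z \<in> \<H>"
  define w where "w = (of_int a * z + of_int b) / (of_int c * z + of_int d)"
  define u where "u = of_int c * z + of_int d"
  have "c \<noteq> 0 \<or> d \<noteq> 0" using det by auto
  hence u: "u \<noteq> 0" using lattice_point_nonzero[of z c d] z by (auto simp: u_def)
  have "Im (of_int a * z + of_int b) * Re u - Re (of_int a * z + of_int b) * Im u = of_int (a * d - b * c) * Im z"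
    by (simp add: u_def algebra_simps)
  hence "Im w = Im z / norm u ^ 2"
    unfolding w_def u_def [symmetric] det by (simp add: Im_divide cmod_power2)
  hence "w \<in> \<H>" using z u by simp
  thus "(if (of_int a * z + of_int b) / (of_int c * z + of_int d) \<in> \<H> then F ((of_int a * z + of_int b) / (of_int c * z + of_int d)) else 0) =
       (of_int c * z + of_int d) powi k * (if z \<in> \<H> then F z else 0)"
    using mform_SL2[OF F k det, of z] z by (simp add: w_def)
qed auto

section \<open>The vanishing order of extremal quasimodular forms\<close>

lemma modular_form_zero: "modular_form k (\<lambda>_. 0)"
  by (auto simp: modular_form_def)

text \<open>The monomials of weight \<open>4 * n + 2 * e\<close> and degree at most 2 in \<open>E2\<close> form a single
  sequence: dividing \<open>2 * t + e\<close> by 3 yields the exponents of \<open>E6\<close> and \<open>E2\<close>.\<close>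

definition monomial :: "nat \<Rightarrow> nat \<Rightarrow> nat \<Rightarrow> complex \<Rightarrow> complex" where
  "monomial n e t z = E4 z ^ (n - t) * E6 z ^ ((2 * t + e) div 3) * E2 z ^ ((2 * t + e) mod 3)"

definition cut :: "(complex \<Rightarrow> complex) \<Rightarrow> complex \<Rightarrow> complex" where
  "cut F = (\<lambda>z. if z \<in> \<H> then F z else 0)"

lemma monomial_in_quasimodular_space:
  assumes "t \<le> n" and k: "k = 4 * int n + 2 * int e"
  shows "cut (monomial n e t) \<in> quasimodular_space k"
proof -
  define b c where "b = (2 * t + e) div 3" "c = (2 * t + e) mod 3"
  have bc: "2 * t + e = 3 * b + c" "c < 3" by (auto simp: b_c_def)
  define F where "F = (\<lambda>z. E4 z ^ (n - t) * E6 z ^ b)"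
  have wt: "k - 2 * int c = int (n - t) * 4 + int b * 6"
    using bc(1) assms by (simp add: of_nat_diff)
  have F: "modular_form (k - 2 * int c) (cut F)"
    unfolding cut_def F_def
  proof (rule mform_imp_modular_form)
    show "mform (k - 2 * int c) (\<lambda>z. E4 z ^ (n - t) * E6 z ^ b)"
      unfolding wt by (intro mform_mult mform_power mform_E4 mform_E6)
    show "even (k - 2 * int c)" using k by simp
  qed
  have m: "cut (monomial n e t) = (\<lambda>z. cut F z * E2 z ^ c)"
    by (auto simp: cut_def monomial_def F_def b_c_def)
  define Z where "Z = (\<lambda>_::complex. 0::complex)"
  have Z: "modular_form l Z" for l unfolding Z_def by (rule modular_form_zero)
  consider "c = 0" | "c = 1" | "c = 2" using bc(2) by linarith
  thus ?thesis
  proof cases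
    case 1
    have "quasimodular_decomposition k (cut (monomial n e t)) (cut F) Z Z"
      using F Z 1 unfolding quasimodular_decomposition_def m by (simp add: Z_def)
    thus ?thesis unfolding quasimodular_space_def by blast
  next
    case 2
    have "quasimodular_decomposition k (cut (monomial n e t)) Z (cut F) Z"
      using F Z 2 unfolding quasimodular_decomposition_def m by (simp add: Z_def)
    thus ?thesis unfolding quasimodular_space_def by blast
  next
    case 3
    have "quasimodular_decomposition k (cut (monomial n e t)) Z Z (cut F)"
      using F Z 3 unfolding quasimodular_decomposition_def m by (simp add: Z_def)
    thus ?thesis unfolding quasimodular_space_def by blast
  qed
qed

lemma quadratic_eq_0:
  fixes p q r x y z :: complex
  assumes "p + q * x + r * x ^ 2 = 0" "p + q * y + r * y ^ 2 = 0" "p + q * z + r * z ^ 2 = 0"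
    and "x \<noteq> y" "x \<noteq> z" "y \<noteq> z"
  shows "p = 0" "q = 0" "r = 0"
proof -
  have "(x - y) * (q + r * (x + y)) = 0" using assms(1,2) by algebra
  hence 1: "q + r * (x + y) = 0" using assms(4) by simp
  have "(x - z) * (q + r * (x + z)) = 0" using assms(1,3) by algebra
  hence 2: "q + r * (x + z) = 0" using assms(5) by simp
  have "(y - z) * r = 0" using 1 2 by algebra
  thus r: "r = 0" using assms(6) by simp
  show q: "q = 0" using 1 r by simp
  show "p = 0" using assms(1) q r by simp
qed

text \<open>By Ramanujan's equation, the zero of \<open>E6\<close> at \<open>\<i>\<close> is simple.\<close>

lemma E6_nonzero_near_i: "eventually (\<lambda>z. E6 z \<noteq> 0) (at \<i>)"
proof -
  have "Dq E6 \<i> = (E2 \<i> * E6 \<i> - E4 \<i> ^ 2) / 2" by (rule Ramanujan(3)) simp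
  hence D: "Dq E6 \<i> \<noteq> 0" using E4_i E6_i by simp
  have "(E6 has_field_derivative 2 * of_real pi * \<i> * Dq E6 \<i>) (at \<i>)"
    by (rule has_field_derivative_Dq[of _ \<H>]) (auto intro!: holomorphic_intros)
  hence "((\<lambda>z. (E6 z - E6 \<i>) / (z - \<i>)) \<longlongrightarrow> 2 * of_real pi * \<i> * Dq E6 \<i>) (at \<i>)"
    by (simp add: has_field_derivative_iff)
  hence "eventually (\<lambda>z. (E6 z - E6 \<i>) / (z - \<i>) \<noteq> 0) (at \<i>)"
    by (rule tendsto_imp_eventually_ne) (use D in simp)
  thus ?thesis by eventually_elim (auto simp: E6_i)
qed

text \<open>At three points of an orbit of the modular group, \<open>E4\<close> and \<open>E6\<close> agree up to powers of the
  automorphy factor, while \<open>E2\<close> is replaced by three different values; a polynomial of degree 2 in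
  \<open>E2\<close> therefore vanishes coefficientwise. Within one power of \<open>E2\<close>, the monomials have different orders
  of vanishing at \<open>\<i>\<close>.\<close>

lemma monomials_independent:
  assumes sum0: "\<And>z. Im z > 0 \<Longrightarrow> (\<Sum>t\<le>n. u t * monomial n e t z) = 0" and t: "t \<le> n"
  shows "u t = 0"
proof (rule ccontr)
  assume "u t \<noteq> 0"
  define b where "b = (\<lambda>t. (2 * t + e) div 3)"
  define c where "c = (\<lambda>t. (2 * t + e) mod 3)"
  have bc: "2 * t + e = 3 * b t + c t" "c t < 3" for t by (auto simp: b_def c_def)
  define s where "s = (LEAST t. t \<le> n \<and> u t \<noteq> 0)"
  have s: "s \<le> n" "u s \<noteq> 0"
    using LeastI[of "\<lambda>t. t \<le> n \<and> u t \<noteq> 0" t] t \<open>u t \<noteq> 0\<close> by (auto simp: s_def)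
  have smin: "s \<le> t" if "t \<le> n" "u t \<noteq> 0" for t
    unfolding s_def by (rule Least_le) (use that in auto)
  have orbit: "(\<Sum>t\<le>n. u t * (E4 z ^ (n - t) * E6 z ^ b t * (E2 z + alpha / z) ^ c t)) = 0" if z: "Im z > 0" for z
  proof -
    have z0: "z \<noteq> 0" using z by auto
    have zi: "Im (-1 / z) > 0" using z by (rule minus_inverse_in_upper_half_plane)
    have mon: "monomial n e t (-1 / z) = z ^ (4 * n + 2 * e) * (E4 z ^ (n - t) * E6 z ^ b t * (E2 z + alpha / z) ^ c t)"
      if "t \<le> n" for t
    proof -
      have e2: "E2 (-1 / z) = z ^ 2 * (E2 z + alpha / z)"
        unfolding E2_minus_inverse[OF z] using z0 by (simp add: field_simps power2_eq_square)
      have e4: "E4 (-1 / z) = z ^ 4 * E4 z" using mform_minus_inverse[OF mform_E4 z] by simp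
      have e6: "E6 (-1 / z) = z ^ 6 * E6 z" using mform_minus_inverse[OF mform_E6 z] by simp
      have ex: "4 * (n - t) + 6 * b t + 2 * c t = 4 * n + 2 * e" using bc(1)[of t] that by linarith
      have "monomial n e t (-1 / z) = z ^ (4 * (n - t) + 6 * b t + 2 * c t) * (E4 z ^ (n - t) * E6 z ^ b t * (E2 z + alpha / z) ^ c t)"
      proof -
        have "monomial n e t (-1 / z) = (z ^ 4 * E4 z) ^ (n - t) * (z ^ 6 * E6 z) ^ b t * (z ^ 2 * (E2 z + alpha / z)) ^ c t"
          unfolding monomial_def e2 e4 e6 b_def c_def ..
        also have "\<dots> = (z ^ 4) ^ (n - t) * (z ^ 6) ^ b t * (z ^ 2) ^ c t * (E4 z ^ (n - t) * E6 z ^ b t * (E2 z + alpha / z) ^ c t)"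
          unfolding power_mult_distrib by (simp only: mult_ac)
        finally show ?thesis by (simp only: power_add power_mult)
      qed
      thus ?thesis unfolding ex .
    qed
    have "0 = (\<Sum>t\<le>n. u t * monomial n e t (-1 / z))" by (rule sum0[OF zi, symmetric])
    also have "\<dots> = (\<Sum>t\<le>n. z ^ (4 * n + 2 * e) * (u t * (E4 z ^ (n - t) * E6 z ^ b t * (E2 z + alpha / z) ^ c t)))"
    proof (intro sum.cong refl)
      fix t assume "t \<in> {..n}"
      hence "t \<le> n" by simp
      show "u t * monomial n e t (-1 / z) = z ^ (4 * n + 2 * e) * (u t * (E4 z ^ (n - t) * E6 z ^ b t * (E2 z + alpha / z) ^ c t))"
        unfolding mon[OF \<open>t \<le> n\<close>] by (simp only: mult_ac)
    qed
    also have "\<dots> = z ^ (4 * n + 2 * e) * (\<Sum>t\<le>n. u t * (E4 z ^ (n - t) * E6 z ^ b t * (E2 z + alpha / z) ^ c t))"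
      by (rule sum_distrib_left [symmetric])
    finally show ?thesis using z0 by simp
  qed
  define p where "p = (\<lambda>j z. \<Sum>t\<le>n. if c t = j then u t * (E4 z ^ (n - t) * E6 z ^ b t) else 0)"
  have expand: "(\<Sum>t\<le>n. u t * (E4 z ^ (n - t) * E6 z ^ b t * x ^ c t)) = p 0 z + p 1 z * x + p 2 z * x ^ 2" for z x
  proof -
    have "u t * (E4 z ^ (n - t) * E6 z ^ b t * x ^ c t) =
        (if c t = 0 then u t * (E4 z ^ (n - t) * E6 z ^ b t) else 0) +
        (if c t = 1 then u t * (E4 z ^ (n - t) * E6 z ^ b t) else 0) * x +
        (if c t = 2 then u t * (E4 z ^ (n - t) * E6 z ^ b t) else 0) * x ^ 2" for t
    proof -
      have "c t = 0 \<or> c t = 1 \<or> c t = 2" using bc(2)[of t] by linarith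
      thus ?thesis by auto
    qed
    thus ?thesis by (simp add: p_def sum.distrib sum_distrib_right)
  qed
  have p0: "p (c s) z = 0" if z: "Im z > 0" for z
  proof -
    have z0: "z \<noteq> 0" "z + 1 \<noteq> 0" using z by (auto simp: complex_eq_iff)
    have a: "alpha \<noteq> 0" by (simp add: alpha_def)
    have z1: "Im (z + 1) > 0" using z by simp
    have per: "E2 (z + 1) = E2 z" "E4 (z + 1) = E4 z" "E6 (z + 1) = E6 z"
      using q_holomorphic_periodic[OF _ z, of _ 1] q_holomorphic_E2 q_holomorphic_E4 q_holomorphic_E6 by simp_all
    have 1: "p 0 z + p 1 z * E2 z + p 2 z * E2 z ^ 2 = 0"
      using sum0[OF z] expand[of z "E2 z"] by (simp add: monomial_def b_def c_def)
    have 2: "p 0 z + p 1 z * (E2 z + alpha / z) + p 2 z * (E2 z + alpha / z) ^ 2 = 0"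
      using orbit[OF z] unfolding expand .
    have 3: "p 0 z + p 1 z * (E2 z + alpha / (z + 1)) + p 2 z * (E2 z + alpha / (z + 1)) ^ 2 = 0"
      using orbit[OF z1] unfolding per expand .
    have "E2 z \<noteq> E2 z + alpha / z" "E2 z \<noteq> E2 z + alpha / (z + 1)" "E2 z + alpha / z \<noteq> E2 z + alpha / (z + 1)"
      using z0 a by (auto simp: frac_eq_eq)
    from quadratic_eq_0[OF 1 2 3 this] have "p 0 z = 0" "p 1 z = 0" "p 2 z = 0" .
    moreover have "c s = 0 \<or> c s = 1 \<or> c s = 2" using bc(2)[of s] by linarith
    ultimately show ?thesis by auto
  qed
  define g where "g = (\<lambda>z. \<Sum>t\<le>n. if c t = c s then u t * (E4 z ^ (n - t) * E6 z ^ (b t - b s)) else 0)"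
  have bs: "b s \<le> b t" if "t \<le> n" "u t \<noteq> 0" for t
    using smin[OF that] unfolding b_def by (intro div_le_mono) auto
  have pg: "p (c s) z = E6 z ^ b s * g z" for z
    unfolding p_def g_def sum_distrib_left
  proof (intro sum.cong refl)
    fix t assume t: "t \<in> {..n}"
    show "(if c t = c s then u t * (E4 z ^ (n - t) * E6 z ^ b t) else 0) =
          E6 z ^ b s * (if c t = c s then u t * (E4 z ^ (n - t) * E6 z ^ (b t - b s)) else 0)"
    proof (cases "u t = 0")
      case False
      hence "E6 z ^ b t = E6 z ^ b s * E6 z ^ (b t - b s)"
        using bs[of t] t by (simp flip: power_add)
      thus ?thesis by simp
    qed auto
  qed
  have "eventually (\<lambda>z. z \<in> \<H>) (at \<i>)"
    by (rule eventually_at_in_open') auto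
  hence "eventually (\<lambda>z. g z = 0) (at \<i>)"
    using E6_nonzero_near_i by eventually_elim (use p0 pg in auto)
  hence "(g \<longlongrightarrow> 0) (at \<i>)" by (rule tendsto_eventually)
  moreover have "isCont g \<i>"
  proof -
    have "g holomorphic_on \<H>"
    proof -
      have "(\<lambda>z. if c t = c s then u t * (E4 z ^ (n - t) * E6 z ^ (b t - b s)) else 0) holomorphic_on \<H>" for t
        by (cases "c t = c s") (auto intro!: holomorphic_intros)
      thus ?thesis unfolding g_def by (intro holomorphic_on_sum)
    qed
    from holomorphic_on_imp_continuous_on[OF this] show ?thesis
      by (simp add: continuous_on_eq_continuous_at)
  qed
  hence "(g \<longlongrightarrow> g \<i>) (at \<i>)" by (simp add: isCont_def)
  ultimately have "g \<i> = 0" using tendsto_unique[OF at_neq_bot] by blast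
  moreover have "g \<i> = (\<Sum>t\<le>n. if t = s then u s * E4 \<i> ^ (n - s) else 0)"
    unfolding g_def
  proof (intro sum.cong refl)
    fix t assume t: "t \<in> {..n}"
    show "(if c t = c s then u t * (E4 \<i> ^ (n - t) * E6 \<i> ^ (b t - b s)) else 0) =
          (if t = s then u s * E4 \<i> ^ (n - s) else 0)"
    proof (cases "t = s")
      case False
      show ?thesis
      proof (cases "c t = c s \<and> u t \<noteq> 0")
        case True
        hence "s < t" using smin[of t] t False by simp
        hence "b s < b t" using bc(1)[of t] bc(1)[of s] True by linarith
        thus ?thesis using False by (simp add: E6_i)
      qed (use False in auto)
    qed auto
  qed
  ultimately have "u s * E4 \<i> ^ (n - s) = 0" using s(1) by (simp add: sum.delta)
  thus False using s(2) E4_i by simp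
qed

lemma sum_fun_apply: "(\<Sum>x\<in>A. f x) z = (\<Sum>x\<in>A. f x z :: complex)"
  by (induction A rule: infinite_finite_induct) auto

text \<open>The \<open>n + 1\<close> independent monomials bound the dimension from below. An infinite-dimensional space
  would have \<open>dim = 0\<close>, hence extremal order \<open>-1\<close>, which is excluded since the order is a natural
  number.\<close>

lemma extremal_order_ge:
  assumes ext: "extremal k f" and k: "k = 4 * int n + 2 * int e"
  obtains N where "has_order_at_infinity f N" "n \<le> N"
proof -
  interpret V: vector_space fun_scale by (rule vector_space_fun_scale)
  obtain N where N: "has_order_at_infinity f N" "int N = int (V.dim (quasimodular_space k)) - 1"
    using ext unfolding extremal_def by blast
  define X where "X = (\<lambda>t. cut (monomial n e t))"
  have lin: "u t = 0" if "(\<Sum>t\<le>n. fun_scale (u t) (X t)) = 0" "t \<le> n" for u t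
  proof (rule monomials_independent[where u = u and n = n and e = e])
    fix z :: complex assume z: "Im z > 0"
    have "(\<Sum>t\<le>n. fun_scale (u t) (X t)) z = (\<Sum>t\<le>n. u t * monomial n e t z)"
      unfolding sum_fun_apply using z by (simp add: fun_scale_def X_def cut_def)
    thus "(\<Sum>t\<le>n. u t * monomial n e t z) = 0" unfolding that(1) by simp
  qed fact
  have inj: "inj_on X {..n}"
  proof (rule inj_onI, rule ccontr)
    fix s t assume st: "s \<in> {..n}" "t \<in> {..n}" "X s = X t" "s \<noteq> t"
    define u where "u = (\<lambda>i. if i = s then 1 else if i = t then -1 else 0 :: complex)"
    have "(\<Sum>i\<le>n. fun_scale (u i) (X i)) = (\<Sum>i\<in>{s, t}. fun_scale (u i) (X i))"
      by (rule sum.mono_neutral_right) (use st in \<open>auto simp: u_def fun_scale_def fun_eq_iff\<close>)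
    also have "\<dots> = 0" using st by (simp add: u_def fun_scale_def fun_eq_iff)
    finally have "u s = 0" using lin st by blast
    thus False by (simp add: u_def)
  qed
  have ind: "V.independent (X ` {..n})"
  proof (rule V.independent_if_scalars_zero)
    fix g x assume g: "(\<Sum>x\<in>X ` {..n}. fun_scale (g x) x) = 0" and x: "x \<in> X ` {..n}"
    from x obtain t where t: "t \<le> n" "x = X t" by blast
    have "(\<Sum>t\<le>n. fun_scale (g (X t)) (X t)) = 0" using g by (simp add: sum.reindex[OF inj])
    from lin[OF this t(1)] show "g x = 0" by (simp add: t(2))
  qed auto
  obtain B where B: "B \<subseteq> quasimodular_space k" "V.independent B" "quasimodular_space k \<subseteq> V.span B"
      "card B = V.dim (quasimodular_space k)"
    by (rule V.basis_exists)
  have "card B > 0" using N(2) B(4) by linarith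
  hence fin: "finite B" by (rule card_ge_0_finite)
  have "X ` {..n} \<subseteq> V.span B"
    using monomial_in_quasimodular_space[OF _ k] B(3) by (auto simp: X_def)
  from V.independent_span_bound[OF fin ind this]
  have "card (X ` {..n}) \<le> card B" by blast
  hence "Suc n \<le> card B" by (simp add: card_image[OF inj])
  hence "n \<le> N" using N(2) B(4) by linarith
  thus ?thesis using that N(1) by blast
qed

text \<open>Every point of the punctured disc is a value of the nome, so the expansion of \<open>f\<close> converges on
  the whole disc.\<close>

lemma order_at_infinity_factor:
  assumes "has_order_at_infinity f n"
  obtains F a where "q_holomorphic F" "(F \<longlongrightarrow> a) at_cusp" "a \<noteq> 0"
    "\<And>z. Im z > 0 \<Longrightarrow> f z = nome z ^ n * F z"
proof -
  obtain a where a: "\<And>z. Im z > 0 \<Longrightarrow> (\<lambda>m. a m * nome z ^ m) sums f z" "\<And>m. m < n \<Longrightarrow> a m = 0" "a n \<noteq> 0"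
    using assms unfolding has_order_at_infinity_def upper_half_plane_iff Ball_def by blast
  define G where "G = (\<lambda>q. \<Sum>m. a (m + n) * q ^ m)"
  have surj: "\<exists>z. Im z > 0 \<and> nome z = q" if "q \<noteq> 0" "norm q < 1" for q
  proof (intro exI[of _ "Ln q / (2 * of_real pi * \<i>)"] conjI)
    show "nome (Ln q / (2 * of_real pi * \<i>)) = q" using that by (simp add: nome_def)
    have "Im (Ln q / (2 * of_real pi * \<i>)) = - ln (norm q) / (2 * pi)"
      using that by (simp add: Im_divide power2_eq_square field_simps)
    moreover have "0 < - ln (norm q) / (2 * pi)" using that by (intro divide_pos_pos) auto
    ultimately show "Im (Ln q / (2 * of_real pi * \<i>)) > 0" by (simp only:)
  qed
  have shift: "(\<lambda>m. nome z ^ n * (a (m + n) * nome z ^ m)) sums f z" if "Im z > 0" for z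
  proof -
    have "(\<Sum>i<n. a i * nome z ^ i) = 0" using a(2) by (intro sum.neutral) auto
    hence "(\<lambda>m. a (m + n) * nome z ^ (m + n)) sums f z"
      using sums_split_initial_segment[OF a(1)[OF that], of n] by simp
    thus ?thesis by (simp add: power_add mult_ac)
  qed
  have summ: "summable (\<lambda>m. a (m + n) * q ^ m)" if q: "norm q < 1" for q
  proof (cases "q = 0")
    case False
    then obtain z where z: "Im z > 0" "nome z = q" using surj q by blast
    have "summable (\<lambda>m. (1 / nome z ^ n) * (nome z ^ n * (a (m + n) * nome z ^ m)))"
      by (intro summable_mult sums_summable[OF shift[OF z(1)]])
    thus ?thesis by (simp add: z(2)[symmetric])
  next
    case True
    thus ?thesis by simp
  qed
  have G: "G holomorphic_on ball 0 1"
  proof (subst holomorphic_on_open)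
    show "\<forall>q\<in>ball 0 1. \<exists>f'. (G has_field_derivative f') (at q)"
    proof
      fix q :: complex assume "q \<in> ball 0 1"
      hence "norm q < 1" by simp
      have "(G has_field_derivative (\<Sum>m. diffs (\<lambda>m. a (m + n)) m * q ^ m)) (at q)"
        unfolding G_def by (rule termdiffs_strong'[of 1]) (use summ \<open>norm q < 1\<close> in auto)
      thus "\<exists>f'. (G has_field_derivative f') (at q)" by blast
    qed
  qed auto
  have G0: "G 0 = a n" unfolding G_def by (subst powser_zero) simp
  show ?thesis
  proof (rule that)
    show "q_holomorphic (\<lambda>z. G (nome z))" by (intro q_intros G)
    show "((\<lambda>z. G (nome z)) \<longlongrightarrow> a n) at_cusp" using tendsto_compose_nome[OF G] by (simp add: G0)
    show "a n \<noteq> 0" by fact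
    fix z :: complex assume z: "Im z > 0"
    have "(\<lambda>m. nome z ^ n * (a (m + n) * nome z ^ m)) sums (nome z ^ n * G (nome z))"
      unfolding G_def by (intro sums_mult summable_sums summ) (use z in auto)
    thus "f z = nome z ^ n * G (nome z)" using shift[OF z] sums_unique2 by blast
  qed
qed

section \<open>Vector-valued forms and their minors\<close>

context
  fixes S :: "complex set" and z :: complex
  assumes S: "open S" "z \<in> S"
begin

lemma serre_add:
  "F holomorphic_on S \<Longrightarrow> G holomorphic_on S \<Longrightarrow> serre M (\<lambda>z. F z + G z) z = serre M F z + serre M G z"
  by (simp add: serre_def Dq_add[OF S] algebra_simps)

lemma serre_cmult: "F holomorphic_on S \<Longrightarrow> serre M (\<lambda>z. c * F z) z = c * serre M F z"
  by (simp add: serre_def Dq_cmult[OF S] algebra_simps)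

lemma serre_mult:
  "F holomorphic_on S \<Longrightarrow> G holomorphic_on S \<Longrightarrow> M = a + b \<Longrightarrow>
     serre M (\<lambda>z. F z * G z) z = serre a F z * G z + F z * serre b G z"
  by (simp add: serre_def Dq_mult[OF S] algebra_simps add_divide_distrib)

lemma serre_cong: "(\<And>z. z \<in> S \<Longrightarrow> F z = G z) \<Longrightarrow> serre M F z = serre M G z"
  using Dq_cong[of S F G z] S by (simp add: serre_def)

end

abbreviation kap :: complex where "kap \<equiv> 1 / (2 * of_real pi * \<i>)"

lemma serre_mult_ident:
  assumes "F holomorphic_on \<H>" "Im z > 0"
  shows "serre M (\<lambda>z. z * F z) z = z * serre M F z + kap * F z"
proof -
  have "Dq (\<lambda>z. z) z = kap" by (rule Dq_eqI) (auto intro!: derivative_eq_intros)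
  thus ?thesis using assms by (simp add: serre_def Dq_mult[of \<H>] algebra_simps)
qed

primrec serre_pow :: "int \<Rightarrow> (complex \<Rightarrow> complex) \<Rightarrow> nat \<Rightarrow> complex \<Rightarrow> complex" where
  "serre_pow m h 0 = h"
| "serre_pow m h (Suc j) = serre (m + 2 * int j) (serre_pow m h j)"

lemma holomorphic_serre_pow [holomorphic_intros]: "h holomorphic_on \<H> \<Longrightarrow> serre_pow m h j holomorphic_on \<H>"
  by (induction j) (auto intro!: holomorphic_intros)

lemma q_holomorphic_serre_pow [q_intros]: "q_holomorphic h \<Longrightarrow> q_holomorphic (serre_pow m h j)"
  by (induction j) (auto intro!: q_intros)

lemma serre_pow_minus_inverse:
  assumes h: "h holomorphic_on \<H>" and h': "h' holomorphic_on \<H>"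
    and law: "\<And>z. Im z > 0 \<Longrightarrow> h (-1 / z) = z powi m * h' z" and z: "Im z > 0"
  shows "serre_pow m h j (-1 / z) = z powi (m + 2 * int j) * serre_pow m h' j z"
  using z
proof (induction j arbitrary: z)
  case (Suc j)
  have "m + 2 * int (Suc j) = m + 2 * int j + 2" by simp
  thus ?case
    using serre_minus_inverse[OF holomorphic_serre_pow[OF h, of m j] holomorphic_serre_pow[OF h', of m j] Suc.IH Suc.prems]
    by (simp only: serre_pow.simps)
qed (use law in auto)

lemma Dq_serre_pow: "Dq (serre_pow m h j) z = serre_pow m h (Suc j) z + of_int (m + 2 * int j) / 12 * E2 z * serre_pow m h j z"
  by (simp add: serre_def)

text \<open>The Serre derivatives of \<open>2 * z * f + p\<close> and of \<open>z^2 * f + z * p + r\<close> have the same shape.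
  These are the coefficients of their lower powers of \<open>z\<close>.\<close>

primrec serre_log1 :: "int \<Rightarrow> (complex \<Rightarrow> complex) \<Rightarrow> (complex \<Rightarrow> complex) \<Rightarrow> nat \<Rightarrow> complex \<Rightarrow> complex" where
  "serre_log1 m f p 0 = p"
| "serre_log1 m f p (Suc j) = (\<lambda>z. serre (m + 2 * int j) (serre_log1 m f p j) z + 2 * kap * serre_pow m f j z)"

primrec serre_log2 :: "int \<Rightarrow> (complex \<Rightarrow> complex) \<Rightarrow> (complex \<Rightarrow> complex) \<Rightarrow> (complex \<Rightarrow> complex) \<Rightarrow> nat \<Rightarrow> complex \<Rightarrow> complex" where
  "serre_log2 m f p r 0 = r"
| "serre_log2 m f p r (Suc j) = (\<lambda>z. serre (m + 2 * int j) (serre_log2 m f p r j) z + kap * serre_log1 m f p j z)"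

definition minor :: "(nat \<Rightarrow> complex) \<Rightarrow> (nat \<Rightarrow> complex) \<Rightarrow> (nat \<Rightarrow> complex) \<Rightarrow> nat \<Rightarrow> nat \<Rightarrow> nat \<Rightarrow> complex" where
  "minor a b c i j l = a i * (b j * c l - b l * c j) - a j * (b i * c l - b l * c i) + a l * (b i * c j - b j * c i)"

text \<open>The expansion of a 4 by 4 determinant with a repeated row.\<close>

lemma minor_Cramer:
  "minor a b c 0 1 2 * a 3 - minor a b c 0 1 3 * a 2 + minor a b c 0 2 3 * a 1 - minor a b c 1 2 3 * a 0 = 0"
  "minor a b c 0 1 2 * b 3 - minor a b c 0 1 3 * b 2 + minor a b c 0 2 3 * b 1 - minor a b c 1 2 3 * b 0 = 0"
  "minor a b c 0 1 2 * c 3 - minor a b c 0 1 3 * c 2 + minor a b c 0 2 3 * c 1 - minor a b c 1 2 3 * c 0 = 0"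
  unfolding minor_def by algebra+

text \<open>The \<open>j\<close>-th Serre derivative multiplies \<open>q ^ n\<close> by \<open>cusp_poly m j n\<close> at the cusp. The derivative of
  this polynomial at 0 appears because \<open>z\<close> is, up to a constant factor, the derivative of
  \<open>q ^ x\<close> with respect to \<open>x\<close> at \<open>x = 0\<close>.\<close>

primrec cusp_poly :: "int \<Rightarrow> nat \<Rightarrow> complex \<Rightarrow> complex" where
  "cusp_poly m 0 x = 1"
| "cusp_poly m (Suc j) x = (x - of_int (m + 2 * int j) / 12) * cusp_poly m j x"

primrec cusp_poly_deriv0 :: "int \<Rightarrow> nat \<Rightarrow> complex" where
  "cusp_poly_deriv0 m 0 = 0"
| "cusp_poly_deriv0 m (Suc j) = cusp_poly m j 0 - of_int (m + 2 * int j) / 12 * cusp_poly_deriv0 m j"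

lemma tendsto_serre_cusp:
  assumes "q_holomorphic F" "(F \<longlongrightarrow> L) at_cusp"
  shows "(serre M F \<longlongrightarrow> - (of_int M / 12) * L) at_cusp"
proof -
  have "((\<lambda>z. Dq F z - of_int M / 12 * E2 z * F z) \<longlongrightarrow> 0 - of_int M / 12 * 1 * L) at_cusp"
    by (intro tendsto_intros tendsto_Dq_cusp E2_tendsto_1 assms)
  thus ?thesis by (simp add: serre_def[abs_def])
qed

lemma Dq_nome: "Dq nome z = nome z"
  by (rule Dq_eqI) (use has_field_derivative_nome[of z UNIV] in simp)

lemma serre_nome_power:
  assumes "F holomorphic_on \<H>" "Im z > 0"
  shows "serre M (\<lambda>z. nome z ^ n * F z) z = nome z ^ n * (of_nat n * F z + serre M F z)"
proof -
  have nome: "nome holomorphic_on \<H>" unfolding nome_def by (intro holomorphic_intros)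
  have "Dq (\<lambda>z. nome z ^ n) z = of_nat n * nome z ^ n"
    by (subst Dq_power[of \<H>]) (use nome assms in \<open>auto simp: Dq_nome power_eq_if\<close>)
  thus ?thesis using assms nome
    by (simp add: serre_def Dq_mult[of \<H>] holomorphic_on_power algebra_simps)
qed

text \<open>The functions \<open>z ^ 2 * f + z * p + r\<close>, \<open>2 * z * f + p\<close> and \<open>f\<close> attached to a quasimodular form of
  depth 2 are the components of a vector-valued form of weight \<open>m\<close>: the inversion exchanges the
  first and the third one and changes the sign of the second one.\<close>

locale vector_form =
  fixes m :: int and f p r :: "complex \<Rightarrow> complex"
  assumes q: "q_holomorphic f" "q_holomorphic p" "q_holomorphic r"
    and f_law: "Im z > 0 \<Longrightarrow> f (-1 / z) = z powi m * (z ^ 2 * f z + z * p z + r z)"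
    and p_law: "Im z > 0 \<Longrightarrow> p (-1 / z) = z powi m * (p z + 2 * r z / z)"
    and r_law: "Im z > 0 \<Longrightarrow> r (-1 / z) = z powi m * (r z / z ^ 2)"
begin

definition u1 :: "complex \<Rightarrow> complex" where "u1 = (\<lambda>z. z ^ 2 * f z + z * p z + r z)"
definition u2 :: "complex \<Rightarrow> complex" where "u2 = (\<lambda>z. 2 * z * f z + p z)"

abbreviation H1 where "H1 \<equiv> serre_pow m u1"
abbreviation H2 where "H2 \<equiv> serre_pow m u2"
abbreviation H3 where "H3 \<equiv> serre_pow m f"

definition S :: "nat \<Rightarrow> nat \<Rightarrow> nat \<Rightarrow> complex \<Rightarrow> complex" where
  "S i j l z = minor (\<lambda>j. H1 j z) (\<lambda>j. H2 j z) (\<lambda>j. H3 j z) i j l"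

lemma hol: "f holomorphic_on \<H>" "p holomorphic_on \<H>" "r holomorphic_on \<H>"
  and hol_u: "u1 holomorphic_on \<H>" "u2 holomorphic_on \<H>"
proof -
  show *: "f holomorphic_on \<H>" "p holomorphic_on \<H>" "r holomorphic_on \<H>"
    by (intro q_holomorphic_imp_holomorphic q)+
  show "u1 holomorphic_on \<H>" "u2 holomorphic_on \<H>"
    unfolding u1_def u2_def by (intro holomorphic_intros *)+
qed

lemma q_log1: "q_holomorphic (serre_log1 m f p j)"
  by (induction j) (auto simp only: serre_log1.simps intro!: q_intros q)

lemma q_log2: "q_holomorphic (serre_log2 m f p r j)"
  by (induction j) (auto simp only: serre_log2.simps intro!: q_intros q q_log1)

lemma H2_eq: "Im z > 0 \<Longrightarrow> H2 j z = 2 * z * H3 j z + serre_log1 m f p j z"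
proof (induction j arbitrary: z)
  case (Suc j)
  note h = holomorphic_serre_pow[OF hol(1), of m j] q_holomorphic_imp_holomorphic[OF q_log1[of j]]
  have "H2 (Suc j) z = serre (m + 2 * int j) (\<lambda>z. 2 * (z * H3 j z) + serre_log1 m f p j z) z"
    unfolding serre_pow.simps by (rule serre_cong[where S = "\<H>"]) (use Suc in \<open>auto simp: mult.assoc\<close>)
  also have "\<dots> = serre (m + 2 * int j) (\<lambda>z. 2 * (z * H3 j z)) z + serre (m + 2 * int j) (serre_log1 m f p j) z"
    by (rule serre_add[where S = "\<H>"]) (use h Suc.prems in \<open>auto intro!: holomorphic_intros hol\<close>)
  also have "serre (m + 2 * int j) (\<lambda>z. 2 * (z * H3 j z)) z = 2 * serre (m + 2 * int j) (\<lambda>z. z * H3 j z) z"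
    by (rule serre_cmult[where S = "\<H>"]) (use h Suc.prems in \<open>auto intro!: holomorphic_intros hol\<close>)
  also have "serre (m + 2 * int j) (\<lambda>z. z * H3 j z) z = z * H3 (Suc j) z + kap * H3 j z"
    using serre_mult_ident[OF h(1) Suc.prems] by simp
  finally show ?case by (simp add: algebra_simps)
qed (simp add: u2_def)

lemma H1_eq: "Im z > 0 \<Longrightarrow> H1 j z = z ^ 2 * H3 j z + z * serre_log1 m f p j z + serre_log2 m f p r j z"
proof (induction j arbitrary: z)
  case (Suc j)
  note h = holomorphic_serre_pow[OF hol(1), of m j] q_holomorphic_imp_holomorphic[OF q_log1[of j]]
    q_holomorphic_imp_holomorphic[OF q_log2[of j]]
  define P where "P = (\<lambda>z. z * H3 j z + serre_log1 m f p j z)"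
  have P: "P holomorphic_on \<H>" unfolding P_def by (intro holomorphic_intros h hol)
  have "H1 (Suc j) z = serre (m + 2 * int j) (\<lambda>z. z * P z + serre_log2 m f p r j z) z"
    unfolding serre_pow.simps P_def
    by (rule serre_cong[where S = "\<H>"]) (use Suc in \<open>auto simp: algebra_simps power2_eq_square\<close>)
  also have "\<dots> = serre (m + 2 * int j) (\<lambda>z. z * P z) z + serre (m + 2 * int j) (serre_log2 m f p r j) z"
    by (rule serre_add[where S = "\<H>"]) (use h P Suc.prems in \<open>auto intro!: holomorphic_intros hol\<close>)
  also have "serre (m + 2 * int j) (\<lambda>z. z * P z) z = z * serre (m + 2 * int j) P z + kap * P z"
    by (rule serre_mult_ident[OF P Suc.prems])
  also have "serre (m + 2 * int j) P z = serre (m + 2 * int j) (\<lambda>z. z * H3 j z) z + serre (m + 2 * int j) (serre_log1 m f p j) z"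
    unfolding P_def by (rule serre_add[where S = "\<H>"]) (use h Suc.prems in \<open>auto intro!: holomorphic_intros hol\<close>)
  also have "serre (m + 2 * int j) (\<lambda>z. z * H3 j z) z = z * H3 (Suc j) z + kap * H3 j z"
    using serre_mult_ident[OF h(1) Suc.prems] by simp
  finally show ?case by (simp add: P_def algebra_simps power2_eq_square)
qed (simp add: u1_def)

text \<open>Row operations with powers of \<open>z\<close> as factors remove \<open>z\<close> from the minors. In particular they are
  periodic.\<close>

lemma S_eq:
  assumes "Im z > 0"
  shows "S i j l z = minor (\<lambda>j. serre_log2 m f p r j z) (\<lambda>j. serre_log1 m f p j z) (\<lambda>j. H3 j z) i j l"
  unfolding S_def minor_def H1_eq[OF assms] H2_eq[OF assms] by algebra

lemma q_S: "q_holomorphic (S i j l)"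
  by (rule q_holomorphic_cong[OF _ S_eq[symmetric]]) (auto simp: minor_def intro!: q_intros q q_log1 q_log2)

text \<open>The permutation of the components by the inversion, together with the change of sign, has
  determinant 1.\<close>

lemma S_minus_inverse:
  assumes z: "Im z > 0"
  shows "S i j l (-1 / z) = z powi (3 * m + 2 * int (i + j + l)) * S i j l z"
proof -
  have z0: "z \<noteq> 0" if "Im z > 0" for z using that by auto
  have 1: "f (-1 / z) = z powi m * u1 z" if "Im z > 0" for z
    unfolding f_law[OF that] u1_def ..
  have 2: "u2 (-1 / z) = z powi m * (-1 * u2 z)" if "Im z > 0" for z
  proof -
    have "u2 (-1 / z) = z powi m * (2 * (-1 / z) * (z ^ 2 * f z + z * p z + r z) + (p z + 2 * r z / z))"
      unfolding u2_def f_law[OF that] p_law[OF that] by (simp add: algebra_simps)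
    also have "2 * (-1 / z) * (z ^ 2 * f z + z * p z + r z) + (p z + 2 * r z / z) = -1 * u2 z"
      using z0[OF that] by (simp add: u2_def field_simps power2_eq_square)
    finally show ?thesis .
  qed
  have 3: "u1 (-1 / z) = z powi m * f z" if "Im z > 0" for z
  proof -
    have "u1 (-1 / z) = z powi m * ((-1 / z) ^ 2 * (z ^ 2 * f z + z * p z + r z) + (-1 / z) * (p z + 2 * r z / z) + r z / z ^ 2)"
      unfolding u1_def f_law[OF that] p_law[OF that] r_law[OF that] by (simp add: algebra_simps)
    also have "(-1 / z) ^ 2 * (z ^ 2 * f z + z * p z + r z) + (-1 / z) * (p z + 2 * r z / z) + r z / z ^ 2 = f z"
      using z0[OF that] by (simp add: field_simps power2_eq_square)
    finally show ?thesis .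
  qed
  have neg: "serre_pow m (\<lambda>z. -1 * u2 z) j z = - H2 j z" if "Im z > 0" for j z
    using that
  proof (induction j arbitrary: z)
    case (Suc j)
    have "serre_pow m (\<lambda>z. -1 * u2 z) (Suc j) z = serre (m + 2 * int j) (\<lambda>z. -1 * H2 j z) z"
      unfolding serre_pow.simps by (rule serre_cong[where S = "\<H>"]) (use Suc in auto)
    also have "\<dots> = -1 * serre (m + 2 * int j) (H2 j) z"
      by (rule serre_cmult[where S = "\<H>"]) (use Suc.prems in \<open>auto intro!: holomorphic_intros hol_u\<close>)
    finally show ?case by simp
  qed auto
  have L1: "H3 j (-1 / z) = z powi (m + 2 * int j) * H1 j z" for j
    by (rule serre_pow_minus_inverse[OF hol(1) hol_u(1) 1 z])
  have "(\<lambda>z. -1 * u2 z) holomorphic_on \<H>" by (intro holomorphic_intros hol_u)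
  from serre_pow_minus_inverse[OF hol_u(2) this 2 z]
  have L2: "H2 j (-1 / z) = z powi (m + 2 * int j) * (- H2 j z)" for j
    unfolding neg[OF z] by simp
  have L3: "H1 j (-1 / z) = z powi (m + 2 * int j) * H3 j z" for j
    by (rule serre_pow_minus_inverse[OF hol_u(1) hol(1) 3 z])
  have "z powi (3 * m + 2 * int (i + j + l)) = z powi ((m + 2 * int i) + (m + 2 * int j) + (m + 2 * int l))"
    by (simp add: algebra_simps)
  also have "\<dots> = z powi (m + 2 * int i) * z powi (m + 2 * int j) * z powi (m + 2 * int l)"
    using z0[OF z] by (simp only: power_int_add simp_thms)
  finally show ?thesis unfolding S_def minor_def L1 L2 L3 by algebra
qed

text \<open>In the product rule only the term in which the last column is differentiated survives, besides
  multiples of \<open>E2\<close>.\<close>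

lemma Dq_S012:
  assumes z: "Im z > 0"
  shows "Dq (S 0 1 2) z = S 0 1 3 z + of_int (3 * m + 6) / 12 * E2 z * S 0 1 2 z"
proof (rule Dq_eqI)
  define d where "d = (\<lambda>h j. 2 * of_real pi * \<i> * (serre_pow m h (Suc j) z + of_int (m + 2 * int j) / 12 * E2 z * serre_pow m h j z))"
  have D: "(serre_pow m h j has_field_derivative d h j) (at z)" if "h holomorphic_on \<H>" for h j
    using has_field_derivative_Dq[OF holomorphic_serre_pow[OF that] open_upper_half_plane, of z m j] z
    unfolding Dq_serre_pow d_def by simp
  note D1 = D[OF hol_u(1)] and D2 = D[OF hol_u(2)] and D3 = D[OF hol(1)]
  have "((\<lambda>z. minor (\<lambda>j. H1 j z) (\<lambda>j. H2 j z) (\<lambda>j. H3 j z) 0 1 2) has_field_derivative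
     (d u1 0 * (H2 1 z * H3 2 z - H2 2 z * H3 1 z) + H1 0 z * (d u2 1 * H3 2 z + H2 1 z * d f 2 - d u2 2 * H3 1 z - H2 2 z * d f 1)
      - d u1 1 * (H2 0 z * H3 2 z - H2 2 z * H3 0 z) - H1 1 z * (d u2 0 * H3 2 z + H2 0 z * d f 2 - d u2 2 * H3 0 z - H2 2 z * d f 0)
      + d u1 2 * (H2 0 z * H3 1 z - H2 1 z * H3 0 z) + H1 2 z * (d u2 0 * H3 1 z + H2 0 z * d f 1 - d u2 1 * H3 0 z - H2 1 z * d f 0))) (at z)"
    unfolding minor_def
    by (rule derivative_eq_intros D1 D2 D3 refl)+ (simp only: mult_ac, algebra)
  also have "(d u1 0 * (H2 1 z * H3 2 z - H2 2 z * H3 1 z) + H1 0 z * (d u2 1 * H3 2 z + H2 1 z * d f 2 - d u2 2 * H3 1 z - H2 2 z * d f 1)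
      - d u1 1 * (H2 0 z * H3 2 z - H2 2 z * H3 0 z) - H1 1 z * (d u2 0 * H3 2 z + H2 0 z * d f 2 - d u2 2 * H3 0 z - H2 2 z * d f 0)
      + d u1 2 * (H2 0 z * H3 1 z - H2 1 z * H3 0 z) + H1 2 z * (d u2 0 * H3 1 z + H2 0 z * d f 1 - d u2 1 * H3 0 z - H2 1 z * d f 0)) =
    2 * of_real pi * \<i> * (S 0 1 3 z + of_int (3 * m + 6) / 12 * E2 z * S 0 1 2 z)"
  proof -
    define e where "e = E2 z / 12"
    define M where "M = (of_int m :: complex)"
    define K where "K = 2 * complex_of_real pi * \<i>"
    have dd: "d h 0 = K * (serre_pow m h 1 z + M * e * serre_pow m h 0 z)"
             "d h 1 = K * (serre_pow m h 2 z + (M + 2) * e * serre_pow m h 1 z)"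
             "d h 2 = K * (serre_pow m h 3 z + (M + 4) * e * serre_pow m h 2 z)" for h
      unfolding d_def e_def M_def K_def by (simp_all add: numeral_2_eq_2 numeral_3_eq_3 del: serre_pow.simps)
    have ee: "of_int (3 * m + 6) / 12 * E2 z = (3 * M + 6) * e" by (simp add: e_def M_def)
    show ?thesis unfolding dd ee S_def minor_def K_def [symmetric] by algebra
  qed
  finally show "(S 0 1 2 has_field_derivative 2 * of_real pi * \<i> * (S 0 1 3 z + of_int (3 * m + 6) / 12 * E2 z * S 0 1 2 z)) (at z)"
    unfolding S_def[abs_def] .
qed

lemma log1_tendsto:
  assumes "(f \<longlongrightarrow> 0) at_cusp" "(p \<longlongrightarrow> p0) at_cusp"
  shows "(serre_log1 m f p j \<longlongrightarrow> p0 * cusp_poly m j 0) at_cusp"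
proof -
  have f0: "(serre_pow m f j \<longlongrightarrow> 0) at_cusp" for j
  proof (induction j)
    case (Suc j)
    from tendsto_serre_cusp[OF q_holomorphic_serre_pow[OF q(1)] this, of "m + 2 * int j"] show ?case by simp
  qed (use assms in simp)
  show ?thesis
  proof (induction j)
    case (Suc j)
    have "((\<lambda>z. serre (m + 2 * int j) (serre_log1 m f p j) z + 2 * kap * serre_pow m f j z) \<longlongrightarrow>
            - (of_int (m + 2 * int j) / 12) * (p0 * cusp_poly m j 0) + 2 * kap * 0) at_cusp"
      by (intro tendsto_add tendsto_mult_left tendsto_serre_cusp q_log1 Suc f0)
    thus ?case by (simp add: mult_ac)
  qed (use assms in simp)
qed

lemma log2_tendsto:
  assumes "(f \<longlongrightarrow> 0) at_cusp" "(p \<longlongrightarrow> p0) at_cusp" "(r \<longlongrightarrow> r0) at_cusp"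
  shows "(serre_log2 m f p r j \<longlongrightarrow> r0 * cusp_poly m j 0 + kap * p0 * cusp_poly_deriv0 m j) at_cusp"
proof (induction j)
  case (Suc j)
  have "((\<lambda>z. serre (m + 2 * int j) (serre_log2 m f p r j) z + kap * serre_log1 m f p j z) \<longlongrightarrow>
          - (of_int (m + 2 * int j) / 12) * (r0 * cusp_poly m j 0 + kap * p0 * cusp_poly_deriv0 m j)
          + kap * (p0 * cusp_poly m j 0)) at_cusp"
    by (intro tendsto_add tendsto_mult_left tendsto_serre_cusp q_log2 Suc log1_tendsto assms)
  also have "- (of_int (m + 2 * int j) / 12) * (r0 * cusp_poly m j 0 + kap * p0 * cusp_poly_deriv0 m j)
          + kap * (p0 * cusp_poly m j 0) =
        r0 * cusp_poly m (Suc j) 0 + kap * p0 * cusp_poly_deriv0 m (Suc j)"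
    unfolding cusp_poly.simps cusp_poly_deriv0.simps by algebra
  finally show ?case by simp
qed (use assms in simp)

lemma H3_tendsto:
  assumes F: "q_holomorphic F" "(F \<longlongrightarrow> a) at_cusp" "\<And>z. Im z > 0 \<Longrightarrow> f z = nome z ^ n * F z"
  shows "((\<lambda>z. H3 j z / nome z ^ n) \<longlongrightarrow> a * cusp_poly m j (of_nat n)) at_cusp"
proof -
  have "\<exists>G. q_holomorphic G \<and> (G \<longlongrightarrow> a * cusp_poly m j (of_nat n)) at_cusp \<and> (\<forall>z. Im z > 0 \<longrightarrow> H3 j z = nome z ^ n * G z)"
  proof (induction j)
    case 0
    thus ?case using F by auto
  next
    case (Suc j)
    then obtain G where G: "q_holomorphic G" "(G \<longlongrightarrow> a * cusp_poly m j (of_nat n)) at_cusp"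
      "\<And>z. Im z > 0 \<Longrightarrow> H3 j z = nome z ^ n * G z" by blast
    have "H3 (Suc j) z = nome z ^ n * (of_nat n * G z + serre (m + 2 * int j) G z)" if "Im z > 0" for z
    proof -
      have "H3 (Suc j) z = serre (m + 2 * int j) (\<lambda>z. nome z ^ n * G z) z"
        unfolding serre_pow.simps by (rule serre_cong[where S = "\<H>"]) (use G(3) that in auto)
      thus ?thesis using serre_nome_power[OF q_holomorphic_imp_holomorphic[OF G(1)] that] by simp
    qed
    moreover have "((\<lambda>z. of_nat n * G z + serre (m + 2 * int j) G z) \<longlongrightarrow>
        of_nat n * (a * cusp_poly m j (of_nat n)) + - (of_int (m + 2 * int j) / 12) * (a * cusp_poly m j (of_nat n))) at_cusp"
      by (intro tendsto_add tendsto_mult_left tendsto_serre_cusp G)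
    moreover have "of_nat n * (a * cusp_poly m j (of_nat n)) + - (of_int (m + 2 * int j) / 12) * (a * cusp_poly m j (of_nat n))
        = a * cusp_poly m (Suc j) (of_nat n)"
      unfolding cusp_poly.simps by algebra
    moreover have "q_holomorphic (\<lambda>z. of_nat n * G z + serre (m + 2 * int j) G z)" by (intro q_intros G)
    ultimately show ?case by (intro exI[of _ "\<lambda>z. of_nat n * G z + serre (m + 2 * int j) G z"]) simp
  qed
  then obtain G where G: "(G \<longlongrightarrow> a * cusp_poly m j (of_nat n)) at_cusp" "\<And>z. Im z > 0 \<Longrightarrow> H3 j z = nome z ^ n * G z"
    by blast
  show ?thesis
    by (rule Lim_transform_eventually[OF G(1)])
       (use eventually_at_cusp_Im[of 0] in eventually_elim, auto simp: G(2))
qed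

text \<open>The row of \<open>f\<close> contributes the factor \<open>q ^ n\<close>. The value \<open>r0\<close> of \<open>r\<close> at the cusp drops out, because
  it multiplies a copy of the row of \<open>p\<close>.\<close>

lemma S_tendsto:
  assumes F: "q_holomorphic F" "(F \<longlongrightarrow> a) at_cusp" "\<And>z. Im z > 0 \<Longrightarrow> f z = nome z ^ n * F z"
    and n: "n > 0" and p0: "(p \<longlongrightarrow> p0) at_cusp"
  shows "((\<lambda>z. S i j l z / nome z ^ n) \<longlongrightarrow>
            kap * p0 ^ 2 * a * minor (cusp_poly_deriv0 m) (\<lambda>j. cusp_poly m j 0) (\<lambda>j. cusp_poly m j (of_nat n)) i j l) at_cusp"
proof -
  obtain r0 where r0: "(r \<longlongrightarrow> r0) at_cusp" using q_holomorphic_tendsto[OF q(3)] by blast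
  have "((\<lambda>z. nome z ^ n * F z) \<longlongrightarrow> 0 ^ n * a) at_cusp" by (intro tendsto_intros tendsto_nome F)
  hence "((\<lambda>z. nome z ^ n * F z) \<longlongrightarrow> 0) at_cusp"
    by (simp add: zero_power[OF n])
  hence f0: "(f \<longlongrightarrow> 0) at_cusp"
    by (rule Lim_transform_eventually) (use eventually_at_cusp_Im[of 0] in eventually_elim, auto simp: F(3))
  define x where "x = (\<lambda>j. r0 * cusp_poly m j 0 + kap * p0 * cusp_poly_deriv0 m j)"
  define y where "y = (\<lambda>j. p0 * cusp_poly m j 0)"
  define w where "w = (\<lambda>j. a * cusp_poly m j (of_nat n))"
  have "((\<lambda>z. minor (\<lambda>j. serre_log2 m f p r j z) (\<lambda>j. serre_log1 m f p j z) (\<lambda>j. H3 j z / nome z ^ n) i j l)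
          \<longlongrightarrow> minor x y w i j l) at_cusp"
    unfolding minor_def x_def y_def w_def
    by (intro tendsto_add tendsto_diff tendsto_mult log2_tendsto log1_tendsto H3_tendsto[OF F] f0 p0 r0)
  hence "((\<lambda>z. S i j l z / nome z ^ n) \<longlongrightarrow> minor x y w i j l) at_cusp"
    by (rule Lim_transform_eventually)
       (use eventually_at_cusp_Im[of 0] in eventually_elim, auto simp: S_eq minor_def field_simps)
  also have "minor x y w i j l = kap * p0 ^ 2 * a * minor (cusp_poly_deriv0 m) (\<lambda>j. cusp_poly m j 0) (\<lambda>j. cusp_poly m j (of_nat n)) i j l"
    unfolding minor_def x_def y_def w_def by algebra
  finally show ?thesis .
qed

lemma mform_S:
  assumes F: "q_holomorphic F" "(F \<longlongrightarrow> a) at_cusp" "\<And>z. Im z > 0 \<Longrightarrow> f z = nome z ^ n * F z"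
    and n: "n > 0" and p0: "(p \<longlongrightarrow> p0) at_cusp" and N: "N \<le> n"
  shows "mform (3 * m + 2 * int (i + j + l) - 12 * int N) (\<lambda>z. S i j l z / discriminant z ^ N)"
    and "((\<lambda>z. S i j l z / discriminant z ^ N) \<longlongrightarrow>
      (if N = n then kap * p0 ^ 2 * a * minor (cusp_poly_deriv0 m) (\<lambda>j. cusp_poly m j 0) (\<lambda>j. cusp_poly m j (of_nat n)) i j l else 0)) at_cusp"
proof -
  let ?L = "kap * p0 ^ 2 * a * minor (cusp_poly_deriv0 m) (\<lambda>j. cusp_poly m j 0) (\<lambda>j. cusp_poly m j (of_nat n)) i j l"
  have "((\<lambda>z. nome z ^ (n - N) * (S i j l z / nome z ^ n)) \<longlongrightarrow> 0 ^ (n - N) * ?L) at_cusp"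
    by (intro tendsto_intros tendsto_nome S_tendsto[OF F n p0])
  moreover have "nome z ^ (n - N) * (S i j l z / nome z ^ n) = S i j l z / nome z ^ N" for z
    using N by (simp add: power_diff)
  moreover have "0 ^ (n - N) * ?L = (if N = n then ?L else 0)" using N by auto
  ultimately have lim: "((\<lambda>z. S i j l z / nome z ^ N) \<longlongrightarrow> (if N = n then ?L else 0)) at_cusp" by (simp only:)
  have hol: "S i j l holomorphic_on \<H>" by (rule q_holomorphic_imp_holomorphic[OF q_S])
  have per: "S i j l (z + 1) = S i j l z" if "Im z > 0" for z
    using q_holomorphic_periodic[OF q_S that, of _ _ _ 1] by simp
  from mform_divide_discriminant_power[OF hol per S_minus_inverse lim]
  show "mform (3 * m + 2 * int (i + j + l) - 12 * int N) (\<lambda>z. S i j l z / discriminant z ^ N)"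
    "((\<lambda>z. S i j l z / discriminant z ^ N) \<longlongrightarrow> (if N = n then ?L else 0)) at_cusp" by blast+
qed

end

section \<open>The equation in Serre derivatives\<close>

text \<open>At the cusp the equation has the characteristic polynomial \<open>x ^ 2 * (x - N)\<close>, with the double root
  belonging to the solutions in which \<open>z\<close> occurs. Its coefficients with respect to the polynomials
  \<open>cusp_poly m j\<close> are the quotients of the minors.\<close>

lemma cusp_minors_0:
  assumes "m = 4 * int N - 2"
  defines "d \<equiv> minor (cusp_poly_deriv0 m) (\<lambda>j. cusp_poly m j 0) (\<lambda>j. cusp_poly m j (of_nat N))"
  shows "d 0 2 3 = (1 / 36 - of_nat N ^ 2 / 3) * d 0 1 2"
    and "d 1 2 3 = ((1 / 36 - of_nat N ^ 2 / 3) / 6 + 2 / 27 * of_nat N ^ 3) * d 0 1 2"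
proof -
  define x :: complex where "x = of_nat N / 3"
  have N: "of_nat N = 3 * x" by (simp add: x_def)
  have e: "of_int (m + 2 * int 0) / 12 = x - 1 / 6" "of_int (m + 2 * int (Suc 0)) / 12 = x"
      "of_int (m + 2 * int (Suc (Suc 0))) / 12 = x + 1 / 6"
    unfolding assms by (simp_all add: x_def field_simps)
  have P: "cusp_poly m 0 y = 1" "cusp_poly m 1 y = y - (x - 1 / 6)" "cusp_poly m 2 y = (y - x) * (y - (x - 1 / 6))"
      "cusp_poly m 3 y = (y - (x + 1 / 6)) * ((y - x) * (y - (x - 1 / 6)))" for y
    unfolding numeral_2_eq_2 numeral_3_eq_3 One_nat_def cusp_poly.simps e by (simp_all only: mult_1_right One_nat_def)
  have D: "cusp_poly_deriv0 m 0 = 0" "cusp_poly_deriv0 m 1 = 1" "cusp_poly_deriv0 m 2 = (0 - (x - 1 / 6)) - x"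
      "cusp_poly_deriv0 m 3 = (0 - x) * (0 - (x - 1 / 6)) - (x + 1 / 6) * ((0 - (x - 1 / 6)) - x)"
    using P[of 0] unfolding numeral_2_eq_2 numeral_3_eq_3 One_nat_def cusp_poly_deriv0.simps e
    by (simp_all only: mult_zero_right diff_zero mult_1_right)
  show "d 0 2 3 = (1 / 36 - of_nat N ^ 2 / 3) * d 0 1 2"
    "d 1 2 3 = ((1 / 36 - of_nat N ^ 2 / 3) / 6 + 2 / 27 * of_nat N ^ 3) * d 0 1 2"
    unfolding d_def minor_def P D N by (simp_all add: field_simps power2_eq_square power3_eq_cube)
qed

lemma cusp_minors_2:
  assumes "m = 4 * int N"
  defines "d \<equiv> minor (cusp_poly_deriv0 m) (\<lambda>j. cusp_poly m j 0) (\<lambda>j. cusp_poly m j (of_nat N))"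
  shows "d 0 2 3 = (1 / 36 - of_nat N ^ 2 / 3) * d 0 1 2"
    and "d 1 2 3 = 2 / 27 * of_nat N ^ 3 * d 0 1 2"
proof -
  define x :: complex where "x = of_nat N / 3"
  have N: "of_nat N = 3 * x" by (simp add: x_def)
  have e: "of_int (m + 2 * int 0) / 12 = x" "of_int (m + 2 * int (Suc 0)) / 12 = x + 1 / 6"
      "of_int (m + 2 * int (Suc (Suc 0))) / 12 = x + 1 / 3"
    unfolding assms by (simp_all add: x_def field_simps)
  have P: "cusp_poly m 0 y = 1" "cusp_poly m 1 y = y - x" "cusp_poly m 2 y = (y - (x + 1 / 6)) * (y - x)"
      "cusp_poly m 3 y = (y - (x + 1 / 3)) * ((y - (x + 1 / 6)) * (y - x))" for y
    unfolding numeral_2_eq_2 numeral_3_eq_3 One_nat_def cusp_poly.simps e by (simp_all only: mult_1_right One_nat_def)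
  have D: "cusp_poly_deriv0 m 0 = 0" "cusp_poly_deriv0 m 1 = 1" "cusp_poly_deriv0 m 2 = (0 - x) - (x + 1 / 6)"
      "cusp_poly_deriv0 m 3 = (0 - (x + 1 / 6)) * (0 - x) - (x + 1 / 3) * ((0 - x) - (x + 1 / 6))"
    using P[of 0] unfolding numeral_2_eq_2 numeral_3_eq_3 One_nat_def cusp_poly_deriv0.simps e
    by (simp_all only: mult_zero_right diff_zero mult_1_right)
  show "d 0 2 3 = (1 / 36 - of_nat N ^ 2 / 3) * d 0 1 2"
    "d 1 2 3 = 2 / 27 * of_nat N ^ 3 * d 0 1 2"
    unfolding d_def minor_def P D N by (simp_all add: field_simps power2_eq_square power3_eq_cube)
qed

lemma holomorphic_discriminant [holomorphic_intros]: "discriminant holomorphic_on \<H>"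
  by (rule q_holomorphic_imp_holomorphic[OF q_holomorphic_discriminant])

lemma Dq_discriminant_power:
  assumes "Im z > 0"
  shows "Dq (\<lambda>z. discriminant z ^ N) z = of_nat N * E2 z * discriminant z ^ N"
proof -
  have "Dq (\<lambda>z. discriminant z ^ N) z = of_nat N * discriminant z ^ (N - 1) * Dq discriminant z"
    by (rule Dq_power[OF open_upper_half_plane _ holomorphic_discriminant]) (use assms in simp)
  also have "\<dots> = of_nat N * (discriminant z ^ (N - 1) * discriminant z) * E2 z"
    unfolding Dq_discriminant[OF assms] by (simp only: mult_ac)
  also have "of_nat N * (discriminant z ^ (N - 1) * discriminant z) = of_nat N * discriminant z ^ N"
    by (cases N) (simp_all only: of_nat_0 mult_zero_left diff_Suc_1 power_Suc2)
  finally show ?thesis by (simp only: mult_ac)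
qed

context vector_form
begin

lemma Cramer_S:
  assumes "h \<in> {u1, u2, f}"
  shows "S 0 1 2 z * serre_pow m h 3 z - S 0 1 3 z * serre_pow m h 2 z
           + S 0 2 3 z * serre_pow m h 1 z - S 1 2 3 z * serre_pow m h 0 z = 0"
  using assms minor_Cramer[of "\<lambda>j. H1 j z" "\<lambda>j. H2 j z" "\<lambda>j. H3 j z"] unfolding S_def by blast

text \<open>Divided by the \<open>N\<close>-th power of the discriminant, the four minors have weights 0, 2, 4 and 6. The
  first one is a constant, the second one is its Serre derivative and vanishes, and the other two
  are multiples of \<open>E4\<close> and \<open>E6\<close> with factors that are determined at the cusp.\<close>

lemma equation_weight_0_mod_4:
  assumes m: "m = 4 * int N - 2" and N: "N > 0" "N \<le> n"
    and F: "q_holomorphic F" "(F \<longlongrightarrow> a) at_cusp" "\<And>z. Im z > 0 \<Longrightarrow> f z = nome z ^ n * F z"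
    and z0: "Im z0 > 0" "S 0 1 2 z0 \<noteq> 0"
  shows "\<exists>c. c \<noteq> 0 \<and> (\<forall>z. Im z > 0 \<longrightarrow> S 0 1 2 z = c * discriminant z ^ N)"
    and "\<And>h z. h \<in> {u1, u2, f} \<Longrightarrow> Im z > 0 \<Longrightarrow>
       serre_pow m h 3 z + (1 / 36 - of_nat N ^ 2 / 3) * E4 z * serre_pow m h 1 z
         - ((1 / 36 - of_nat N ^ 2 / 3) / 6 + 2 / 27 * of_nat N ^ 3) * E6 z * h z = 0"
proof -
  have n: "n > 0" using N by simp
  obtain p0 where p0: "(p \<longlongrightarrow> p0) at_cusp" using q_holomorphic_tendsto[OF q(2)] by blast
  define d where "d = minor (cusp_poly_deriv0 m) (\<lambda>j. cusp_poly m j 0) (\<lambda>j. cusp_poly m j (of_nat n))"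
  define K where "K = kap * p0 ^ 2 * a"
  note mf = mform_S(1)[OF F n p0 N(2)]
  have lim: "((\<lambda>z. S i j l z / discriminant z ^ N) \<longlongrightarrow> (if N = n then K * d i j l else 0)) at_cusp" for i j l
    using mform_S(2)[OF F n p0 N(2)] by (simp only: K_def d_def)
  have wt0: "3 * m + 2 * int (0 + 1 + 2) - 12 * int N = 0" using m by simp
  obtain c where c: "\<And>z. Im z > 0 \<Longrightarrow> S 0 1 2 z / discriminant z ^ N = c"
  proof -
    have "mform 0 (\<lambda>z. S 0 1 2 z / discriminant z ^ N)" using mf[of 0 1 2] unfolding wt0 .
    thus thesis by (rule mform_0_const) (rule that)
  qed
  have A: "S 0 1 2 z = c * discriminant z ^ N" if "Im z > 0" for z using c[OF that] by (simp add: field_simps)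
  have c0: "c \<noteq> 0" using A[OF z0(1)] z0(2) by auto
  have "((\<lambda>z. S 0 1 2 z / discriminant z ^ N) \<longlongrightarrow> c) at_cusp"
    by (rule tendsto_eventually) (use eventually_at_cusp_Im[of 0] in eventually_elim, rule c)
  \<comment> \<open>A vanishing order above \<open>N\<close> would annihilate the Wronskian.\<close>
  from tendsto_unique[OF at_cusp_neq_bot this lim]
  have cn: "c = (if N = n then K * d 0 1 2 else 0)" .
  with c0 have nN: "n = N" by (auto split: if_splits)
  have cK: "c = K * d 0 1 2" using cn nN by simp
  define g :: complex where "g = 1 / 36 - of_nat N ^ 2 / 3"
  have B: "S 0 1 3 z = 0" if z: "Im z > 0" for z
  proof -
    have "Dq (S 0 1 2) z = Dq (\<lambda>z. c * discriminant z ^ N) z"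
      by (rule Dq_cong[of \<H>]) (use A z in auto)
    also have "\<dots> = c * Dq (\<lambda>z. discriminant z ^ N) z"
      by (rule Dq_cmult[of \<H>]) (use z in \<open>auto intro!: holomorphic_intros\<close>)
    also have "\<dots> = of_nat N * E2 z * S 0 1 2 z"
      unfolding Dq_discriminant_power[OF z] A[OF z] by (simp only: mult_ac)
    finally have "S 0 1 3 z + of_int (3 * m + 6) / 12 * E2 z * S 0 1 2 z = of_nat N * E2 z * S 0 1 2 z"
      using Dq_S012[OF z] by simp
    moreover have "of_int (3 * m + 6) / 12 = (of_nat N :: complex)" unfolding m by simp
    ultimately show ?thesis by simp
  qed
  have C: "S 0 2 3 z = c * (g * E4 z) * discriminant z ^ N" if z: "Im z > 0" for z
  proof -
    have wt: "3 * m + 2 * int (0 + 2 + 3) - 12 * int N = 4" using m by simp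
    have "S 0 2 3 z / discriminant z ^ N = (K * d 0 2 3) * E4 z"
      by (rule mform_unique[OF mf[of 0 2 3, unfolded wt] mform_E4 _ _ E4_tendsto_1 z])
         (use lim[of 0 2 3] nN in auto)
    also have "K * d 0 2 3 = c * g"
      using cusp_minors_0(1)[OF m] unfolding cK d_def g_def nN by (simp add: mult_ac)
    finally show ?thesis by (simp add: field_simps)
  qed
  have E: "S 1 2 3 z = c * ((g / 6 + 2 / 27 * of_nat N ^ 3) * E6 z) * discriminant z ^ N" if z: "Im z > 0" for z
  proof -
    have wt: "3 * m + 2 * int (1 + 2 + 3) - 12 * int N = 6" using m by simp
    have "S 1 2 3 z / discriminant z ^ N = (K * d 1 2 3) * E6 z"
      by (rule mform_unique[OF mf[of 1 2 3, unfolded wt] mform_E6 _ _ E6_tendsto_1 z])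
         (use lim[of 1 2 3] nN in auto)
    also have "K * d 1 2 3 = c * (g / 6 + 2 / 27 * of_nat N ^ 3)"
      using cusp_minors_0(2)[OF m] unfolding cK d_def g_def nN by (simp add: mult_ac)
    finally show ?thesis by (simp add: field_simps)
  qed
  have eq: "serre_pow m h 3 z + g * E4 z * serre_pow m h 1 z - (g / 6 + 2 / 27 * of_nat N ^ 3) * E6 z * h z = 0"
    if h: "h \<in> {u1, u2, f}" and z: "Im z > 0" for h z
  proof -
    define X where "X = discriminant z ^ N"
    have "(c * X) * (serre_pow m h 3 z + g * E4 z * serre_pow m h 1 z
             - (g / 6 + 2 / 27 * of_nat N ^ 3) * E6 z * serre_pow m h 0 z) =
          S 0 1 2 z * serre_pow m h 3 z - S 0 1 3 z * serre_pow m h 2 z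
           + S 0 2 3 z * serre_pow m h 1 z - S 1 2 3 z * serre_pow m h 0 z"
      unfolding A[OF z] B[OF z] C[OF z] E[OF z] X_def [symmetric] by algebra
    also have "\<dots> = 0" by (rule Cramer_S[OF h])
    finally have "(c * discriminant z ^ N) * (serre_pow m h 3 z + g * E4 z * serre_pow m h 1 z
             - (g / 6 + 2 / 27 * of_nat N ^ 3) * E6 z * serre_pow m h 0 z) = 0"
      unfolding X_def .
    thus ?thesis using c0 by simp
  qed
  show "\<exists>c. c \<noteq> 0 \<and> (\<forall>z. Im z > 0 \<longrightarrow> S 0 1 2 z = c * discriminant z ^ N)" using c0 A by blast
  show "serre_pow m h 3 z + (1 / 36 - of_nat N ^ 2 / 3) * E4 z * serre_pow m h 1 z
         - ((1 / 36 - of_nat N ^ 2 / 3) / 6 + 2 / 27 * of_nat N ^ 3) * E6 z * h z = 0"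
    if "h \<in> {u1, u2, f}" "Im z > 0" for h z by (rule eq [unfolded g_def, OF that])
qed

text \<open>Divided by the \<open>N\<close>-th power of the discriminant, the four minors have weights 6, 8, 10 and 12, and
  the first three are multiples of \<open>E6\<close>, \<open>E4 ^ 2\<close> and \<open>E4 * E6\<close>. In weight 12 the cusp leaves one
  constant \<open>s\<close> free. It is determined at the zero \<open>\<i>\<close> of the leading coefficient \<open>E6\<close>: since all three
  solutions are holomorphic there, the derivative of the equation holds at \<open>\<i>\<close> as well. The third
  derivatives cancel in it, and modulo the equation itself only a multiple of the first derivative
  remains, which is nonzero for one of the solutions.\<close>

lemma equation_weight_2_mod_4:
  assumes m: "m = 4 * int N" and N: "N > 0" "N \<le> n"
    and F: "q_holomorphic F" "(F \<longlongrightarrow> a) at_cusp" "\<And>z. Im z > 0 \<Longrightarrow> f z = nome z ^ n * F z"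
    and z0: "Im z0 > 0" "S 0 1 2 z0 \<noteq> 0"
  shows "\<exists>c. c \<noteq> 0 \<and> (\<forall>z. Im z > 0 \<longrightarrow> S 0 1 2 z = c * E6 z * discriminant z ^ N)"
    and "\<And>h z. h \<in> {u1, u2, f} \<Longrightarrow> Im z > 0 \<Longrightarrow>
       E6 z * serre_pow m h 3 z + E4 z ^ 2 / 2 * serre_pow m h 2 z
         + (1 / 36 - of_nat N ^ 2 / 3) * (E4 z * E6 z) * serre_pow m h 1 z
         - ((2 / 27 * of_nat N ^ 3 + (1 / 36 - of_nat N ^ 2 / 3) / 2) * E6 z ^ 2
              - (1 / 36 - of_nat N ^ 2 / 3) / 2 * E4 z ^ 3) * h z = 0"
proof -
  have n: "n > 0" using N by simp
  obtain p0 where p0: "(p \<longlongrightarrow> p0) at_cusp" using q_holomorphic_tendsto[OF q(2)] by blast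
  define d where "d = minor (cusp_poly_deriv0 m) (\<lambda>j. cusp_poly m j 0) (\<lambda>j. cusp_poly m j (of_nat n))"
  define K where "K = kap * p0 ^ 2 * a"
  note mf = mform_S(1)[OF F n p0 N(2)]
  have lim: "((\<lambda>z. S i j l z / discriminant z ^ N) \<longlongrightarrow> (if N = n then K * d i j l else 0)) at_cusp" for i j l
    using mform_S(2)[OF F n p0 N(2)] by (simp only: K_def d_def)
  define c where "c = (if N = n then K * d 0 1 2 else 0)"
  have A: "S 0 1 2 z = c * E6 z * discriminant z ^ N" if z: "Im z > 0" for z
  proof -
    have wt: "3 * m + 2 * int (0 + 1 + 2) - 12 * int N = 6" using m by simp
    have "S 0 1 2 z / discriminant z ^ N = c * E6 z"
      by (rule mform_unique[OF mf[of 0 1 2, unfolded wt] mform_E6 _ _ E6_tendsto_1 z])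
         (use lim[of 0 1 2] in \<open>auto simp: c_def\<close>)
    thus ?thesis by (simp add: field_simps)
  qed
  have c0: "c \<noteq> 0" using A[OF z0(1)] z0(2) by auto
  hence nN: "n = N" by (auto simp: c_def split: if_splits)
  have cK: "c = K * d 0 1 2" using nN by (simp add: c_def)
  define g :: complex where "g = 1 / 36 - of_nat N ^ 2 / 3"
  have B: "S 0 1 3 z = - c * (E4 z ^ 2 / 2) * discriminant z ^ N" if z: "Im z > 0" for z
  proof -
    have "Dq (S 0 1 2) z = Dq (\<lambda>z. c * (E6 z * discriminant z ^ N)) z"
      by (rule Dq_cong[of \<H>]) (use A z in auto)
    also have "\<dots> = c * Dq (\<lambda>z. E6 z * discriminant z ^ N) z"
      by (rule Dq_cmult[of \<H>]) (use z in \<open>auto intro!: holomorphic_intros\<close>)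
    also have "Dq (\<lambda>z. E6 z * discriminant z ^ N) z = Dq E6 z * discriminant z ^ N + E6 z * Dq (\<lambda>z. discriminant z ^ N) z"
      by (rule Dq_mult[of \<H>]) (use z in \<open>auto intro!: holomorphic_intros\<close>)
    finally have "S 0 1 3 z + of_int (3 * m + 6) / 12 * E2 z * S 0 1 2 z =
        c * ((E2 z * E6 z - E4 z ^ 2) / 2 * discriminant z ^ N + E6 z * (of_nat N * E2 z * discriminant z ^ N))"
      unfolding Dq_S012[OF z] Ramanujan(3)[OF z] Dq_discriminant_power[OF z] .
    moreover have "of_int (3 * m + 6) / 12 = (of_nat N + 1 / 2 :: complex)" unfolding m by (simp add: field_simps)
    ultimately have "S 0 1 3 z + (of_nat N + 1 / 2) * E2 z * (c * E6 z * discriminant z ^ N) =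
        c * ((E2 z * E6 z - E4 z ^ 2) / 2 * discriminant z ^ N + E6 z * (of_nat N * E2 z * discriminant z ^ N))"
      unfolding A[OF z] by (simp only:)
    moreover define X where "X = discriminant z ^ N"
    ultimately have "S 0 1 3 z = c * ((E2 z * E6 z - E4 z ^ 2) / 2 * X + E6 z * (of_nat N * E2 z * X))
        - (of_nat N + 1 / 2) * E2 z * (c * E6 z * X)"
      by (simp only: eq_diff_eq)
    also have "\<dots> = - c * (E4 z ^ 2 / 2) * X" by (simp add: field_simps)
    finally show ?thesis unfolding X_def .
  qed
  have C: "S 0 2 3 z = c * (g * (E4 z * E6 z)) * discriminant z ^ N" if z: "Im z > 0" for z
  proof -
    have wt: "3 * m + 2 * int (0 + 2 + 3) - 12 * int N = 10" using m by simp
    have E46: "mform 10 (\<lambda>z. E4 z * E6 z)" using mform_mult[OF mform_E4 mform_E6] by simp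
    have E46_lim: "((\<lambda>z. E4 z * E6 z) \<longlongrightarrow> 1) at_cusp"
      using tendsto_mult[OF E4_tendsto_1 E6_tendsto_1] by simp
    have "S 0 2 3 z / discriminant z ^ N = (K * d 0 2 3) * (E4 z * E6 z)"
      by (rule mform_unique[OF mf[of 0 2 3, unfolded wt] E46 _ _ E46_lim z])
         (use lim[of 0 2 3] nN in auto)
    also have "K * d 0 2 3 = c * g"
      using cusp_minors_2(1)[OF m] unfolding cK d_def g_def nN by (simp add: mult_ac)
    finally show ?thesis by (simp add: field_simps)
  qed
  obtain s where E: "\<And>z. Im z > 0 \<Longrightarrow>
      S 1 2 3 z = c * ((2 / 27 * of_nat N ^ 3 - s) * E6 z ^ 2 + s * E4 z ^ 3) * discriminant z ^ N"
  proof -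
    define L where "L = c * (2 / 27 * of_nat N ^ 3)"
    have wt: "3 * m + 2 * int (1 + 2 + 3) - 12 * int N = 12" using m by simp
    have "K * d 1 2 3 = L"
      using cusp_minors_2(2)[OF m] unfolding cK d_def L_def nN by (simp add: mult_ac)
    hence lim123: "((\<lambda>z. S 1 2 3 z / discriminant z ^ N) \<longlongrightarrow> L) at_cusp"
      using lim[of 1 2 3] nN by simp
    have "mform 12 (\<lambda>z. S 1 2 3 z / discriminant z ^ N - L * E6 z ^ 2)"
      using mf[of 1 2 3, unfolded wt] mform_power[OF mform_E6, of 2] by (intro mform_diff mform_cmult) auto
    moreover have "((\<lambda>z. S 1 2 3 z / discriminant z ^ N - L * E6 z ^ 2) \<longlongrightarrow> L - L * 1 ^ 2) at_cusp"
      by (intro tendsto_intros lim123 E6_tendsto_1)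
    ultimately have "mform (12 - 12) (\<lambda>z. (S 1 2 3 z / discriminant z ^ N - L * E6 z ^ 2) / discriminant z)"
      by (intro mform_divide_discriminant) auto
    hence "mform 0 (\<lambda>z. (S 1 2 3 z / discriminant z ^ N - L * E6 z ^ 2) / discriminant z)" by simp
    then obtain b where b: "\<And>z. Im z > 0 \<Longrightarrow> (S 1 2 3 z / discriminant z ^ N - L * E6 z ^ 2) / discriminant z = b"
      by (rule mform_0_const) blast
    show ?thesis
    proof (rule that)
      fix z :: complex assume z: "Im z > 0"
      have "S 1 2 3 z / discriminant z ^ N = L * E6 z ^ 2 + b * discriminant z"
        using b[OF z] by (simp add: field_simps)
      also have "b * discriminant z = b * ((E4 z ^ 3 - E6 z ^ 2) / 1728)"
        using E4_cube_minus_E6_square[OF z] by simp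
      also have "L * E6 z ^ 2 + b * ((E4 z ^ 3 - E6 z ^ 2) / 1728) =
          c * ((2 / 27 * of_nat N ^ 3 - b / 1728 / c) * E6 z ^ 2 + b / 1728 / c * E4 z ^ 3)"
        using c0 by (simp add: L_def field_simps)
      finally show "S 1 2 3 z = c * ((2 / 27 * of_nat N ^ 3 - b / 1728 / c) * E6 z ^ 2 + b / 1728 / c * E4 z ^ 3) * discriminant z ^ N"
        by (subst (asm) divide_eq_eq) simp
    qed
  qed
  define G where "G = (\<lambda>h z. E6 z * serre_pow m h 3 z + 1 / 2 * E4 z ^ 2 * serre_pow m h 2 z
         + g * (E4 z * E6 z) * serre_pow m h 1 z
         - ((2 / 27 * of_nat N ^ 3 - s) * E6 z ^ 2 + s * E4 z ^ 3) * serre_pow m h 0 z)"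
  have G0: "G h z = 0" if h: "h \<in> {u1, u2, f}" and z: "Im z > 0" for h z
  proof -
    define X where "X = discriminant z ^ N"
    have "(c * X) * G h z = S 0 1 2 z * serre_pow m h 3 z - S 0 1 3 z * serre_pow m h 2 z
           + S 0 2 3 z * serre_pow m h 1 z - S 1 2 3 z * serre_pow m h 0 z"
      unfolding A[OF z] B[OF z] C[OF z] E[OF z] G_def X_def [symmetric] by (simp add: algebra_simps)
    also have "\<dots> = 0" by (rule Cramer_S[OF h])
    finally have "(c * discriminant z ^ N) * G h z = 0" unfolding X_def .
    thus ?thesis using c0 by simp
  qed
  have s: "s = - g / 2"
  proof -
    \<comment> \<open>Otherwise the column of first derivatives, and with it the second minor, would vanish at \<open>\<i>\<close>.\<close>
    have "\<exists>h\<in>{u1, u2, f}. serre_pow m h 1 \<i> \<noteq> 0"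
    proof (rule ccontr)
      assume "\<not> ?thesis"
      hence "S 0 1 3 \<i> = 0" by (simp add: S_def minor_def)
      thus False using B[of \<i>] c0 E4_i by simp
    qed
    then obtain h where h: "h \<in> {u1, u2, f}" and h1: "serre_pow m h 1 \<i> \<noteq> 0" by blast
    have hol_h: "h holomorphic_on \<H>" using h hol(1) hol_u by auto
    define x where "x = (\<lambda>j. serre_pow m h j \<i>)"
    define e where "e = E2 \<i> / 12"
    define M where "M = (of_int m :: complex)"
    define k where "k = 2 * complex_of_real pi * \<i>"
    have D: "(F has_field_derivative k * Dq F \<i>) (at \<i>)" if "F holomorphic_on \<H>" for F
      using has_field_derivative_Dq[OF that open_upper_half_plane, of \<i>] by (simp add: k_def)
    have x0: "(serre_pow m h 0 has_field_derivative k * (x 1 + M * e * x 0)) (at \<i>)"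
     and x1: "(serre_pow m h 1 has_field_derivative k * (x 2 + (M + 2) * e * x 1)) (at \<i>)"
     and x2: "(serre_pow m h 2 has_field_derivative k * (x 3 + (M + 4) * e * x 2)) (at \<i>)"
     and x3: "(serre_pow m h 3 has_field_derivative k * (x 4 + (M + 6) * e * x 3)) (at \<i>)"
      using D[OF holomorphic_serre_pow[OF hol_h, of m 0]] D[OF holomorphic_serre_pow[OF hol_h, of m 1]]
        D[OF holomorphic_serre_pow[OF hol_h, of m 2]] D[OF holomorphic_serre_pow[OF hol_h, of m 3]]
      unfolding Dq_serre_pow x_def e_def M_def by (simp_all add: eval_nat_numeral del: serre_pow.simps)
    have D4: "(E4 has_field_derivative k * (4 * e * E4 \<i>)) (at \<i>)"
      using D[OF holomorphic_E4] Ramanujan(2)[of \<i>] by (simp add: E6_i e_def)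
    have D6: "(E6 has_field_derivative k * (- (E4 \<i> ^ 2) / 2)) (at \<i>)"
      using D[OF holomorphic_E6] Ramanujan(3)[of \<i>] by (simp add: E6_i)
    have DG: "(G h has_field_derivative
        k * (- (E4 \<i> ^ 2) / 2) * x 3
        + (E4 \<i> * (k * (4 * e * E4 \<i>)) * x 2 + E4 \<i> ^ 2 / 2 * (k * (x 3 + (M + 4) * e * x 2)))
        + g * (E4 \<i> * (k * (- (E4 \<i> ^ 2) / 2))) * x 1
        - (s * (3 * E4 \<i> ^ 2 * (k * (4 * e * E4 \<i>))) * x 0 + s * E4 \<i> ^ 3 * (k * (x 1 + M * e * x 0)))) (at \<i>)"
      unfolding G_def
      by (rule derivative_eq_intros x0 x1 x2 x3 D4 D6 refl)+
         (simp add: E6_i x_def algebra_simps power2_eq_square power3_eq_cube)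
    have "(G h has_field_derivative 0) (at \<i>)"
      by (rule has_field_derivative_transform_within_open[OF DERIV_const open_upper_half_plane])
         (use G0[OF h] in auto)
    note DG0 = DERIV_unique[OF DG this]
    have Gi: "E4 \<i> ^ 2 / 2 * x 2 - s * E4 \<i> ^ 3 * x 0 = 0"
      using G0[OF h, of \<i>] by (simp add: G_def E6_i x_def)
    have "k * E4 \<i> ^ 3 * (g / 2 + s) * x 1 =
      k * (12 + M) * e * (E4 \<i> ^ 2 / 2 * x 2 - s * E4 \<i> ^ 3 * x 0) - (k * (- (E4 \<i> ^ 2) / 2) * x 3
        + (E4 \<i> * (k * (4 * e * E4 \<i>)) * x 2 + E4 \<i> ^ 2 / 2 * (k * (x 3 + (M + 4) * e * x 2)))
        + g * (E4 \<i> * (k * (- (E4 \<i> ^ 2) / 2))) * x 1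
        - (s * (3 * E4 \<i> ^ 2 * (k * (4 * e * E4 \<i>))) * x 0 + s * E4 \<i> ^ 3 * (k * (x 1 + M * e * x 0))))"
      by (simp add: field_simps power2_eq_square power3_eq_cube)
    also have "\<dots> = 0" unfolding Gi DG0 by simp
    finally have "k * E4 \<i> ^ 3 * (g / 2 + s) * x 1 = 0" .
    hence "g / 2 + s = 0" using h1 E4_i by (simp add: x_def k_def)
    thus ?thesis by (simp add: eq_neg_iff_add_eq_0 add.commute)
  qed
  have eq: "E6 z * serre_pow m h 3 z + E4 z ^ 2 / 2 * serre_pow m h 2 z
         + g * (E4 z * E6 z) * serre_pow m h 1 z
         - ((2 / 27 * of_nat N ^ 3 + g / 2) * E6 z ^ 2 - g / 2 * E4 z ^ 3) * h z = 0"
    if h: "h \<in> {u1, u2, f}" and z: "Im z > 0" for h z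
    using G0[OF h z] unfolding G_def s by (simp add: algebra_simps)
  show "\<exists>c. c \<noteq> 0 \<and> (\<forall>z. Im z > 0 \<longrightarrow> S 0 1 2 z = c * E6 z * discriminant z ^ N)" using c0 A by blast
  show "E6 z * serre_pow m h 3 z + E4 z ^ 2 / 2 * serre_pow m h 2 z
         + (1 / 36 - of_nat N ^ 2 / 3) * (E4 z * E6 z) * serre_pow m h 1 z
         - ((2 / 27 * of_nat N ^ 3 + (1 / 36 - of_nat N ^ 2 / 3) / 2) * E6 z ^ 2
              - (1 / 36 - of_nat N ^ 2 / 3) / 2 * E4 z ^ 3) * h z = 0"
    if "h \<in> {u1, u2, f}" "Im z > 0" for h z by (rule eq [unfolded g_def, OF that])
qed

end

section \<open>The Wronskian\<close>

lemma vector_form_of_decomposition: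
  assumes "quasimodular_decomposition k f f0 f1 f2"
  shows "vector_form (k - 2) f (\<lambda>z. alpha * (f1 z + 2 * f2 z * E2 z)) (\<lambda>z. alpha ^ 2 * f2 z)"
proof
  have mf: "mform k f0" "mform (k - 2) f1" "mform (k - 4) f2"
    and f: "f = (\<lambda>z. f0 z + f1 z * E2 z + f2 z * E2 z ^ 2)"
    using assms modular_form_imp_mform unfolding quasimodular_decomposition_def by blast+
  note q = mf[THEN mform_q_holomorphic]
  show "q_holomorphic f" "q_holomorphic (\<lambda>z. alpha * (f1 z + 2 * f2 z * E2 z))" "q_holomorphic (\<lambda>z. alpha ^ 2 * f2 z)"
    unfolding f by (intro q_intros q)+
  fix z :: complex assume z: "Im z > 0"
  define P where "P = z powi (k - 2)"
  define i where "i = 1 / z"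
  have z0: "z \<noteq> 0" using z by auto
  have zi: "z * i = 1" using z0 by (simp add: i_def)
  have f0: "f0 (-1 / z) = P * z ^ 2 * f0 z"
  proof -
    have "z powi k = z powi ((k - 2) + 2)" by simp
    also have "\<dots> = P * z ^ 2" unfolding P_def by (subst power_int_add) (use z0 in auto)
    finally show ?thesis using mform_minus_inverse[OF mf(1) z] by simp
  qed
  have f1: "f1 (-1 / z) = P * f1 z" using mform_minus_inverse[OF mf(2) z] by (simp add: P_def)
  have f2: "f2 (-1 / z) = P * i ^ 2 * f2 z"
  proof -
    have "z powi (k - 4) = z powi ((k - 2) + (- 2))" by simp
    also have "\<dots> = P * i ^ 2" unfolding P_def i_def
      by (subst power_int_add) (use z0 in \<open>auto simp: power_int_minus field_simps\<close>)
    finally show ?thesis using mform_minus_inverse[OF mf(3) z] by simp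
  qed
  note E2 = E2_minus_inverse[OF z]
  have "f (-1 / z) = P * (z ^ 2 * f z + z * (alpha * (f1 z + 2 * f2 z * E2 z)) + alpha ^ 2 * f2 z)"
    unfolding f f0 f1 f2 E2 using zi by algebra
  thus "f (-1 / z) = z powi (k - 2) * (z ^ 2 * f z + z * (alpha * (f1 z + 2 * f2 z * E2 z)) + alpha ^ 2 * f2 z)"
    unfolding P_def .
  have "alpha * (f1 (-1 / z) + 2 * f2 (-1 / z) * E2 (-1 / z)) =
          P * (alpha * (f1 z + 2 * f2 z * E2 z) + 2 * (alpha ^ 2 * f2 z) * i)"
    unfolding f1 f2 E2 using zi by algebra
  thus "alpha * (f1 (-1 / z) + 2 * f2 (-1 / z) * E2 (-1 / z)) =
          z powi (k - 2) * (alpha * (f1 z + 2 * f2 z * E2 z) + 2 * (alpha ^ 2 * f2 z) / z)"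
    unfolding P_def i_def by simp
  have "alpha ^ 2 * f2 (-1 / z) = P * ((alpha ^ 2 * f2 z) * i ^ 2)"
    unfolding f2 by (simp only: mult_ac)
  thus "alpha ^ 2 * f2 (-1 / z) = z powi (k - 2) * (alpha ^ 2 * f2 z / z ^ 2)"
    unfolding P_def i_def by (simp add: power_divide)
qed

abbreviation twopii :: complex where "twopii \<equiv> 2 * of_real pi * \<i>"

lemma deriv_eq_Dq: "deriv f = (\<lambda>z. twopii * Dq f z)"
  by (simp add: Dq_def fun_eq_iff)

lemma deriv_pow_eq_Dq_pow:
  assumes "f holomorphic_on S" "open S" "z \<in> S"
  shows "(deriv ^^ j) f z = twopii ^ j * (Dq ^^ j) f z"
  using assms(3)
proof (induction j arbitrary: z)
  case (Suc j)
  have hol: "(Dq ^^ j) f holomorphic_on S"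
    by (induction j) (auto intro!: holomorphic_intros assms)
  have "(deriv ^^ Suc j) f z = twopii * Dq ((deriv ^^ j) f) z" by (simp add: deriv_eq_Dq)
  also have "Dq ((deriv ^^ j) f) z = Dq (\<lambda>z. twopii ^ j * (Dq ^^ j) f z) z"
    by (rule Dq_cong[OF _ assms(2) Suc.prems]) (rule Suc.IH)
  also have "\<dots> = twopii ^ j * Dq ((Dq ^^ j) f) z"
    by (rule Dq_cmult[OF assms(2) Suc.prems hol])
  finally show ?case by simp
qed simp

lemma wronskian3_eq_minor:
  assumes "u1 holomorphic_on S" "u2 holomorphic_on S" "u3 holomorphic_on S" "open S" "z \<in> S"
  shows "wronskian3 u1 u2 u3 z =
           twopii ^ 3 * minor (\<lambda>j. (Dq ^^ j) u1 z) (\<lambda>j. (Dq ^^ j) u2 z) (\<lambda>j. (Dq ^^ j) u3 z) 0 1 2"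
proof -
  have d: "deriv u z = twopii * (Dq ^^ 1) u z" "u z = (Dq ^^ 0) u z" for u by (simp_all add: Dq_def)
  define k where "k = twopii"
  show ?thesis
    unfolding wronskian3_def det_3 vector_3 deriv_pow_eq_Dq_pow[OF assms(1,4,5)]
      deriv_pow_eq_Dq_pow[OF assms(2,4,5)] deriv_pow_eq_Dq_pow[OF assms(3,4,5)] minor_def d(1) k_def [symmetric]
    unfolding d(2) [symmetric] by (simp add: power2_eq_square power3_eq_cube algebra_simps)
qed

text \<open>Serre derivatives and ordinary derivatives differ by column operations.\<close>

lemma minor_serre_eq_minor_Dq:
  assumes "u1 holomorphic_on \<H>" "u2 holomorphic_on \<H>" "u3 holomorphic_on \<H>" "Im z > 0"
  shows "minor (\<lambda>j. serre_pow m u1 j z) (\<lambda>j. serre_pow m u2 j z) (\<lambda>j. serre_pow m u3 j z) 0 1 2 =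
         minor (\<lambda>j. (Dq ^^ j) u1 z) (\<lambda>j. (Dq ^^ j) u2 z) (\<lambda>j. (Dq ^^ j) u3 z) 0 1 2"
proof -
  define M where "M = (of_int m / 12 :: complex)"
  define M' where "M' = (of_int (m + 2) / 12 :: complex)"
  have x1: "serre_pow m u 1 z = (Dq ^^ 1) u z - M * E2 z * (Dq ^^ 0) u z" for u
    by (simp add: serre_def M_def)
  have x2: "serre_pow m u 2 z = (Dq ^^ 2) u z - M * (Dq E2 z * (Dq ^^ 0) u z + E2 z * (Dq ^^ 1) u z)
               - M' * E2 z * ((Dq ^^ 1) u z - M * E2 z * (Dq ^^ 0) u z)"
    if u: "u holomorphic_on \<H>" for u
  proof -
    have zH: "z \<in> \<H>" using assms(4) by simp
    have su: "serre m u = (\<lambda>z. Dq u z - M * (E2 z * u z))" by (simp add: serre_def fun_eq_iff M_def)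
    have "serre_pow m u 2 z = serre (m + 2) (serre m u) z" by (simp add: numeral_2_eq_2)
    also have "\<dots> = Dq (serre m u) z - M' * E2 z * serre_pow m u 1 z"
      by (subst serre_def) (simp add: M'_def)
    also have "Dq (serre m u) z = Dq (\<lambda>z. Dq u z - M * (E2 z * u z)) z" unfolding su ..
    also have "Dq (\<lambda>z. Dq u z - M * (E2 z * u z)) z = Dq (Dq u) z - Dq (\<lambda>z. M * (E2 z * u z)) z"
      by (rule Dq_diff[OF open_upper_half_plane zH]) (auto intro!: holomorphic_intros u)
    also have "Dq (\<lambda>z. M * (E2 z * u z)) z = M * Dq (\<lambda>z. E2 z * u z) z"
      by (rule Dq_cmult[OF open_upper_half_plane zH]) (auto intro!: holomorphic_intros u)
    also have "Dq (\<lambda>z. E2 z * u z) z = Dq E2 z * u z + E2 z * Dq u z"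
      by (rule Dq_mult[OF open_upper_half_plane zH]) (auto intro!: holomorphic_intros u)
    finally show ?thesis unfolding x1 by (simp add: numeral_2_eq_2)
  qed
  have x0: "serre_pow m u 0 z = (Dq ^^ 0) u z" for u by simp
  show ?thesis
    unfolding minor_def x2[OF assms(1)] x2[OF assms(2)] x2[OF assms(3)] x1 x0
    by (simp add: algebra_simps)
qed

section \<open>The equation of the quotients by the cube root\<close>

lemma holomorphic_serre_on:
  "F holomorphic_on S \<Longrightarrow> open S \<Longrightarrow> S \<subseteq> \<H> \<Longrightarrow> serre M F holomorphic_on S"
  unfolding serre_def[abs_def]
  by (intro holomorphic_intros holomorphic_on_subset[OF holomorphic_E2]) auto

text \<open>The equation satisfied by \<open>y\<close> when \<open>w * y\<close> satisfies a given one, in Serre derivatives. Here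
  \<open>y\<close> has weight \<open>-2\<close>, and \<open>v\<close> is the logarithmic Serre derivative of \<open>w\<close>.\<close>

lemma serre_pow_quotient:
  assumes U: "open U" "U \<subseteq> \<H>" and w: "w holomorphic_on U" and y: "y holomorphic_on U" and v: "v holomorphic_on U"
    and h: "\<And>z. z \<in> U \<Longrightarrow> h z = w z * y z" and wv: "\<And>z. z \<in> U \<Longrightarrow> serre (m + 2) w z = v z * w z"
    and z: "z \<in> U"
  defines "y1 \<equiv> serre (-2) y" and "y2 \<equiv> serre 0 (serre (-2) y)" and "y3 \<equiv> serre 2 (serre 0 (serre (-2) y))"
  defines "v1 \<equiv> serre 2 v" and "v2 \<equiv> serre 4 (serre 2 v)"
  shows "serre_pow m h 1 z = w z * (y1 z + v z * y z)"
    and "serre_pow m h 2 z = w z * (y2 z + 2 * (v z * y1 z) + (v1 z + v z ^ 2) * y z)"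
    and "serre_pow m h 3 z = w z * (y3 z + 3 * v z * y2 z + 3 * (v1 z + v z ^ 2) * y1 z
             + (v2 z + 3 * v z * v1 z + v z ^ 3) * y z)"
proof -
  have hs: "serre M F holomorphic_on U" if "F holomorphic_on U" for M F
    by (rule holomorphic_serre_on[OF that U])
  have hy: "y1 holomorphic_on U" "y2 holomorphic_on U" "v1 holomorphic_on U"
    unfolding y1_def y2_def v1_def by (intro hs y v)+
  have e1: "serre_pow m h 1 z = w z * (y1 z + v z * y z)" if z: "z \<in> U" for z
  proof -
    have "serre_pow m h 1 z = serre m (\<lambda>z. w z * y z) z"
      using serre_cong[OF U(1) z, of h "\<lambda>z. w z * y z"] h by simp
    also have "\<dots> = serre (m + 2) w z * y z + w z * serre (-2) y z"
      by (rule serre_mult[OF U(1) z w y]) simp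
    finally show ?thesis unfolding wv[OF z] y1_def by (simp add: algebra_simps)
  qed
  have e2: "serre_pow m h 2 z = w z * (y2 z + 2 * (v z * y1 z) + (v1 z + v z ^ 2) * y z)" if z: "z \<in> U" for z
  proof -
    have "serre_pow m h 2 z = serre (m + 2) (serre_pow m h 1) z" by (simp add: numeral_2_eq_2)
    also have "\<dots> = serre (m + 2) (\<lambda>z. w z * (y1 z + v z * y z)) z"
      by (rule serre_cong[OF U(1) z]) (rule e1)
    also have "\<dots> = serre (m + 2) w z * (y1 z + v z * y z) + w z * serre 0 (\<lambda>z. y1 z + v z * y z) z"
      by (rule serre_mult[OF U(1) z w]) (auto intro!: holomorphic_intros hy v y)
    also have "serre 0 (\<lambda>z. y1 z + v z * y z) z = serre 0 y1 z + serre 0 (\<lambda>z. v z * y z) z"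
      by (rule serre_add[OF U(1) z]) (auto intro!: holomorphic_intros hy v y)
    also have "serre 0 (\<lambda>z. v z * y z) z = serre 2 v z * y z + v z * serre (-2) y z"
      by (rule serre_mult[OF U(1) z v y]) simp
    finally show ?thesis unfolding wv[OF z] y1_def y2_def v1_def
      by (simp add: algebra_simps power2_eq_square)
  qed
  show "serre_pow m h 1 z = w z * (y1 z + v z * y z)" by (rule e1[OF z])
  show "serre_pow m h 2 z = w z * (y2 z + 2 * (v z * y1 z) + (v1 z + v z ^ 2) * y z)" by (rule e2[OF z])
  have "serre_pow m h 3 z = serre (m + 4) (serre_pow m h 2) z" by (simp add: numeral_3_eq_3 numeral_2_eq_2)
  also have "\<dots> = serre (m + 4) (\<lambda>z. w z * (y2 z + 2 * (v z * y1 z) + (v1 z + v z * v z) * y z)) z"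
    by (rule serre_cong[OF U(1) z]) (use e2 in \<open>simp add: power2_eq_square\<close>)
  also have "\<dots> = serre (m + 2) w z * (y2 z + 2 * (v z * y1 z) + (v1 z + v z * v z) * y z)
       + w z * serre 2 (\<lambda>z. y2 z + 2 * (v z * y1 z) + (v1 z + v z * v z) * y z) z"
    by (rule serre_mult[OF U(1) z w]) (auto intro!: holomorphic_intros hy v y)
  also have "serre 2 (\<lambda>z. y2 z + 2 * (v z * y1 z) + (v1 z + v z * v z) * y z) z =
       serre 2 (\<lambda>z. y2 z + 2 * (v z * y1 z)) z + serre 2 (\<lambda>z. (v1 z + v z * v z) * y z) z"
    by (rule serre_add[OF U(1) z]) (auto intro!: holomorphic_intros hy v y)
  also have "serre 2 (\<lambda>z. y2 z + 2 * (v z * y1 z)) z = serre 2 y2 z + serre 2 (\<lambda>z. 2 * (v z * y1 z)) z"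
    by (rule serre_add[OF U(1) z]) (auto intro!: holomorphic_intros hy v y)
  also have "serre 2 (\<lambda>z. 2 * (v z * y1 z)) z = 2 * serre 2 (\<lambda>z. v z * y1 z) z"
    by (rule serre_cmult[OF U(1) z]) (auto intro!: holomorphic_intros hy v y)
  also have "serre 2 (\<lambda>z. v z * y1 z) z = serre 2 v z * y1 z + v z * serre 0 y1 z"
    by (rule serre_mult[OF U(1) z v hy(1)]) simp
  also have "serre 2 (\<lambda>z. (v1 z + v z * v z) * y z) z =
      serre 4 (\<lambda>z. v1 z + v z * v z) z * y z + (v1 z + v z * v z) * serre (-2) y z"
    by (rule serre_mult[OF U(1) z]) (auto intro!: holomorphic_intros hy v y)
  also have "serre 4 (\<lambda>z. v1 z + v z * v z) z = serre 4 v1 z + serre 4 (\<lambda>z. v z * v z) z"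
    by (rule serre_add[OF U(1) z]) (auto intro!: holomorphic_intros hy v y)
  also have "serre 4 (\<lambda>z. v z * v z) z = serre 2 v z * v z + v z * serre 2 v z"
    by (rule serre_mult[OF U(1) z v v]) simp
  moreover have "serre 0 y1 = y2" "serre (-2) y = y1" "serre 2 y2 = y3" "serre 2 v = v1" "serre 4 v1 = v2"
    by (simp_all add: y1_def y2_def y3_def v1_def v2_def)
  ultimately show "serre_pow m h 3 z = w z * (y3 z + 3 * v z * y2 z + 3 * (v1 z + v z ^ 2) * y1 z
             + (v2 z + 3 * v z * v1 z + v z ^ 3) * y z)"
    unfolding wv[OF z] by (simp add: algebra_simps power2_eq_square power3_eq_cube)
qed

text \<open>Passage from Serre derivatives to ordinary ones on functions of weight \<open>-2\<close>. By Ramanujan's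
  equations \<open>E2\<close> cancels up to the combination in which \<open>Q\<close> appears together with half of its
  derivative.\<close>

lemma serre_equation_to_Dq:
  assumes U: "open U" "U \<subseteq> \<H>" and y: "y holomorphic_on U" and P: "P holomorphic_on U" and z: "z \<in> U"
    and eq: "serre 2 (serre 0 (serre (-2) y)) z + P z * serre (-2) y z + T * y z = 0"
  shows "Dq (Dq (Dq y)) z + (P z - E4 z / 36) * Dq y z
           + (1 / 2 * Dq (\<lambda>z. P z - E4 z / 36) z + (T - 1 / 2 * serre 4 P z)) * y z = 0"
proof -
  have zH: "Im z > 0" if "z \<in> U" for z using U(2) that by auto
  have hE: "E2 holomorphic_on U" "E4 holomorphic_on U"
    using U(2) by (auto intro: holomorphic_on_subset[OF holomorphic_E2] holomorphic_on_subset[OF holomorphic_E4])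
  have D: "(F has_field_derivative twopii * Dq F z) (at z)" if "F holomorphic_on U" "z \<in> U" for F z
    using has_field_derivative_Dq[OF that(1) U(1) that(2)] by simp
  have hy: "Dq y holomorphic_on U" "Dq (Dq y) holomorphic_on U"
    by (intro holomorphic_intros y U)+
  have y2: "serre 0 (serre (-2) y) z = Dq (Dq y) z + E2 z / 6 * Dq y z + (E2 z ^ 2 - E4 z) / 72 * y z" if z: "z \<in> U" for z
  proof -
    have "serre (-2) y = (\<lambda>z. Dq y z + 1 / 6 * (E2 z * y z))" by (simp add: serre_def fun_eq_iff)
    hence "serre 0 (serre (-2) y) z = Dq (\<lambda>z. Dq y z + 1 / 6 * (E2 z * y z)) z"
      by (simp only: serre_def[of 0]) simp
    also have "\<dots> = Dq (Dq y) z + 1 / 6 * (Dq E2 z * y z + E2 z * Dq y z)"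
      by (rule Dq_eqI) (rule derivative_eq_intros D[OF y z] D[OF hy(1) z] D[OF hE(1) z] refl | simp add: algebra_simps)+
    also have "\<dots> = Dq (Dq y) z + E2 z / 6 * Dq y z + (E2 z ^ 2 - E4 z) / 72 * y z"
      unfolding Ramanujan(1)[OF zH[OF z]] by (simp add: field_simps)
    finally show ?thesis .
  qed
  have y3: "serre 2 (serre 0 (serre (-2) y)) z = Dq (Dq (Dq y)) z - E4 z / 36 * Dq y z - Dq E4 z / 72 * y z"
  proof -
    have "Dq (serre 0 (serre (-2) y)) z = Dq (\<lambda>z. Dq (Dq y) z + 1 / 6 * (E2 z * Dq y z) + 1 / 72 * ((E2 z * E2 z - E4 z) * y z)) z"
      by (rule Dq_cong[OF _ U(1) z]) (simp add: y2 power2_eq_square)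
    also have "\<dots> = Dq (Dq (Dq y)) z + 1 / 6 * (Dq E2 z * Dq y z + E2 z * Dq (Dq y) z)
        + 1 / 72 * ((2 * E2 z * Dq E2 z - Dq E4 z) * y z + (E2 z * E2 z - E4 z) * Dq y z)"
      by (rule Dq_eqI) (rule derivative_eq_intros D[OF y z] D[OF hy(1) z] D[OF hy(2) z] D[OF hE(1) z] D[OF hE(2) z] refl | simp add: algebra_simps)+
    finally have *: "serre 2 (serre 0 (serre (-2) y)) z = Dq (Dq (Dq y)) z + 1 / 6 * (Dq E2 z * Dq y z + E2 z * Dq (Dq y) z)
        + 1 / 72 * ((2 * E2 z * Dq E2 z - Dq E4 z) * y z + (E2 z * E2 z - E4 z) * Dq y z)
        - 1 / 6 * E2 z * (Dq (Dq y) z + E2 z / 6 * Dq y z + (E2 z ^ 2 - E4 z) / 72 * y z)"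
      by (subst serre_def) (simp add: y2[OF z])
    show ?thesis unfolding * Ramanujan(1)[OF zH[OF z]] by (simp add: field_simps power2_eq_square)
  qed
  have DP: "Dq (\<lambda>z. P z - E4 z / 36) z = Dq P z - Dq E4 z / 36"
    by (rule Dq_eqI) (rule derivative_eq_intros D[OF P z] D[OF hE(2) z] refl | simp add: algebra_simps)+
  have y1: "serre (-2) y z = Dq y z + E2 z / 6 * y z" by (simp add: serre_def)
  have P4: "serre 4 P z = Dq P z - E2 z / 3 * P z" by (simp add: serre_def)
  show ?thesis using eq unfolding y3 DP y1 P4 by (simp add: field_simps)
qed

lemma equation_for_quotient_0:
  assumes U: "open U" "U \<subseteq> \<H>" and w: "w holomorphic_on U" and y: "y holomorphic_on U"
    and h: "\<And>z. z \<in> U \<Longrightarrow> h z = w z * y z" and wv: "\<And>z. z \<in> U \<Longrightarrow> serre (m + 2) w z = 0"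
    and z: "z \<in> U" and wz: "w z \<noteq> 0"
    and eq: "serre_pow m h 3 z + (1 / 36 - of_nat N ^ 2 / 3) * E4 z * serre_pow m h 1 z
         - ((1 / 36 - of_nat N ^ 2 / 3) / 6 + 2 / 27 * of_nat N ^ 3) * E6 z * h z = 0"
  defines "Qs \<equiv> \<lambda>z. - (of_nat N ^ 2 / 3) * E4 z"
  shows "Dq (Dq (Dq y)) z + Qs z * Dq y z + (1 / 2 * Dq Qs z + (- (2 / 27 * of_nat N ^ 3) * E6 z)) * y z = 0"
proof -
  define g :: complex where "g = 1 / 36 - of_nat N ^ 2 / 3"
  have s0: "serre M (\<lambda>_. 0) = (\<lambda>_. 0)" for M by (simp add: serre_def fun_eq_iff)
  have v: "(\<lambda>_. 0 :: complex) holomorphic_on U" by simp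
  have wv': "serre (m + 2) w z = 0 * w z" if "z \<in> U" for z using wv[OF that] by simp
  note pw = serre_pow_quotient[OF U w y v h wv' z, unfolded s0]
  have x1: "serre_pow m h 1 z = w z * serre (-2) y z"
    and x3: "serre_pow m h 3 z = w z * serre 2 (serre 0 (serre (-2) y)) z"
    using pw by (simp_all del: serre_pow.simps One_nat_def)
  have zH: "Im z > 0" using U(2) z by auto
  have hE4: "E4 holomorphic_on U" using holomorphic_on_subset[OF holomorphic_E4 U(2)] .
  have "w z * (serre 2 (serre 0 (serre (-2) y)) z + g * E4 z * serre (-2) y z
          + - ((g / 6 + 2 / 27 * of_nat N ^ 3) * E6 z) * y z) =
        w z * serre 2 (serre 0 (serre (-2) y)) z + g * E4 z * (w z * serre (-2) y z)
          - (g / 6 + 2 / 27 * of_nat N ^ 3) * E6 z * (w z * y z)"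
    by (simp add: algebra_simps)
  also have "\<dots> = 0"
    using eq unfolding x1 x3 h[OF z] g_def .
  finally have "serre 2 (serre 0 (serre (-2) y)) z + g * E4 z * serre (-2) y z
          + - ((g / 6 + 2 / 27 * of_nat N ^ 3) * E6 z) * y z = 0" using wz by simp
  from serre_equation_to_Dq[where P = "\<lambda>z. g * E4 z", OF U y _ z this]
  have *: "Dq (Dq (Dq y)) z + (g * E4 z - E4 z / 36) * Dq y z
    + (1 / 2 * Dq (\<lambda>z. g * E4 z - E4 z / 36) z
        + (- ((g / 6 + 2 / 27 * of_nat N ^ 3) * E6 z) - 1 / 2 * serre 4 (\<lambda>z. g * E4 z) z)) * y z = 0"
    using hE4 by (simp add: holomorphic_on_mult)
  have 1: "(\<lambda>z. g * E4 z - E4 z / 36) = Qs" by (simp add: fun_eq_iff Qs_def g_def algebra_simps)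
  have "serre 4 (\<lambda>z. g * E4 z) z = g * (- E6 z / 3)"
    using serre_cmult[OF U(1) z hE4, of 4 g] serre_E4[OF zH] by simp
  hence 2: "- ((g / 6 + 2 / 27 * of_nat N ^ 3) * E6 z) - 1 / 2 * serre 4 (\<lambda>z. g * E4 z) z = - (2 / 27 * of_nat N ^ 3) * E6 z"
    by (simp add: field_simps)
  show ?thesis using * unfolding 2 fun_cong[OF 1] 1 .
qed

text \<open>With \<open>t = 1 / E6\<close>, a form of weight \<open>-6\<close>, everything becomes a polynomial in \<open>E4\<close>, \<open>E6\<close> and \<open>t\<close>, and
  \<open>E2\<close> disappears from all Serre derivatives.\<close>

lemma equation_for_quotient_2:
  assumes U: "open U" "U \<subseteq> \<H>" and w: "w holomorphic_on U" and y: "y holomorphic_on U"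
    and h: "\<And>z. z \<in> U \<Longrightarrow> h z = w z * y z"
    and E6: "\<And>z. z \<in> U \<Longrightarrow> E6 z \<noteq> 0"
    and wv: "\<And>z. z \<in> U \<Longrightarrow> serre (m + 2) w z = - (E4 z ^ 2 / (6 * E6 z)) * w z"
    and z: "z \<in> U" and wz: "w z \<noteq> 0"
    and eq: "E6 z * serre_pow m h 3 z + E4 z ^ 2 / 2 * serre_pow m h 2 z
         + (1 / 36 - of_nat N ^ 2 / 3) * (E4 z * E6 z) * serre_pow m h 1 z
         - ((2 / 27 * of_nat N ^ 3 + (1 / 36 - of_nat N ^ 2 / 3) / 2) * E6 z ^ 2
              - (1 / 36 - of_nat N ^ 2 / 3) / 2 * E4 z ^ 3) * h z = 0"
  defines "Qs \<equiv> \<lambda>z. - (of_nat N ^ 2 / 3) * E4 z - 1 / 3 * (E4 z * (E4 z ^ 3 - E6 z ^ 2) / E6 z ^ 2)"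
    and "Rs \<equiv> \<lambda>z. - (2 / 27 * of_nat N ^ 3) * E6 z + 5 / 54 * ((E4 z ^ 3 - E6 z ^ 2) ^ 2 / E6 z ^ 3)
                          + (12 - 16 * of_nat N ^ 2) / 144 * ((E4 z ^ 3 - E6 z ^ 2) / E6 z)"
  shows "Dq (Dq (Dq y)) z + Qs z * Dq y z + (1 / 2 * Dq Qs z + Rs z) * y z = 0"
proof -
  define g :: complex where "g = 1 / 36 - of_nat N ^ 2 / 3"
  define t where "t = (\<lambda>z. 1 / E6 z)"
  have t: "E6 z * t z = 1" if "z \<in> U" for z using E6[OF that] by (simp add: t_def)
  have zH: "Im z > 0" if "z \<in> U" for z using U(2) that by auto
  have hE: "E4 holomorphic_on U" "E6 holomorphic_on U"
    using U(2) by (auto intro: holomorphic_on_subset[OF holomorphic_E4] holomorphic_on_subset[OF holomorphic_E6])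
  have ht: "t holomorphic_on U" unfolding t_def by (intro holomorphic_intros hE E6)
  have D: "(F has_field_derivative twopii * Dq F z) (at z)" if "F holomorphic_on U" "z \<in> U" for F z
    using has_field_derivative_Dq[OF that(1) U(1) that(2)] by simp
  have Dt: "Dq t z = - (E2 z * t z - E4 z ^ 2 * t z ^ 2) / 2" if "z \<in> U" for z
  proof -
    have "Dq t z = (0 * E6 z - 1 * Dq E6 z) / E6 z ^ 2"
      unfolding t_def by (subst Dq_divide[OF U(1) that _ hE(2)]) (use E6[OF that] in auto)
    also have "\<dots> = - ((E2 z * E6 z - E4 z ^ 2) / 2) * t z ^ 2"
      unfolding Ramanujan(3)[OF zH[OF that]] by (simp add: t_def power_divide)
    also have "\<dots> = - (E2 z * (E6 z * t z) * t z - E4 z ^ 2 * t z ^ 2) / 2"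
      by (simp add: power2_eq_square field_simps)
    finally show ?thesis unfolding t[OF that] by simp
  qed
  note D4 = D[OF hE(1)] and Dt' = D[OF ht]
  define v where "v = (\<lambda>z. - (1 / 6) * (E4 z ^ 2 * t z))"
  define v1 where "v1 = (\<lambda>z. 1 / 9 * E4 z - 1 / 12 * (E4 z ^ 4 * t z ^ 2))"
  define P where "P = (\<lambda>z. (1 / 3 + g) * E4 z - 1 / 3 * (E4 z ^ 4 * t z ^ 2))"
  have hv: "v holomorphic_on U" "P holomorphic_on U"
    unfolding v_def P_def by (intro holomorphic_intros hE ht)+
  have s1: "serre 2 v z = v1 z" if z: "z \<in> U" for z
  proof -
    have "Dq v z = - (1 / 6) * (2 * E4 z * Dq E4 z * t z + E4 z ^ 2 * Dq t z)"
      unfolding v_def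
      by (rule Dq_eqI) (rule derivative_eq_intros D4[OF z] Dt'[OF z] refl | simp add: algebra_simps)+
    hence "serre 2 v z = - (1 / 6) * (2 * E4 z * Dq E4 z * t z + E4 z ^ 2 * Dq t z)
             - of_int 2 / 12 * E2 z * (- (1 / 6) * (E4 z ^ 2 * t z))"
      by (simp only: serre_def v_def)
    also have "\<dots> = 1 / 9 * (E4 z * (E6 z * t z)) - 1 / 12 * (E4 z ^ 4 * t z ^ 2)"
      unfolding Dt[OF z] Ramanujan(2)[OF zH[OF z]]
      by (simp add: field_simps power2_eq_square power4_eq_xxxx)
    finally show ?thesis unfolding t[OF z] v1_def by simp
  qed
  have v2: "serre 4 (serre 2 v) z = - (1 / 27) * E6 z + 1 / 9 * (E4 z ^ 3 * t z) - 1 / 12 * (E4 z ^ 6 * t z ^ 3)"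
  proof -
    have "Dq v1 z = 1 / 9 * Dq E4 z - 1 / 12 * (4 * E4 z ^ 3 * Dq E4 z * t z ^ 2 + E4 z ^ 4 * (2 * t z * Dq t z))"
      unfolding v1_def
      by (rule Dq_eqI) (rule derivative_eq_intros D4[OF z] Dt'[OF z] refl | simp add: algebra_simps)+
    hence "serre 4 v1 z = 1 / 9 * Dq E4 z - 1 / 12 * (4 * E4 z ^ 3 * Dq E4 z * t z ^ 2 + E4 z ^ 4 * (2 * t z * Dq t z))
             - of_int 4 / 12 * E2 z * (1 / 9 * E4 z - 1 / 12 * (E4 z ^ 4 * t z ^ 2))"
      by (simp only: serre_def v1_def)
    also have "\<dots> = - (1 / 27) * E6 z + 1 / 9 * (E4 z ^ 3 * t z * (E6 z * t z)) - 1 / 12 * (E4 z ^ 6 * t z ^ 3)"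
      unfolding Dt[OF z] Ramanujan(2)[OF zH[OF z]] by (simp add: field_simps eval_nat_numeral)
    finally show ?thesis using serre_cong[OF U(1) z, of "serre 2 v" v1, OF s1] unfolding t[OF z] by simp
  qed
  have sP: "serre 4 P z = - (1 / 3 + g) / 3 * E6 z - 1 / 3 * (E4 z ^ 6 * t z ^ 3 - 4 / 3 * (E4 z ^ 3 * t z))"
  proof -
    have "Dq P z = (1 / 3 + g) * Dq E4 z - 1 / 3 * (4 * E4 z ^ 3 * Dq E4 z * t z ^ 2 + E4 z ^ 4 * (2 * t z * Dq t z))"
      unfolding P_def
      by (rule Dq_eqI) (rule derivative_eq_intros D4[OF z] Dt'[OF z] refl | simp add: algebra_simps)+
    hence "serre 4 P z = (1 / 3 + g) * Dq E4 z - 1 / 3 * (4 * E4 z ^ 3 * Dq E4 z * t z ^ 2 + E4 z ^ 4 * (2 * t z * Dq t z))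
             - of_int 4 / 12 * E2 z * ((1 / 3 + g) * E4 z - 1 / 3 * (E4 z ^ 4 * t z ^ 2))"
      by (simp only: serre_def P_def)
    also have "\<dots> = - (1 / 3 + g) / 3 * E6 z - 1 / 3 * (E4 z ^ 6 * t z ^ 3 - 4 / 3 * (E4 z ^ 3 * t z * (E6 z * t z)))"
      unfolding Dt[OF z] Ramanujan(2)[OF zH[OF z]] by (simp add: field_simps eval_nat_numeral)
    finally show ?thesis unfolding t[OF z] by simp
  qed
  have wv': "serre (m + 2) w z = v z * w z" if "z \<in> U" for z
    using wv[OF that] by (simp add: v_def t_def field_simps)
  note pw = serre_pow_quotient[OF U w y hv(1) h wv' z]
  define y1 y2 y3 where "y1 = serre (-2) y z" and "y2 = serre 0 (serre (-2) y) z"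
    and "y3 = serre 2 (serre 0 (serre (-2) y)) z"
  define V V1 V2 where "V = v z" and "V1 = v1 z" and "V2 = serre 4 (serre 2 v) z"
  define e :: complex where "e = 2 / 27 * of_nat N ^ 3 + g / 2"
  define T where "T = V2 - 2 * V ^ 3 + g * E4 z * V - (e * E6 z - g / 2 * (E4 z ^ 3 * t z))"
  have x1: "serre_pow m h 1 z = w z * (y1 + V * y z)"
    and x2: "serre_pow m h 2 z = w z * (y2 + 2 * (V * y1) + (V1 + V ^ 2) * y z)"
    and x3: "serre_pow m h 3 z = w z * (y3 + 3 * V * y2 + 3 * (V1 + V ^ 2) * y1 + (V2 + 3 * V * V1 + V ^ 3) * y z)"
    using pw by (simp_all only: y1_def y2_def y3_def V_def V1_def V2_def s1[OF z])
  have Pz: "P z = 3 * V1 - 3 * V ^ 2 + g * E4 z"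
    by (simp add: P_def V1_def V_def v1_def v_def field_simps eval_nat_numeral)
  have E4sq: "E4 z ^ 2 / 2 = E6 z * (- 3 * V)"
    using E6[OF z] by (simp add: V_def v_def t_def)
  have E4cb: "E4 z ^ 3 = E6 z * (E4 z ^ 3 * t z)" using E6[OF z] by (simp add: t_def)
  have "E6 z * w z * (y3 + P z * y1 + T * y z) =
     E6 z * serre_pow m h 3 z + E6 z * (- 3 * V) * serre_pow m h 2 z + g * (E4 z * E6 z) * serre_pow m h 1 z
       - (e * E6 z ^ 2 - g / 2 * (E6 z * (E4 z ^ 3 * t z))) * (w z * y z)"
    unfolding x1 x2 x3 Pz T_def by (simp add: algebra_simps power2_eq_square power3_eq_cube)
  also have "\<dots> = 0"
    using eq unfolding E4sq [symmetric] E4cb [symmetric] h[OF z] g_def e_def .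
  finally have "y3 + P z * y1 + T * y z = 0" using wz E6[OF z] by simp
  from serre_equation_to_Dq[OF U y hv(2) z this[unfolded y1_def y3_def]]
  have *: "Dq (Dq (Dq y)) z + (P z - E4 z / 36) * Dq y z
    + (1 / 2 * Dq (\<lambda>z. P z - E4 z / 36) z + (T - 1 / 2 * serre 4 P z)) * y z = 0" .
  have PQ: "P z - E4 z / 36 = Qs z" if "z \<in> U" for z
    using E6[OF that] by (simp add: P_def Qs_def g_def t_def field_simps eval_nat_numeral)
  have "Dq (\<lambda>z. P z - E4 z / 36) z = Dq Qs z" by (rule Dq_cong[OF _ U(1) z]) (rule PQ)
  moreover have "T - 1 / 2 * serre 4 P z = Rs z"
  proof -
    have "(E4 z ^ 3 - E6 z ^ 2) ^ 2 / E6 z ^ 3 = E4 z ^ 6 * t z ^ 3 - 2 * (E4 z ^ 3 * t z) + E6 z"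
      "(E4 z ^ 3 - E6 z ^ 2) / E6 z = E4 z ^ 3 * t z - E6 z"
      using E6[OF z] by (simp_all add: t_def field_simps eval_nat_numeral)
    hence Rz: "Rs z = - (2 / 27 * of_nat N ^ 3) * E6 z + 5 / 54 * (E4 z ^ 6 * t z ^ 3 - 2 * (E4 z ^ 3 * t z) + E6 z)
                 + (12 - 16 * of_nat N ^ 2) / 144 * (E4 z ^ 3 * t z - E6 z)"
      by (simp only: Rs_def)
    have Vz: "V = - (1 / 6) * (E4 z ^ 2 * t z)" by (simp only: V_def v_def)
    have V2z: "V2 = - (1 / 27) * E6 z + 1 / 9 * (E4 z ^ 3 * t z) - 1 / 12 * (E4 z ^ 6 * t z ^ 3)"
      unfolding V2_def by (rule v2)
    show ?thesis
      unfolding Rz T_def V2z Vz sP e_def g_def by (simp add: field_simps eval_nat_numeral)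
  qed
  ultimately show ?thesis using * PQ[OF z] by simp
qed

section \<open>The coefficients as quotients of determinants\<close>

lemma minor_Dq_mult:
  assumes "open U" "w holomorphic_on U" "y1 holomorphic_on U" "y2 holomorphic_on U" "y3 holomorphic_on U" "z \<in> U"
  shows "minor (\<lambda>j. (Dq ^^ j) (\<lambda>z. w z * y1 z) z) (\<lambda>j. (Dq ^^ j) (\<lambda>z. w z * y2 z) z) (\<lambda>j. (Dq ^^ j) (\<lambda>z. w z * y3 z) z) 0 1 2 =
         w z ^ 3 * minor (\<lambda>j. (Dq ^^ j) y1 z) (\<lambda>j. (Dq ^^ j) y2 z) (\<lambda>j. (Dq ^^ j) y3 z) 0 1 2"
proof -
  have d1: "(Dq ^^ 1) (\<lambda>z. w z * y z) x = Dq w x * (Dq ^^ 0) y x + w x * (Dq ^^ 1) y x" if "y holomorphic_on U" "x \<in> U" for y x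
    using Dq_mult[OF assms(1) that(2) assms(2) that(1)] by simp
  have d2: "(Dq ^^ 2) (\<lambda>z. w z * y z) z = Dq (Dq w) z * (Dq ^^ 0) y z + 2 * Dq w z * (Dq ^^ 1) y z + w z * (Dq ^^ 2) y z"
    if y: "y holomorphic_on U" for y
  proof -
    have "Dq (Dq (\<lambda>z. w z * y z)) z = Dq (\<lambda>z. Dq w z * y z + w z * Dq y z) z"
      by (rule Dq_cong[OF _ assms(1,6)]) (use d1[OF y] in simp)
    also have "\<dots> = Dq (\<lambda>z. Dq w z * y z) z + Dq (\<lambda>z. w z * Dq y z) z"
      by (rule Dq_add[OF assms(1,6)]) (auto intro!: holomorphic_intros assms y)
    also have "Dq (\<lambda>z. Dq w z * y z) z = Dq (Dq w) z * y z + Dq w z * Dq y z"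
      by (rule Dq_mult[OF assms(1,6)]) (auto intro!: holomorphic_intros assms y)
    also have "Dq (\<lambda>z. w z * Dq y z) z = Dq w z * Dq y z + w z * Dq (Dq y) z"
      by (rule Dq_mult[OF assms(1,6)]) (auto intro!: holomorphic_intros assms y)
    finally show ?thesis by (simp add: numeral_2_eq_2)
  qed
  have d0: "(Dq ^^ 0) (\<lambda>z. w z * y z) z = w z * (Dq ^^ 0) y z" for y by simp
  show ?thesis
    unfolding minor_def d2[OF assms(3)] d2[OF assms(4)] d2[OF assms(5)]
      d1[OF assms(3,6)] d1[OF assms(4,6)] d1[OF assms(5,6)] d0
    by (simp add: algebra_simps power3_eq_cube)
qed

text \<open>The first two members of a fundamental system determine the coefficients, by Cramer's rule.
  Their Wronskian may have zeros, but only isolated ones: where it vanishes identically, so does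
  the Wronskian of all three functions.\<close>

lemma coefficients_eq:
  assumes U: "open U" and y: "y1 holomorphic_on U" "y2 holomorphic_on U" "y3 holomorphic_on U"
    and QT: "Qs holomorphic_on U" "T holomorphic_on U"
    and eq: "\<And>z. z \<in> U \<Longrightarrow> Dq (Dq (Dq y1)) z + Qs z * Dq y1 z + T z * y1 z = 0"
            "\<And>z. z \<in> U \<Longrightarrow> Dq (Dq (Dq y2)) z + Qs z * Dq y2 z + T z * y2 z = 0"
    and nz: "\<And>z. z \<in> U \<Longrightarrow> minor (\<lambda>j. (Dq ^^ j) y1 z) (\<lambda>j. (Dq ^^ j) y2 z) (\<lambda>j. (Dq ^^ j) y3 z) 0 1 2 \<noteq> 0"
    and z: "z \<in> U"
  shows "Q2 y1 y2 z = twopii ^ 2 * Qs z" and "Q3 y1 y2 z = twopii ^ 3 * T z"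
proof -
  define N where "N = (\<lambda>z. y1 z * Dq y2 z - Dq y1 z * y2 z)"
  have hN: "N holomorphic_on U" unfolding N_def by (intro holomorphic_intros y U)
  have N0: "eventually (\<lambda>x. N x \<noteq> 0) (at z)"
  proof (rule ccontr)
    assume "\<not> ?thesis"
    hence fr: "frequently (\<lambda>x. N x = 0) (at z)" by (simp add: frequently_def)
    have an: "N analytic_on {z}" using hN U z by (meson analytic_at)
    have "eventually (\<lambda>x. N x = 0) (at z)"
      by (rule not_essential_frequently_0_imp_eventually_0[OF _ _ fr])
         (use an in \<open>auto intro: isolated_singularity_at_analytic not_essential_analytic\<close>)
    hence "eventually (\<lambda>x. N x = 0 \<and> x \<in> U) (at z)"
      using eventually_at_in_open'[OF U z] by eventually_elim simp
    then obtain r where r: "r > 0" "\<And>x. x \<noteq> z \<Longrightarrow> dist x z < r \<Longrightarrow> N x = 0 \<and> x \<in> U"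
      unfolding eventually_at by auto
    define B where "B = ball z r - {z}"
    have inB: "N x = 0 \<and> x \<in> U" if "x \<in> B" for x
      using that by (intro r(2)) (auto simp: B_def dist_commute)
    have B: "open B" "B \<subseteq> U" "\<And>x. x \<in> B \<Longrightarrow> N x = 0"
    proof -
      show "open B" unfolding B_def by (intro open_Diff) auto
    qed (use inB in blast)+
    have "z + of_real (r / 2) \<in> B" using r(1) by (auto simp: B_def dist_norm)
    then obtain b where b: "b \<in> B" by blast
    note yB = y[THEN holomorphic_on_subset, OF B(2)]
    have N1: "y1 x * Dq y2 x = Dq y1 x * y2 x" if "x \<in> B" for x using B(3)[OF that] by (simp add: N_def)
    have N2: "y1 x * Dq (Dq y2) x = Dq (Dq y1) x * y2 x" if "x \<in> B" for x
    proof -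
      have "Dq (\<lambda>x. y1 x * Dq y2 x) x = Dq (\<lambda>x. Dq y1 x * y2 x) x"
        by (rule Dq_cong[OF _ B(1) that]) (rule N1)
      moreover have "Dq (\<lambda>x. y1 x * Dq y2 x) x = Dq y1 x * Dq y2 x + y1 x * Dq (Dq y2) x"
        by (rule Dq_mult[OF B(1) that]) (auto intro!: holomorphic_intros yB B)
      moreover have "Dq (\<lambda>x. Dq y1 x * y2 x) x = Dq (Dq y1) x * y2 x + Dq y1 x * Dq y2 x"
        by (rule Dq_mult[OF B(1) that]) (auto intro!: holomorphic_intros yB B)
      ultimately show ?thesis by (simp add: algebra_simps)
    qed
    define M where "M = (\<lambda>x. Dq y1 x * Dq (Dq y2) x - Dq (Dq y1) x * Dq y2 x)"
    have M0: "M x \<noteq> 0" if x: "x \<in> B" for x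
    proof
      assume M: "M x = 0"
      have "minor (\<lambda>j. (Dq ^^ j) y1 x) (\<lambda>j. (Dq ^^ j) y2 x) (\<lambda>j. (Dq ^^ j) y3 x) 0 1 2 =
         y3 x * M x - Dq y3 x * (y1 x * Dq (Dq y2) x - Dq (Dq y1) x * y2 x) + Dq (Dq y3) x * (y1 x * Dq y2 x - Dq y1 x * y2 x)"
        unfolding minor_def M_def by (simp add: numeral_2_eq_2 algebra_simps)
      also have "\<dots> = 0" using M N1[OF x] N2[OF x] by simp
      finally show False using nz[of x] B(2) x by blast
    qed
    have y10: "y1 x = 0" if x: "x \<in> B" for x
    proof -
      have "y1 x * M x = 0" unfolding M_def using N1[OF x] N2[OF x] by algebra
      thus ?thesis using M0[OF x] by simp
    qed
    have D10: "Dq y1 x = 0" if "x \<in> B" for x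
      using Dq_cong[of B y1 "\<lambda>_. 0", OF y10 B(1) that] by simp
    have "Dq (Dq y1) b = 0"
      using Dq_cong[of B "Dq y1" "\<lambda>_. 0", OF D10 B(1) b] by simp
    hence "M b = 0" using D10[OF b] by (simp add: M_def)
    thus False using M0[OF b] by simp
  qed
  have d: "(deriv ^^ 3) u x = twopii ^ 3 * Dq (Dq (Dq u)) x" "deriv u x = twopii * Dq u x"
    if "u holomorphic_on U" "x \<in> U" for u x
    using deriv_pow_eq_Dq_pow[OF that(1) U that(2), of 3] by (simp_all add: numeral_3_eq_3 deriv_eq_Dq)
  have inU: "eventually (\<lambda>x. x \<in> U) (at z)" by (rule eventually_at_in_open'[OF U z])
  have lim: "(F \<longlongrightarrow> F z) (at z)" if "F holomorphic_on U" for F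
    using holomorphic_on_imp_continuous_on[OF that] U z
    by (simp add: continuous_on_eq_continuous_at isCont_def)
  define k where "k = twopii"
  have k: "k \<noteq> 0" by (simp add: k_def)
  show "Q2 y1 y2 z = twopii ^ 2 * Qs z"
    unfolding Q2_def
  proof (rule remove_sings_eqI, rule Lim_transform_eventually)
    show "((\<lambda>x. twopii ^ 2 * Qs x) \<longlongrightarrow> twopii ^ 2 * Qs z) (at z)" by (intro tendsto_intros lim QT)
    show "eventually (\<lambda>x. twopii ^ 2 * Qs x = ((deriv ^^ 3) y1 x * y2 x - y1 x * (deriv ^^ 3) y2 x) /
                             (y1 x * deriv y2 x - deriv y1 x * y2 x)) (at z)"
      using N0 inU
    proof eventually_elim
      case (elim x)
      have D3: "Dq (Dq (Dq y1)) x = - (Qs x * Dq y1 x + T x * y1 x)" "Dq (Dq (Dq y2)) x = - (Qs x * Dq y2 x + T x * y2 x)"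
        using eq[OF elim(2)] by (simp_all only: eq_neg_iff_add_eq_0 add.assoc)
      have "(deriv ^^ 3) y1 x * y2 x - y1 x * (deriv ^^ 3) y2 x = k ^ 2 * Qs x * (k * N x)"
        unfolding d(1)[OF y(1) elim(2)] d(1)[OF y(2) elim(2)] D3 N_def k_def [symmetric]
        by (simp add: algebra_simps power2_eq_square power3_eq_cube)
      moreover have "y1 x * deriv y2 x - deriv y1 x * y2 x = k * N x"
        unfolding d(2)[OF y(1) elim(2)] d(2)[OF y(2) elim(2)] N_def k_def [symmetric] by (simp add: algebra_simps)
      ultimately show ?case using elim(1) k by (simp add: k_def [symmetric])
    qed
  qed
  show "Q3 y1 y2 z = twopii ^ 3 * T z"
    unfolding Q3_def
  proof (rule remove_sings_eqI, rule Lim_transform_eventually)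
    show "((\<lambda>x. twopii ^ 3 * T x) \<longlongrightarrow> twopii ^ 3 * T z) (at z)" by (intro tendsto_intros lim QT)
    show "eventually (\<lambda>x. twopii ^ 3 * T x = (deriv y1 x * (deriv ^^ 3) y2 x - deriv y2 x * (deriv ^^ 3) y1 x) /
                             (y1 x * deriv y2 x - deriv y1 x * y2 x)) (at z)"
      using N0 inU
    proof eventually_elim
      case (elim x)
      have D3: "Dq (Dq (Dq y1)) x = - (Qs x * Dq y1 x + T x * y1 x)" "Dq (Dq (Dq y2)) x = - (Qs x * Dq y2 x + T x * y2 x)"
        using eq[OF elim(2)] by (simp_all only: eq_neg_iff_add_eq_0 add.assoc)
      have "deriv y1 x * (deriv ^^ 3) y2 x - deriv y2 x * (deriv ^^ 3) y1 x = k ^ 3 * T x * (k * N x)"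
        unfolding d(1)[OF y(1) elim(2)] d(1)[OF y(2) elim(2)] d(2)[OF y(1) elim(2)] d(2)[OF y(2) elim(2)] D3 N_def k_def [symmetric]
        by (simp add: algebra_simps power2_eq_square power3_eq_cube)
      moreover have "y1 x * deriv y2 x - deriv y1 x * y2 x = k * N x"
        unfolding d(2)[OF y(1) elim(2)] d(2)[OF y(2) elim(2)] N_def k_def [symmetric] by (simp add: algebra_simps)
      ultimately show ?case using elim(1) k by (simp add: k_def [symmetric])
    qed
  qed
qed

lemma coeff_eq:
  assumes U: "open U" and y: "y1 holomorphic_on U" "y2 holomorphic_on U" "y3 holomorphic_on U"
    and QR: "Qs holomorphic_on U" "Rs holomorphic_on U"
    and eq: "\<And>y z. y \<in> {y1, y2} \<Longrightarrow> z \<in> U \<Longrightarrow>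
               Dq (Dq (Dq y)) z + Qs z * Dq y z + (1 / 2 * Dq Qs z + Rs z) * y z = 0"
    and nz: "\<And>z. z \<in> U \<Longrightarrow> minor (\<lambda>j. (Dq ^^ j) y1 z) (\<lambda>j. (Dq ^^ j) y2 z) (\<lambda>j. (Dq ^^ j) y3 z) 0 1 2 \<noteq> 0"
    and z: "z \<in> U"
  shows "coeff_Q y1 y2 z = Qs z" and "coeff_R y1 y2 z = Rs z"
proof -
  define T where "T = (\<lambda>z. 1 / 2 * Dq Qs z + Rs z)"
  have hT: "T holomorphic_on U" unfolding T_def by (intro holomorphic_intros QR U)
  have eqs: "Dq (Dq (Dq y1)) z + Qs z * Dq y1 z + T z * y1 z = 0"
    "Dq (Dq (Dq y2)) z + Qs z * Dq y2 z + T z * y2 z = 0" if "z \<in> U" for z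
    using eq[OF _ that] by (simp_all add: T_def)
  have Q2: "Q2 y1 y2 z = twopii ^ 2 * Qs z" if "z \<in> U" for z
    by (rule coefficients_eq(1)[OF U y QR(1) hT eqs nz that])
  have Q3: "Q3 y1 y2 z = twopii ^ 3 * T z"
    by (rule coefficients_eq(2)[OF U y QR(1) hT eqs nz z])
  show "coeff_Q y1 y2 z = Qs z" unfolding coeff_Q_def Q2[OF z] by simp
  have "Dq (Q2 y1 y2) z = Dq (\<lambda>z. twopii ^ 2 * Qs z) z" by (rule Dq_cong[OF Q2 U z])
  also have "\<dots> = twopii ^ 2 * Dq Qs z" by (rule Dq_cmult[OF U z QR(1)])
  finally have "deriv (Q2 y1 y2) z = twopii ^ 3 * Dq Qs z"
    by (simp add: deriv_eq_Dq power2_eq_square power3_eq_cube)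
  hence "coeff_R y1 y2 z = (twopii ^ 3 * T z - 1 / 2 * (twopii ^ 3 * Dq Qs z)) / twopii ^ 3"
    unfolding coeff_R_def Q3 by simp
  also have "\<dots> = T z - 1 / 2 * Dq Qs z" by (simp add: field_simps)
  finally show "coeff_R y1 y2 z = Rs z" by (simp add: T_def)
qed

section \<open>Extremal quasimodular forms of depth 2\<close>

text \<open>The form \<open>f2\<close> of weight \<open>k - 4\<close> is nonzero.\<close>

lemma depth2_weight:
  assumes "quasimodular_decomposition k f f0 f1 f2" "\<exists>z\<in>\<H>. f2 z \<noteq> 0"
  shows "even k" "k \<ge> 4"
proof -
  have f2: "modular_form (k - 4) f2" using assms(1) by (simp add: quasimodular_decomposition_def)
  obtain z where z: "Im z > 0" "f2 z \<noteq> 0" using assms(2) by auto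
  show "even k" using modular_form_odd_weight[OF f2] z(2) by auto
  show "k \<ge> 4" using mform_neg[OF modular_form_imp_mform[OF f2] _ z(1)] z(2) by force
qed

lemma Dq_cube_root:
  assumes "open U" "w holomorphic_on U" "\<And>z. z \<in> U \<Longrightarrow> w z ^ 3 = C z" "\<And>z. z \<in> U \<Longrightarrow> C z \<noteq> 0"
    and "z \<in> U" "Dq C z = 3 * l * C z"
  shows "Dq w z = l * w z"
proof -
  have "Dq C z = Dq (\<lambda>z. w z ^ 3) z" by (rule Dq_cong[OF _ assms(1,5)]) (use assms(3) in simp)
  also have "\<dots> = 3 * w z ^ 2 * Dq w z" using Dq_power[OF assms(1,5,2), of 3] by simp
  finally have "3 * w z ^ 2 * Dq w z = 3 * l * w z ^ 3"
    unfolding assms(3)[OF assms(5)] assms(6) by (rule sym)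
  hence "3 * w z ^ 2 * Dq w z = 3 * w z ^ 2 * (l * w z)"
    by (simp add: power2_eq_square power3_eq_cube mult_ac)
  moreover have "w z \<noteq> 0" using assms(3,4)[OF assms(5)] by auto
  ultimately show ?thesis by simp
qed

theorem theorem6p2:
  fixes k :: int
    and f f0 f1 f2 w g1 g2 g3 Q R :: "complex \<Rightarrow> complex"
    and U :: "complex set"
  assumes decomp: "quasimodular_decomposition k f f0 f1 f2"
    and depth2: "\<exists>z\<in>upper_half_plane. f2 z \<noteq> 0"
    and extremal: "extremal k f"
    and branch: "cube_root_branch U (W f f1 f2) w"
    and g1: "g1 = (\<lambda>z. h1 f f1 f2 z / w z)"
    and g2: "g2 = (\<lambda>z. h2 f f1 f2 z / w z)"
    and g3: "g3 = (\<lambda>z. f z / w z)"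
    and Q: "Q = coeff_Q g1 g2"
    and R: "R = coeff_R g1 g2"
  shows "(\<forall>y\<in>{g1, g2, g3}. \<forall>z\<in>U.
            (Dq ^^ 3) y z + Q z * Dq y z + (1 / 2 * Dq Q z + R z) * y z = 0) \<and>
         (k mod 4 = 0 \<longrightarrow>
            (\<forall>z\<in>U. Q z = - (of_int k ^ 2 / 48) * E4 z \<and>
                   R z = - (of_int k ^ 3 / 864) * E6 z)) \<and>
         (k mod 4 = 2 \<longrightarrow>
            (\<forall>z\<in>U. Q z = - (of_int (k - 2) ^ 2 / 48) * E4 z
                          - 1 / 3 * (E4 z * (E4 z ^ 3 - E6 z ^ 2) / E6 z ^ 2) \<and>
                   R z = - (of_int (k - 2) ^ 3 / 864) * E6 z
                          + 5 / 54 * ((E4 z ^ 3 - E6 z ^ 2) ^ 2 / E6 z ^ 3)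
                          + (12 - of_int (k - 2) ^ 2) / 144 * ((E4 z ^ 3 - E6 z ^ 2) / E6 z)))"
proof (cases "U = {}")
  case False
  have U: "open U" "U \<subseteq> \<H>" and W0: "\<And>z. z \<in> U \<Longrightarrow> W f f1 f2 z \<noteq> 0"
    and hw: "w holomorphic_on U" and w3: "\<And>z. z \<in> U \<Longrightarrow> w z ^ 3 = W f f1 f2 z"
    using branch unfolding cube_root_branch_def by blast+
  have zH: "Im z > 0" if "z \<in> U" for z using U(2) that by auto
  have w0: "w z \<noteq> 0" if "z \<in> U" for z using w3[OF that] W0[OF that] by auto
  obtain zU where zU: "zU \<in> U" using False by blast
  define p where "p = (\<lambda>z. alpha * (f1 z + 2 * f2 z * E2 z))"
  define r where "r = (\<lambda>z. alpha ^ 2 * f2 z)"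
  interpret V: vector_form "k - 2" f p r
    unfolding p_def r_def by (rule vector_form_of_decomposition[OF decomp])
  have u1: "h1 f f1 f2 = V.u1" unfolding V.u1_def unfolding fun_eq_iff h1_def p_def r_def by (simp add: mult_ac)
  have u2: "h2 f f1 f2 = V.u2" unfolding V.u2_def unfolding fun_eq_iff h2_def p_def by simp
  have S012: "V.S 0 1 2 z = minor (\<lambda>j. (Dq ^^ j) V.u1 z) (\<lambda>j. (Dq ^^ j) V.u2 z) (\<lambda>j. (Dq ^^ j) f z) 0 1 2"
    if "Im z > 0" for z
    unfolding V.S_def by (rule minor_serre_eq_minor_Dq[OF V.hol_u V.hol(1) that])
  have WS: "W f f1 f2 z = twopii ^ 3 * V.S 0 1 2 z" if "Im z > 0" for z
    unfolding W_def u1 u2 S012[OF that]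
    by (rule wronskian3_eq_minor[OF V.hol_u V.hol(1) open_upper_half_plane]) (use that in simp)
  have SU: "Im zU > 0" "V.S 0 1 2 zU \<noteq> 0" using WS[OF zH[OF zU]] W0[OF zU] zH[OF zU] by auto
  note even_k = depth2_weight(1)[OF decomp depth2]
  define N where "N = nat (k div 4)"
  define e where "e = (if k mod 4 = 0 then 0 else 1 :: nat)"
  have kmod: "k mod 4 = 0 \<or> k mod 4 = 2" using even_k by presburger
  have intN: "int N = k div 4" and N0: "N > 0"
    using depth2_weight(2)[OF decomp depth2] unfolding N_def by auto
  have "k = 4 * (k div 4) + k mod 4" by simp
  moreover have "k mod 4 = 2 * int e" using kmod by (auto simp: e_def)
  ultimately have kN: "k = 4 * int N + 2 * int e" unfolding intN by linarith
  obtain n where n: "has_order_at_infinity f n" "N \<le> n"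
    by (rule extremal_order_ge[OF extremal kN])
  obtain F a where F: "q_holomorphic F" "(F \<longlongrightarrow> a) at_cusp" "\<And>z. Im z > 0 \<Longrightarrow> f z = nome z ^ n * F z"
    using order_at_infinity_factor[OF n(1)] by metis

  \<comment> \<open>Both cases end alike: any normalized equation satisfied by the three quotients has the
    coefficients \<open>Q\<close> and \<open>R\<close>.\<close>
  have reduce: "(\<forall>y\<in>{g1, g2, g3}. \<forall>z\<in>U. (Dq ^^ 3) y z + Q z * Dq y z + (1 / 2 * Dq Q z + R z) * y z = 0) \<and>
                (\<forall>z\<in>U. Q z = Qs z \<and> R z = Rs z)"
    if QR: "Qs holomorphic_on U" "Rs holomorphic_on U"
      and eq: "\<And>h y z. h \<in> {V.u1, V.u2, f} \<Longrightarrow> y holomorphic_on U \<Longrightarrow> (\<And>z. z \<in> U \<Longrightarrow> h z = w z * y z) \<Longrightarrow> z \<in> U \<Longrightarrow>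
             Dq (Dq (Dq y)) z + Qs z * Dq y z + (1 / 2 * Dq Qs z + Rs z) * y z = 0" for Qs Rs
  proof -
    have hu: "V.u1 holomorphic_on U" "V.u2 holomorphic_on U" "f holomorphic_on U"
      using V.hol_u V.hol(1) U(2) by (auto intro: holomorphic_on_subset)
    have hg: "g1 holomorphic_on U" "g2 holomorphic_on U" "g3 holomorphic_on U"
      unfolding g1 g2 g3 u1 u2 using w0 by (auto intro!: holomorphic_intros hu hw)
    have wg: "V.u1 z = w z * g1 z" "V.u2 z = w z * g2 z" "f z = w z * g3 z" if "z \<in> U" for z
      unfolding g1 g2 g3 u1 u2 using w0[OF that] by simp_all
    have eqs: "Dq (Dq (Dq y)) z + Qs z * Dq y z + (1 / 2 * Dq Qs z + Rs z) * y z = 0" if "y \<in> {g1, g2, g3}" "z \<in> U" for y z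
      using that eq[OF _ hg(1) wg(1), of z] eq[OF _ hg(2) wg(2), of z] eq[OF _ hg(3) wg(3), of z] by auto
    have nz: "minor (\<lambda>j. (Dq ^^ j) g1 z) (\<lambda>j. (Dq ^^ j) g2 z) (\<lambda>j. (Dq ^^ j) g3 z) 0 1 2 \<noteq> 0" if z: "z \<in> U" for z
    proof -
      have it: "(Dq ^^ j) h z = (Dq ^^ j) (\<lambda>z. w z * y z) z" if "\<And>z. z \<in> U \<Longrightarrow> h z = w z * y z" for h y j
        using z
      proof (induction j arbitrary: z)
        case (Suc j)
        have "Dq ((Dq ^^ j) h) z = Dq ((Dq ^^ j) (\<lambda>z. w z * y z)) z"
          by (rule Dq_cong[OF Suc.IH U(1) Suc.prems])
        thus ?case by simp
      qed (use that in simp)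
      have "V.S 0 1 2 z = minor (\<lambda>j. (Dq ^^ j) (\<lambda>z. w z * g1 z) z) (\<lambda>j. (Dq ^^ j) (\<lambda>z. w z * g2 z) z)
                              (\<lambda>j. (Dq ^^ j) (\<lambda>z. w z * g3 z) z) 0 1 2"
        unfolding S012[OF zH[OF z]] minor_def
        by (simp only: it[of V.u1 g1, OF wg(1)] it[of V.u2 g2, OF wg(2)] it[of f g3, OF wg(3)])
      also have "\<dots> = w z ^ 3 * minor (\<lambda>j. (Dq ^^ j) g1 z) (\<lambda>j. (Dq ^^ j) g2 z) (\<lambda>j. (Dq ^^ j) g3 z) 0 1 2"
        by (rule minor_Dq_mult[OF U(1) hw hg z])
      finally have "V.S 0 1 2 z = w z ^ 3 * minor (\<lambda>j. (Dq ^^ j) g1 z) (\<lambda>j. (Dq ^^ j) g2 z) (\<lambda>j. (Dq ^^ j) g3 z) 0 1 2" .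
      moreover have "V.S 0 1 2 z \<noteq> 0" using W0[OF z] WS[OF zH[OF z]] by auto
      ultimately show ?thesis by auto
    qed
    have QRz: "Q z = Qs z" "R z = Rs z" if "z \<in> U" for z
      unfolding Q R using coeff_eq[OF U(1) hg QR eqs nz that] by auto
    have DQ: "Dq Q z = Dq Qs z" if "z \<in> U" for z by (rule Dq_cong[OF QRz(1) U(1) that])
    show ?thesis using eqs QRz DQ by (auto simp: numeral_3_eq_3)
  qed
  have hE: "E4 holomorphic_on U" "E6 holomorphic_on U"
    using U(2) by (auto intro: holomorphic_on_subset[OF holomorphic_E4] holomorphic_on_subset[OF holomorphic_E6])
  have hD: "discriminant holomorphic_on U" using holomorphic_on_subset[OF holomorphic_discriminant U(2)] .
  have DDN: "Dq (\<lambda>z. discriminant z ^ N) z = of_nat N * E2 z * discriminant z ^ N" if "z \<in> U" for z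
    by (rule Dq_discriminant_power[OF zH[OF that]])
  show ?thesis
  proof (cases "k mod 4 = 0")
    case True
    hence "e = 0" by (simp add: e_def)
    hence k: "k = 4 * int N" using kN by linarith
    hence m: "k - 2 = 4 * int N - 2" by simp
    obtain c where c: "c \<noteq> 0" "\<And>z. Im z > 0 \<Longrightarrow> V.S 0 1 2 z = c * discriminant z ^ N"
      using V.equation_weight_0_mod_4(1)[OF m N0 n(2) F SU] by blast
    note eqn = V.equation_weight_0_mod_4(2)[OF m N0 n(2) F SU]
    have "Dq w z = of_nat N / 3 * E2 z * w z" if z: "z \<in> U" for z
    proof (rule Dq_cube_root[OF U(1) hw _ _ z])
      show "w z ^ 3 = (twopii ^ 3 * c) * discriminant z ^ N" if "z \<in> U" for z
        using w3[OF that] WS[OF zH[OF that]] c(2)[OF zH[OF that]] by simp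
      show "(twopii ^ 3 * c) * discriminant z ^ N \<noteq> 0" if "z \<in> U" for z using c(1) by simp
      show "Dq (\<lambda>z. (twopii ^ 3 * c) * discriminant z ^ N) z = 3 * (of_nat N / 3 * E2 z) * ((twopii ^ 3 * c) * discriminant z ^ N)"
        by (subst Dq_cmult[OF U(1) z]) (auto intro!: holomorphic_intros hD simp: DDN[OF z])
    qed
    hence wv: "serre (k - 2 + 2) w z = 0" if "z \<in> U" for z
      using that by (simp add: serre_def k)
    define Qs where "Qs = (\<lambda>z. - (of_nat N ^ 2 / 3) * E4 z)"
    define Rs where "Rs = (\<lambda>z. - (2 / 27 * of_nat N ^ 3) * E6 z)"
    have fin: "(\<forall>y\<in>{g1, g2, g3}. \<forall>z\<in>U. (Dq ^^ 3) y z + Q z * Dq y z + (1 / 2 * Dq Q z + R z) * y z = 0) \<and>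
                (\<forall>z\<in>U. Q z = Qs z \<and> R z = Rs z)"
    proof (rule reduce)
      show "Qs holomorphic_on U" "Rs holomorphic_on U"
        unfolding Qs_def Rs_def by (auto intro!: holomorphic_intros hE)
      fix h y z assume *: "h \<in> {V.u1, V.u2, f}" "y holomorphic_on U" "\<And>z. z \<in> U \<Longrightarrow> h z = w z * y z" "z \<in> U"
      show "Dq (Dq (Dq y)) z + Qs z * Dq y z + (1 / 2 * Dq Qs z + Rs z) * y z = 0"
        unfolding Qs_def Rs_def
        by (rule equation_for_quotient_0[OF U hw *(2,3) wv *(4) w0[OF *(4)] eqn[OF _ *(1) zH[OF *(4)]]])
    qed
    have "of_int k ^ 2 / 48 = (of_nat N ^ 2 / 3 :: complex)" "of_int k ^ 3 / 864 = (2 / 27 * of_nat N ^ 3 :: complex)"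
      unfolding k by (simp_all add: power_mult_distrib)
    thus ?thesis using fin True unfolding Qs_def Rs_def by auto
  next
    case False
    hence k2: "k mod 4 = 2" using kmod by simp
    have "e = 1" using False by (simp add: e_def)
    hence m: "k - 2 = 4 * int N" using kN by linarith
    obtain c where c: "c \<noteq> 0" "\<And>z. Im z > 0 \<Longrightarrow> V.S 0 1 2 z = c * E6 z * discriminant z ^ N"
      using V.equation_weight_2_mod_4(1)[OF m N0 n(2) F SU] by blast
    note eqn = V.equation_weight_2_mod_4(2)[OF m N0 n(2) F SU]
    have E6: "E6 z \<noteq> 0" if "z \<in> U" for z
      using W0[OF that] WS[OF zH[OF that]] c(2)[OF zH[OF that]] by auto
    have Dw: "Dq w z = ((E2 z / 2 - E4 z ^ 2 / (2 * E6 z) + of_nat N * E2 z) / 3) * w z" if z: "z \<in> U" for z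
    proof (rule Dq_cube_root[OF U(1) hw _ _ z])
      show "w z ^ 3 = (twopii ^ 3 * c) * (E6 z * discriminant z ^ N)" if "z \<in> U" for z
        using w3[OF that] WS[OF zH[OF that]] c(2)[OF zH[OF that]] by simp
      show "(twopii ^ 3 * c) * (E6 z * discriminant z ^ N) \<noteq> 0" if "z \<in> U" for z using c(1) E6[OF that] by simp
      have "Dq (\<lambda>z. (twopii ^ 3 * c) * (E6 z * discriminant z ^ N)) z = (twopii ^ 3 * c) * Dq (\<lambda>z. E6 z * discriminant z ^ N) z"
        by (rule Dq_cmult[OF U(1) z]) (auto intro!: holomorphic_intros hD hE)
      also have "Dq (\<lambda>z. E6 z * discriminant z ^ N) z = Dq E6 z * discriminant z ^ N + E6 z * Dq (\<lambda>z. discriminant z ^ N) z"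
        by (rule Dq_mult[OF U(1) z]) (auto intro!: holomorphic_intros hD hE)
      also have "\<dots> = 3 * ((E2 z / 2 - E4 z ^ 2 / (2 * E6 z) + of_nat N * E2 z) / 3) * (E6 z * discriminant z ^ N)"
        unfolding DDN[OF z] Ramanujan(3)[OF zH[OF z]] using E6[OF z] by (simp add: field_simps)
      finally show "Dq (\<lambda>z. (twopii ^ 3 * c) * (E6 z * discriminant z ^ N)) z =
          3 * ((E2 z / 2 - E4 z ^ 2 / (2 * E6 z) + of_nat N * E2 z) / 3) * ((twopii ^ 3 * c) * (E6 z * discriminant z ^ N))"
        by (simp only: mult_ac)
    qed
    have wv: "serre (k - 2 + 2) w z = - (E4 z ^ 2 / (6 * E6 z)) * w z" if "z \<in> U" for z
    proof -
      have "of_int (k - 2 + 2) / 12 = (of_nat N / 3 + 1 / 6 :: complex)" unfolding m by (simp add: field_simps)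
      thus ?thesis unfolding serre_def Dw[OF that] using E6[OF that] by (simp add: field_simps)
    qed
    define Qs where "Qs = (\<lambda>z. - (of_nat N ^ 2 / 3) * E4 z - 1 / 3 * (E4 z * (E4 z ^ 3 - E6 z ^ 2) / E6 z ^ 2))"
    define Rs where "Rs = (\<lambda>z. - (2 / 27 * of_nat N ^ 3) * E6 z + 5 / 54 * ((E4 z ^ 3 - E6 z ^ 2) ^ 2 / E6 z ^ 3)
                 + (12 - 16 * of_nat N ^ 2) / 144 * ((E4 z ^ 3 - E6 z ^ 2) / E6 z))"
    have fin: "(\<forall>y\<in>{g1, g2, g3}. \<forall>z\<in>U. (Dq ^^ 3) y z + Q z * Dq y z + (1 / 2 * Dq Q z + R z) * y z = 0) \<and>
                (\<forall>z\<in>U. Q z = Qs z \<and> R z = Rs z)"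
    proof (rule reduce)
      show "Qs holomorphic_on U" "Rs holomorphic_on U"
        unfolding Qs_def Rs_def using E6 by (auto intro!: holomorphic_intros hE)
      fix h y z assume *: "h \<in> {V.u1, V.u2, f}" "y holomorphic_on U" "\<And>z. z \<in> U \<Longrightarrow> h z = w z * y z" "z \<in> U"
      show "Dq (Dq (Dq y)) z + Qs z * Dq y z + (1 / 2 * Dq Qs z + Rs z) * y z = 0"
        unfolding Qs_def Rs_def
        by (rule equation_for_quotient_2[OF U hw *(2,3) E6 wv *(4) w0[OF *(4)] eqn[OF _ *(1) zH[OF *(4)]]])
    qed
    have "of_int (k - 2) ^ 2 / 48 = (of_nat N ^ 2 / 3 :: complex)" "of_int (k - 2) ^ 3 / 864 = (2 / 27 * of_nat N ^ 3 :: complex)"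
      "of_int (k - 2) ^ 2 = (16 * of_nat N ^ 2 :: complex)"
      unfolding m by (simp_all add: power_mult_distrib)
    thus ?thesis using fin False unfolding Qs_def Rs_def by auto
  qed
qed auto

end
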